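(* (i) Let $\Sigma$ be an LPV-SSA which satisfies the regularity certificate (RC). Then $\Sigma$ is minimal if and only if $\Sigma$ is observable. (ii) Let $\Sigma$ and $\Sigma'$ be two minimal LPV-SSAs which both satisfy RC and which are realizations of the same manifest behavior. Then $\Sigma$ and $\Sigma'$ are isomorphic, i.e. there exists an isomorphism from $\Sigma$ to $\Sigma'$.
   Context: Time axis: $\mathbb{T}=[0,+\infty)$ in continuous time (CT) and $\mathbb{T}=\mathbb{N}=\{0,1,2,\ldots\}$ in discrete time (DT); everything is considered for each of the two cases. The operator $\xi$ is $(\xi z)(t)=\frac{d}{dt}z(t)$ in CT and $(\xi z)(t)=z(t+1)$ in DT. LPV-SSA: given $\mathbb{P}\subseteq\mathbb{R}^{n_{\mathrm p}}$ and matrices $A_i\in\mathbb{R}^{n_{\mathrm x}\times n_{\mathrm x}}$, $B_i\in\mathbb{R}^{n_{\mathrm x}\times n_{\mathrm u}}$, $C_i\in\mathbb{R}^{n_{\mathrm y}\times n_{\mathrm x}}$, $D_i\in\mathbb{R}^{n_{\mathrm y}\times n_{\mathrm u}}$, $i=0,\ldots,n_{\mathrm p}$, put $A(\mathbf{p})=A_0+\sum_{i=1}^{n_{\mathrm p}}A_i\mathbf{p}_i$ for $\mathbf{p}\in\mathbb{P}$, and similarly $B(\mathbf p),C(\mathbf p),D(\mathbf p)$. The LPV-SSA $\Sigma=(\mathbb{P},\{A_i,B_i,C_i,D_i\}_{i=0}^{n_{\mathrm p}})$ is the system $$\xi x(t)=A(p(t))x(t)+B(p(t))u(t),\qquad y(t)=C(p(t))x(t)+D(p(t))u(t).$$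 Its state dimension is $\dim\Sigma=n_{\mathrm x}$ ($n_{\mathrm x}=0$ is allowed). Signal spaces: in DT, $\mathcal{X},\mathcal{Y},\mathcal{U},\mathcal{P}$ are the sets of all functions from $\mathbb{N}$ to $\mathbb{R}^{n_{\mathrm x}},\mathbb{R}^{n_{\mathrm y}},\mathbb{R}^{n_{\mathrm u}},\mathbb{P}$. In CT, $\mathcal{X}$ is the set of absolutely continuous functions $[0,\infty)\to\mathbb{R}^{n_{\mathrm x}}$, and $\mathcal{Y},\mathcal{U},\mathcal{P}$ are the sets of piecewise-continuous functions from $[0,\infty)$ to $\mathbb{R}^{n_{\mathrm y}},\mathbb{R}^{n_{\mathrm u}},\mathbb{P}$; in CT, output functions that agree almost everywhere are identified. A solution of $\Sigma$ is a tuple $(x,y,u,p)\in\mathcal{X}\times\mathcal{Y}\times\mathcal{U}\times\mathcal{P}$ satisfying the equations for almost all $t\in\mathbb{T}$ (CT), respectively all $t\in\mathbb{T}$ (DT). For each $(u,p)\in\mathcal{U}\times\mathcal{P}$ and $x_{\mathrm o}\in\mathbb{R}^{n_{\mathrm x}}$ there is a unique solution with $x(0)=x_{\mathrm o}$. Manifest behavior: $\mathcal{B}(\Sigma)=\{(y,u,p)\in\mathcal{Y}\times\mathcal{U}\times\mathcal{P}\mid \exists x\in\mathcal{X}: (x,y,u,p)\text{ is a solution of }\Sigma\}$. A manifest behavior is any subset $\mathcal{B}\subseteq\mathcal{Y}\times\mathcal{U}\times\mathcal{P}$; $\Sigma$ is a realization of $\mathcal{B}$ if $\mathcal{B}=\mathcal{B}(\Sigma)$.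 Minimality: $\Sigma$ is a minimal realization of $\mathcal{B}$ if it is a realization of $\mathcal{B}$ and $\dim\Sigma\le\dim\Sigma'$ for every LPV-SSA $\Sigma'$ that is a realization of $\mathcal{B}$ (here $\Sigma'$ is not required to satisfy RC). $\Sigma$ is minimal if it is a minimal realization of $\mathcal{B}(\Sigma)$. Observability: let $\mathfrak{Y}_{\Sigma,x_{\mathrm o}}:\mathcal{U}\times\mathcal{P}\to\mathcal{Y}$ map $(u,p)$ to the output $y$ of the solution $(x,y,u,p)$ with $x(0)=x_{\mathrm o}$. $\Sigma$ is observable if for all $x_1,x_2\in\mathbb{R}^{n_{\mathrm x}}$, $x_1\neq x_2$ implies $\mathfrak{Y}_{\Sigma,x_1}\neq\mathfrak{Y}_{\Sigma,x_2}$. Isomorphism: for $\Sigma=(\mathbb{P},\{A_i,B_i,C_i,D_i\}_{i=0}^{n_{\mathrm p}})$ and $\Sigma'=(\mathbb{P},\{A'_i,B'_i,C'_i,D'_i\}_{i=0}^{n_{\mathrm p}})$ with $\dim\Sigma=\dim\Sigma'=n_{\mathrm x}$, an isomorphism from $\Sigma$ to $\Sigma'$ is a nonsingular (constant) matrix $T\in\mathbb{R}^{n_{\mathrm x}\times n_{\mathrm x}}$ with $A'_iT=TA_i$, $B'_i=TB_i$, $C'_iT=C_i$, $D'_i=D_i$ for $i=0,\ldots,n_{\mathrm p}$. Regularity certificate (RC): $\Sigma$ satisfies RC if (1) $\mathbb{P}$ is convex with non-empty interior, and (2) in the DT case, $A(\mathbf{p})$ is invertible for all $\mathbf{p}\in\mathbb{P}$.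 *)

theory Defs
  imports "HOL-Analysis.Analysis" "Jordan_Normal_Form.Matrix"
begin

(* State dimensions vary inside the notion of minimality, so states, inputs and outputs are
   carrier-based vectors.  The scheduling space R^np is real^'p with np = CARD('p).
   Both vector types use the infix $, hence the explicit vec_nth and vec_index below.
   A matrix family M_0, ..., M_np is indexed by 'p option: None stands for the index 0 and
   Some i for the index of the i-th scheduling component. *)
record ('p::finite) lpv_ssa =
  sched :: "(real ^ 'p) set"
  xdim :: nat
  udim :: nat
  ydim :: nat
  Am :: "'p option \<Rightarrow> real mat"
  Bm :: "'p option \<Rightarrow> real mat"
  Cm :: "'p option \<Rightarrow> real mat"
  Dm :: "'p option \<Rightarrow> real mat"

definition is_lpv_ssa :: "'p::finite lpv_ssa \<Rightarrow> bool" where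
  "is_lpv_ssa S \<longleftrightarrow> (\<forall>i.
     Am S i \<in> carrier_mat (xdim S) (xdim S) \<and> Bm S i \<in> carrier_mat (xdim S) (udim S) \<and>
     Cm S i \<in> carrier_mat (ydim S) (xdim S) \<and> Dm S i \<in> carrier_mat (ydim S) (udim S))"

definition affine_mat :: "('p::finite option \<Rightarrow> real mat) \<Rightarrow> real ^ 'p \<Rightarrow> real mat" where
  "affine_mat M q = mat (dim_row (M None)) (dim_col (M None))
     (\<lambda>rc. M None $$ rc + (\<Sum>i\<in>UNIV. M (Some i) $$ rc * vec_nth q i))"

definition state_rhs :: "'p::finite lpv_ssa \<Rightarrow> real ^ 'p \<Rightarrow> real Matrix.vec \<Rightarrow> real Matrix.vec \<Rightarrow> real Matrix.vec" where
  "state_rhs S q v w = affine_mat (Am S) q *\<^sub>v v + affine_mat (Bm S) q *\<^sub>v w"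

definition output_rhs :: "'p::finite lpv_ssa \<Rightarrow> real ^ 'p \<Rightarrow> real Matrix.vec \<Rightarrow> real Matrix.vec \<Rightarrow> real Matrix.vec" where
  "output_rhs S q v w = affine_mat (Cm S) q *\<^sub>v v + affine_mat (Dm S) q *\<^sub>v w"

type_synonym ('t, 'p) trajectory =
  "('t \<Rightarrow> real Matrix.vec) \<times> ('t \<Rightarrow> real Matrix.vec) \<times> ('t \<Rightarrow> real Matrix.vec) \<times> ('t \<Rightarrow> real ^ 'p)"

type_synonym ('t, 'p) manifest =
  "(('t \<Rightarrow> real Matrix.vec) \<times> ('t \<Rightarrow> real Matrix.vec) \<times> ('t \<Rightarrow> real ^ 'p)) set"

(* Absolute continuity on every [0,T]: requiring a single delta on the whole half-line would
   exclude solutions of linear systems such as exp. *)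
definition loc_abs_continuous :: "(real \<Rightarrow> real) \<Rightarrow> bool" where
  "loc_abs_continuous f \<longleftrightarrow> (\<forall>T\<ge>0. \<forall>e>0. \<exists>d>0. \<forall>I :: (real \<times> real) set.
     finite I \<longrightarrow> (\<forall>(a, b)\<in>I. 0 \<le> a \<and> a \<le> b \<and> b \<le> T) \<longrightarrow>
     disjoint_family_on (\<lambda>(a, b). {a<..<b}) I \<longrightarrow>
     (\<Sum>(a, b)\<in>I. b - a) < d \<longrightarrow> (\<Sum>(a, b)\<in>I. \<bar>f b - f a\<bar>) < e)"

definition pw_continuous :: "(real \<Rightarrow> 'a::topological_space) \<Rightarrow> bool" where
  "pw_continuous f \<longleftrightarrow>
     (\<forall>T\<ge>0. finite {t \<in> {0..T}. \<not> continuous (at t within {0..}) f}) \<and>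
     (\<forall>t\<ge>0. \<exists>l. (f \<longlongrightarrow> l) (at_right t)) \<and>
     (\<forall>t>0. \<exists>l. (f \<longlongrightarrow> l) (at_left t))"

definition ct_states :: "nat \<Rightarrow> (real \<Rightarrow> real Matrix.vec) set" where
  "ct_states n = {x \<in> {0..} \<rightarrow>\<^sub>E carrier_vec n. \<forall>i<n. loc_abs_continuous (\<lambda>t. vec_index (x t) i)}"

definition ct_signals :: "nat \<Rightarrow> (real \<Rightarrow> real Matrix.vec) set" where
  "ct_signals n = {w \<in> {0..} \<rightarrow>\<^sub>E carrier_vec n. \<forall>i<n. pw_continuous (\<lambda>t. vec_index (w t) i)}"

definition ct_scheds :: "(real ^ 'p::finite) set \<Rightarrow> (real \<Rightarrow> real ^ 'p) set" where
  "ct_scheds P = {p \<in> {0..} \<rightarrow>\<^sub>E P. pw_continuous p}"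

definition ct_solutions :: "'p::finite lpv_ssa \<Rightarrow> (real, 'p) trajectory set" where
  "ct_solutions S = {(x, y, u, p).
     x \<in> ct_states (xdim S) \<and> y \<in> ct_signals (ydim S) \<and>
     u \<in> ct_signals (udim S) \<and> p \<in> ct_scheds (sched S) \<and>
     (AE t in lebesgue. 0 \<le> t \<longrightarrow>
        (\<forall>i<xdim S. ((\<lambda>s. vec_index (x s) i) has_real_derivative
            vec_index (state_rhs S (p t) (x t) (u t)) i) (at t within {0..})) \<and>
        y t = output_rhs S (p t) (x t) (u t))}"

definition dt_solutions :: "'p::finite lpv_ssa \<Rightarrow> (nat, 'p) trajectory set" where
  "dt_solutions S = {(x, y, u, p).
     x \<in> UNIV \<rightarrow> carrier_vec (xdim S) \<and> y \<in> UNIV \<rightarrow> carrier_vec (ydim S) \<and>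
     u \<in> UNIV \<rightarrow> carrier_vec (udim S) \<and> p \<in> UNIV \<rightarrow> sched S \<and>
     (\<forall>t. x (Suc t) = state_rhs S (p t) (x t) (u t) \<and>
          y t = output_rhs S (p t) (x t) (u t))}"

(* The remaining notions are generic in the time axis; sol is ct_solutions or dt_solutions.
   In continuous time a.e.-equal outputs are to be identified.  ct_solutions S is closed under
   changing y within ct_signals on a null set, so manifest_behavior consists of all
   representatives of its elements, and two such behaviors are equal iff their quotients are. *)
definition manifest_behavior ::
  "('p::finite lpv_ssa \<Rightarrow> ('t, 'p) trajectory set) \<Rightarrow> 'p lpv_ssa \<Rightarrow> ('t, 'p) manifest" where
  "manifest_behavior sol S = {(y, u, p). \<exists>x. (x, y, u, p) \<in> sol S}"

definition realization ::
  "('p::finite lpv_ssa \<Rightarrow> ('t, 'p) trajectory set) \<Rightarrow> 'p lpv_ssa \<Rightarrow> ('t, 'p) manifest \<Rightarrow> bool" where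
  "realization sol S B \<longleftrightarrow> is_lpv_ssa S \<and> B = manifest_behavior sol S"

definition minimal_realization ::
  "('p::finite lpv_ssa \<Rightarrow> ('t, 'p) trajectory set) \<Rightarrow> 'p lpv_ssa \<Rightarrow> ('t, 'p) manifest \<Rightarrow> bool" where
  "minimal_realization sol S B \<longleftrightarrow>
     realization sol S B \<and> (\<forall>S'. realization sol S' B \<longrightarrow> xdim S \<le> xdim S')"

definition minimal :: "('p::finite lpv_ssa \<Rightarrow> ('t, 'p) trajectory set) \<Rightarrow> 'p lpv_ssa \<Rightarrow> bool" where
  "minimal sol S \<longleftrightarrow> minimal_realization sol S (manifest_behavior sol S)"

(* The output of the solution starting in x0, given as the set of its representatives: for
   admissible (u, p) this is a singleton in discrete time and one a.e.-equality class of
   ct_signals in continuous time; for all other (u, p) it is empty, so that equality of output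
   maps is equality on admissible (u, p). *)
definition output_map ::
  "('p::finite lpv_ssa \<Rightarrow> ('t::zero, 'p) trajectory set) \<Rightarrow> 'p lpv_ssa \<Rightarrow> real Matrix.vec \<Rightarrow>
   ('t \<Rightarrow> real Matrix.vec) \<times> ('t \<Rightarrow> real ^ 'p) \<Rightarrow> ('t \<Rightarrow> real Matrix.vec) set" where
  "output_map sol S x0 = (\<lambda>(u, p). {y. \<exists>x. (x, y, u, p) \<in> sol S \<and> x 0 = x0})"

definition observable :: "('p::finite lpv_ssa \<Rightarrow> ('t::zero, 'p) trajectory set) \<Rightarrow> 'p lpv_ssa \<Rightarrow> bool" where
  "observable sol S \<longleftrightarrow> (\<forall>x1\<in>carrier_vec (xdim S). \<forall>x2\<in>carrier_vec (xdim S).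
     x1 \<noteq> x2 \<longrightarrow> output_map sol S x1 \<noteq> output_map sol S x2)"

definition lpv_isomorphism :: "real mat \<Rightarrow> 'p::finite lpv_ssa \<Rightarrow> 'p lpv_ssa \<Rightarrow> bool" where
  "lpv_isomorphism T S S' \<longleftrightarrow>
     sched S' = sched S \<and> xdim S' = xdim S \<and> udim S' = udim S \<and> ydim S' = ydim S \<and>
     T \<in> carrier_mat (xdim S) (xdim S) \<and> invertible_mat T \<and>
     (\<forall>i. Am S' i * T = T * Am S i \<and> Bm S' i = T * Bm S i \<and>
          Cm S' i * T = Cm S i \<and> Dm S' i = Dm S i)"

definition ct_regular :: "'p::finite lpv_ssa \<Rightarrow> bool" where
  "ct_regular S \<longleftrightarrow> convex (sched S) \<and> interior (sched S) \<noteq> {}"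

definition dt_regular :: "'p::finite lpv_ssa \<Rightarrow> bool" where
  "dt_regular S \<longleftrightarrow> convex (sched S) \<and> interior (sched S) \<noteq> {} \<and>
     (\<forall>q\<in>sched S. invertible_mat (affine_mat (Am S) q))"

end

theory Submission
  imports Defs "Jordan_Normal_Form.Determinant"
begin

text \<open>Both time axes are treated at once: only existence, uniqueness, linearity and concatenation of
  solutions are used, together with the passage to the infinitesimal step.

  If S is not observable, the states that produce zero output under zero input for all scheduling signals
  form a nonzero subspace invariant under every A(q) and annihilated by every C(q); dividing it out gives
  a smaller realization. Conversely let S be observable. As the flow is injective, scheduling signals can
  be concatenated so that one finite piece p separates all states. For any other realization S' the
  outputs on that piece match the states of S injectively with states of S', whence the dimension bound.
  If the dimensions agree, the matching is a bijection that is already determined by p, so after p matched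
  states stay equivalent for every continuation of the input. This relation is the graph of a matrix T that
  commutes with the flow for all inputs; differentiating at time 0 gives the intertwining relations on the
  scheduling set, and interior points give them for the coefficients.

  In continuous time, solutions are characterized by the integral equation: an absolutely continuous
  function is the Henstock-Kurzweil integral of its almost everywhere derivative.\<close>

unbundle no vec_syntax
unbundle no inner_syntax

section \<open>Matrices and subspaces\<close>

text \<open>Every initial state is allowed, so a behavior contains the responses of all states and
  no reachability condition enters. The obstacle is the order of quantifiers: equality of behaviors
  gives, for each pair (u, p) and each state x of S, a state x' of S' with the same output, but x'
  may depend on the whole of (u, p). Observability does not help directly, because it only says that
  each pair of states is separated by some scheduling signal, possibly a different one for each
  pair. One signal for all states is therefore built, and it has to do its work within a finite
  time, so that an arbitrary continuation can be appended. This is where regularity enters: the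
  state to be separated next is the one reached at the end of the current piece, and it must not
  have collapsed to zero. A competitor S' in the definition of minimality may violate RC, hence
  injectivity of the flow is invoked for S alone. In discrete time it comes from the invertibility
  of A(q), in continuous time from running the linear equation backwards.\<close>

lemma injective_mat_dim_le:
  fixes N :: "real mat"
  assumes N: "N \<in> carrier_mat m n"
    and inj: "\<And>v. v \<in> carrier_vec n \<Longrightarrow> N *\<^sub>v v = 0\<^sub>v m \<Longrightarrow> v = 0\<^sub>v n"
  shows "n \<le> m"
proof (rule ccontr)
  assume nm: "\<not> n \<le> m"
  \<comment> \<open>The missing rows are filled with zeros. Row m of A then vanishes, so A is
    singular, and a kernel vector of A is one of N.\<close>
  define A where "A = mat n n (\<lambda>(i, j). if i < m then N $$ (i, j) else 0)"
  have A: "A \<in> carrier_mat n n" by (simp add: A_def)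
  have "transpose_mat A *\<^sub>v unit_vec n m = 0\<^sub>v n"
    using nm by (intro eq_vecI) (auto simp: A_def)
  moreover have "unit_vec n m \<noteq> (0\<^sub>v n :: real Matrix.vec)"
    using nm unit_vec_nonzero[of n m] by simp
  ultimately have "det (transpose_mat A) = 0"
    using det_0_iff_vec_prod_zero[of "transpose_mat A" n] A unit_vec_carrier by (metis transpose_carrier_mat)
  then have "det A = 0" using det_transpose[OF A] by simp
  then obtain v where v: "v \<in> carrier_vec n" "v \<noteq> 0\<^sub>v n" "A *\<^sub>v v = 0\<^sub>v n"
    using det_0_iff_vec_prod_zero[OF A] by blast
  have "N *\<^sub>v v = 0\<^sub>v m"
  proof (rule eq_vecI)
    fix i assume "i < dim_vec (0\<^sub>v m :: real Matrix.vec)"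
    then have i: "i < m" "i < n" using nm by auto
    have "Matrix.row N i = Matrix.row A i" using N i by (auto simp: A_def)
    then have "(N *\<^sub>v v) $ i = (A *\<^sub>v v) $ i" using N A i by simp
    then show "(N *\<^sub>v v) $ i = 0\<^sub>v m $ i" using v(3) i by simp
  qed (use N in auto)
  then show False using inj v by blast
qed

lemma injective_mat_invertible:
  fixes N :: "real mat"
  assumes N: "N \<in> carrier_mat n n"
    and inj: "\<And>v. v \<in> carrier_vec n \<Longrightarrow> N *\<^sub>v v = 0\<^sub>v n \<Longrightarrow> v = 0\<^sub>v n"
  obtains N' where "N' \<in> carrier_mat n n" "N * N' = 1\<^sub>m n" "N' * N = 1\<^sub>m n"
proof -
  have "det N \<noteq> 0" using det_0_iff_vec_prod_zero[OF N] inj by blast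
  then obtain N' where "N' \<in> carrier_mat n n" "N' * N = 1\<^sub>m n" "N * N' = 1\<^sub>m n"
    using det_non_zero_imp_unit[OF N, of "()"] unfolding Units_def ring_mat_def by auto
  then show ?thesis using that by blast
qed

text \<open>The single closure condition has the form of a superposition of solutions; together with
  the zero vector it covers sums and multiples.\<close>

definition vec_subspace :: "nat \<Rightarrow> real Matrix.vec set \<Rightarrow> bool" where
  "vec_subspace n V \<longleftrightarrow> V \<subseteq> carrier_vec n \<and> 0\<^sub>v n \<in> V \<and> (\<forall>x\<in>V. \<forall>y\<in>V. \<forall>a. x + a \<cdot>\<^sub>v y \<in> V)"

lemma mult_mat_vec_lincomb:
  fixes N :: "real mat"
  assumes "N \<in> carrier_mat m n" "x \<in> carrier_vec n" "y \<in> carrier_vec n"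
  shows "N *\<^sub>v (x + a \<cdot>\<^sub>v y) = N *\<^sub>v x + a \<cdot>\<^sub>v (N *\<^sub>v y)"
  using assms by (simp add: mult_add_distrib_mat_vec[OF assms(1)] mult_mat_vec[OF assms(1)])

lemma mult_mat_vec_zero [simp]:
  fixes N :: "real mat"
  assumes "N \<in> carrier_mat m n" shows "N *\<^sub>v 0\<^sub>v n = 0\<^sub>v m"
  using assms by (intro eq_vecI) auto

text \<open>Z need not be single-valued: one image is chosen for each unit vector, and linearity of
  Z does the rest. Relations that match states of two systems are total before they are known to be
  functions.\<close>

lemma linear_relation_mat:
  fixes Z :: "real Matrix.vec \<Rightarrow> real Matrix.vec \<Rightarrow> bool"
  assumes total: "\<And>x. x \<in> carrier_vec n \<Longrightarrow> \<exists>y\<in>carrier_vec m. Z x y"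
    and zero: "Z (0\<^sub>v n) (0\<^sub>v m)"
    and lin: "\<And>x y x' y' a. x \<in> carrier_vec n \<Longrightarrow> x' \<in> carrier_vec n \<Longrightarrow> y \<in> carrier_vec m \<Longrightarrow>
      y' \<in> carrier_vec m \<Longrightarrow> Z x y \<Longrightarrow> Z x' y' \<Longrightarrow> Z (x + a \<cdot>\<^sub>v x') (y + a \<cdot>\<^sub>v y')"
  obtains N where "N \<in> carrier_mat m n" "\<And>x. x \<in> carrier_vec n \<Longrightarrow> Z x (N *\<^sub>v x)"
proof -
  have "\<forall>j. \<exists>y\<in>carrier_vec m. Z (unit_vec n j) y" using total by simp
  then obtain f where f: "\<And>j. f j \<in> carrier_vec m" "\<And>j. Z (unit_vec n j) (f j)" by metis
  define N where "N = mat m n (\<lambda>(i, j). f j $ i)"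
  have N: "N \<in> carrier_mat m n" by (simp add: N_def)
  have Nu: "N *\<^sub>v unit_vec n j = f j" if "j < n" for j
    using f(1)[of j] that by (intro eq_vecI) (auto simp: N_def)
  have "Z x (N *\<^sub>v x)" if x: "x \<in> carrier_vec n" for x
  proof -
    \<comment> \<open>\<open>w k\<close> keeps the first k coordinates of x; each induction step
      adds one multiple of a unit vector.\<close>
    define w where "w k = Matrix.vec n (\<lambda>j. if j < k then x $ j else 0)" for k
    have w: "w k \<in> carrier_vec n" for k by (simp add: w_def)
    have "Z (w k) (N *\<^sub>v w k)" if "k \<le> n" for k
      using that
    proof (induction k)
      case 0
      have "w 0 = 0\<^sub>v n" by (auto simp: w_def)
      then show ?case using zero N by simp
    next
      case (Suc k)
      then have k: "k < n" by simp
      have ws: "w (Suc k) = w k + x $ k \<cdot>\<^sub>v unit_vec n k"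
        using k by (intro eq_vecI) (auto simp: w_def less_Suc_eq)
      have "N *\<^sub>v w (Suc k) = N *\<^sub>v w k + x $ k \<cdot>\<^sub>v f k"
        unfolding ws Nu[OF k, symmetric]
        using N w by (subst mult_add_distrib_mat_vec[OF N]) (auto simp: mult_mat_vec[OF N])
      then show ?case unfolding ws
        using lin[OF w _ _ f(1) Suc.IH f(2), of k "x $ k"] Suc.prems N w
        by (metis ws Suc_leD mult_mat_vec_carrier unit_vec_carrier)
    qed
    moreover have "w n = x" using x by (auto simp: w_def)
    ultimately show ?thesis by fastforce
  qed
  then show ?thesis using that N by blast
qed

text \<open>The minimal number r of rows is attained exactly at kernel V: a vector of V outside the
  kernel could be divided out by eliminating one more coordinate.\<close>
lemma subspace_as_kernel:
  assumes V: "vec_subspace n V"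
  obtains r Q R where "Q \<in> carrier_mat r n" "R \<in> carrier_mat n r" "Q * R = 1\<^sub>m r"
    "\<And>x. x \<in> carrier_vec n \<Longrightarrow> Q *\<^sub>v x = 0\<^sub>v r \<longleftrightarrow> x \<in> V"
proof -
  \<comment> \<open>Only kernels inside V are required, so that the identity matrix qualifies with r
    = n. The right inverse R is carried along because it later serves as the section of the quotient
    map Q.\<close>
  define P where "P r \<longleftrightarrow> (\<exists>Q R. Q \<in> carrier_mat r n \<and> R \<in> carrier_mat n r \<and> Q * R = 1\<^sub>m r \<and>
    (\<forall>x\<in>carrier_vec n. Q *\<^sub>v x = 0\<^sub>v r \<longrightarrow> x \<in> V))" for r
  have "P n" unfolding P_def
    using V by (intro exI[of _ "1\<^sub>m n"]) (auto simp: vec_subspace_def)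
  define r where "r = (LEAST r. P r)"
  have Pr: "P r" unfolding r_def using \<open>P n\<close> by (rule LeastI)
  then obtain Q R where Q: "Q \<in> carrier_mat r n" and R: "R \<in> carrier_mat n r" and QR: "Q * R = 1\<^sub>m r"
    and ker: "\<And>x. x \<in> carrier_vec n \<Longrightarrow> Q *\<^sub>v x = 0\<^sub>v r \<Longrightarrow> x \<in> V"
    unfolding P_def by blast
  have "Q *\<^sub>v v = 0\<^sub>v r" if v: "v \<in> V" for v
  proof (rule ccontr)
    assume "Q *\<^sub>v v \<noteq> 0\<^sub>v r"
    define w where "w = Q *\<^sub>v v"
    have vn: "v \<in> carrier_vec n" using v V by (auto simp: vec_subspace_def)
    have w: "w \<in> carrier_vec r" using Q vn by (simp add: w_def)
    obtain k where k: "k < r" "w $ k \<noteq> 0"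
      using \<open>Q *\<^sub>v v \<noteq> 0\<^sub>v r\<close> w unfolding w_def[symmetric] by (metis eq_vecI carrier_vecD index_zero_vec)
    define s where "s = r - 1"
    have rs: "r = Suc s" using k by (simp add: s_def)
    \<comment> \<open>\<open>up\<close> enumerates the indices below r other than k in increasing
      order.\<close>
    define up where "up i = (if i < k then i else Suc i)" for i
    have up: "up i < r" "up i \<noteq> k" if "i < s" for i using that rs by (auto simp: up_def)
    have up_inj: "up i = up j \<longleftrightarrow> i = j" for i j by (auto simp: up_def)
    have up_surj: "\<exists>i<s. j = up i" if "j < r" "j \<noteq> k" for j
    proof (cases "j < k")
      case True
      then show ?thesis using that rs k by (intro exI[of _ j]) (auto simp: up_def)
    next
      case False
      then show ?thesis using that rs k by (intro exI[of _ "j - 1"]) (auto simp: up_def)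
    qed
    \<comment> \<open>E is Gaussian elimination with pivot \<open>w $ k\<close>: it maps w to 0 and
      drops coordinate k. F inserts a zero at k, so the correction term vanishes and F is a right
      inverse of E.\<close>
    define E where "E = mat s r (\<lambda>(i, j). (if j = up i then 1 else 0) - (if j = k then w $ up i / w $ k else 0))"
    define F where "F = mat r s (\<lambda>(j, i). if j = up i then 1 else 0 :: real)"
    have E: "E \<in> carrier_mat s r" and F: "F \<in> carrier_mat r s" by (auto simp: E_def F_def)
    have Eu: "(E *\<^sub>v u) $ i = u $ up i - w $ up i / w $ k * u $ k" if "u \<in> carrier_vec r" "i < s" for u i
    proof -
      have "(E *\<^sub>v u) $ i = (\<Sum>j<r. ((if j = up i then 1 else 0) - (if j = k then w $ up i / w $ k else 0)) * u $ j)"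
        using that by (simp add: E_def scalar_prod_def atLeast0LessThan)
      also have "\<dots> = (\<Sum>j<r. (if j = up i then u $ j else 0)) - (\<Sum>j<r. (if j = k then w $ up i / w $ k * u $ j else 0))"
        unfolding sum_subtractf[symmetric] by (intro sum.cong) (auto simp: algebra_simps)
      finally show ?thesis using that k up by (simp add: sum.delta)
    qed
    have EF: "E * F = 1\<^sub>m s"
    proof (rule eq_matI)
      fix i j assume "i < dim_row (1\<^sub>m s :: real mat)" "j < dim_col (1\<^sub>m s :: real mat)"
      then have ij: "i < s" "j < s" by auto
      have "(E * F) $$ (i, j) = (E *\<^sub>v col F j) $ i" using E F ij by simp
      also have "\<dots> = col F j $ up i - w $ up i / w $ k * col F j $ k"
        using F ij by (intro Eu) (metis F carrier_matD(1) col_dim, simp)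
      also have "\<dots> = 1\<^sub>m s $$ (i, j)" using ij up[of i] up[of j] up_inj k by (auto simp: F_def)
      finally show "(E * F) $$ (i, j) = 1\<^sub>m s $$ (i, j)" .
    qed (use E F in auto)
    have "P s" unfolding P_def
    proof (intro exI conjI ballI impI)
      show EQ: "E * Q \<in> carrier_mat s n" and "R * F \<in> carrier_mat n s" using E Q R F by auto
      have "E * Q * (R * F) = E * (Q * (R * F))" by (rule assoc_mult_mat[OF E Q mult_carrier_mat[OF R F]])
      also have "Q * (R * F) = F" using assoc_mult_mat[OF Q R F] QR F by simp
      finally show "E * Q * (R * F) = 1\<^sub>m s" using EF by simp
      fix x assume x: "x \<in> carrier_vec n" and "E * Q *\<^sub>v x = 0\<^sub>v s"
      then have 0: "E *\<^sub>v (Q *\<^sub>v x) = 0\<^sub>v s" using E Q by simp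
      define u where "u = Q *\<^sub>v x"
      have u: "u \<in> carrier_vec r" using Q x by (simp add: u_def)
      \<comment> \<open>The kernel of E is spanned by w = Q v, so Q x is the multiple c of w, and x
        differs from c v by a vector in the kernel of Q, which lies in V.\<close>
      define c where "c = u $ k / w $ k"
      have *: "u $ j = c * w $ j" if jr: "j < r" for j
      proof (cases "j = k")
        case True then show ?thesis using k by (simp add: c_def)
      next
        case False
        then obtain i where "i < s" "j = up i" using up_surj jr by blast
        then show ?thesis using Eu[OF u, of i] 0 by (simp add: u_def c_def)
      qed
      define z where "z = x + (- c) \<cdot>\<^sub>v v"
      have z: "z \<in> carrier_vec n" using x vn by (simp add: z_def)
      have "Q *\<^sub>v z = u + (- c) \<cdot>\<^sub>v w"
        unfolding z_def u_def w_def by (rule mult_mat_vec_lincomb[OF Q x vn])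
      also have "\<dots> = 0\<^sub>v r" using * u w by (intro eq_vecI) auto
      finally have "z \<in> V" by (rule ker[OF z])
      moreover have "x = z + c \<cdot>\<^sub>v v" using x vn by (auto simp: z_def)
      ultimately show "x \<in> V" using V v unfolding vec_subspace_def by metis
    qed
    then have "r \<le> s" unfolding r_def by (rule Least_le)
    then show False using rs by simp
  qed
  then show ?thesis using that[OF Q R QR] ker by blast
qed

text \<open>For r = n the right inverse would be two-sided and Q injective. The strict drop is what
  makes a quotient by a nonzero subspace a smaller system.\<close>

lemma right_inverse_dim_less:
  fixes Q :: "real mat"
  assumes Q: "Q \<in> carrier_mat r n" and R: "R \<in> carrier_mat n r" and QR: "Q * R = 1\<^sub>m r"
    and v: "v \<in> carrier_vec n" "v \<noteq> 0\<^sub>v n" "Q *\<^sub>v v = 0\<^sub>v r"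
  shows "r < n"
proof -
  have "r \<le> n"
  proof (rule injective_mat_dim_le[OF R])
    fix u assume u: "u \<in> carrier_vec r" "R *\<^sub>v u = 0\<^sub>v n"
    have "u = (Q * R) *\<^sub>v u" using u QR by simp
    also have "\<dots> = 0\<^sub>v r" using Q R u by simp
    finally show "u = 0\<^sub>v r" .
  qed
  moreover have "r \<noteq> n"
  proof
    assume rn: "r = n"
    then have "R * Q = 1\<^sub>m n" using mat_mult_left_right_inverse Q R QR by blast
    then have "v = R * Q *\<^sub>v v" using v by simp
    also have "\<dots> = 0\<^sub>v n" using Q R v rn by simp
    finally show False using v by simp
  qed
  ultimately show ?thesis by simp
qed

text \<open>A subspace of the largest dimension meeting some K of the family trivially must be the
  whole space.\<close>
lemma trivial_member_of_shrinking_subspaces: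
  assumes sub: "\<And>K. K \<in> \<K> \<Longrightarrow> vec_subspace n K" and ne: "\<K> \<noteq> {}"
    and shrink: "\<And>K x. K \<in> \<K> \<Longrightarrow> x \<in> K \<Longrightarrow> x \<noteq> 0\<^sub>v n \<Longrightarrow> \<exists>K'\<in>\<K>. K' \<subseteq> K \<and> x \<notin> K'"
  shows "{0\<^sub>v n} \<in> \<K>"
proof -
  \<comment> \<open>The columns of R are linearly independent modulo K, so r is at most the
    codimension of K.\<close>
  define P where "P r \<longleftrightarrow> (\<exists>R\<in>carrier_mat n r. \<exists>K\<in>\<K>. \<forall>z\<in>carrier_vec r. R *\<^sub>v z \<in> K \<longrightarrow> z = 0\<^sub>v r)" for r
  obtain K0 where "K0 \<in> \<K>" using ne by blast
  then have "P 0" unfolding P_def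
    by (intro bexI[of _ "0\<^sub>m n 0"] bexI[of _ K0]) (auto)
  have bnd: "r \<le> n" if Pr: "P r" for r
  proof -
    obtain R K where R: "R \<in> carrier_mat n r" and K: "K \<in> \<K>"
      and i: "\<And>z. z \<in> carrier_vec r \<Longrightarrow> R *\<^sub>v z \<in> K \<Longrightarrow> z = 0\<^sub>v r" using Pr unfolding P_def by blast
    show ?thesis
      using sub[OF K] i by (intro injective_mat_dim_le[OF R]) (auto simp: vec_subspace_def)
  qed
  define r where "r = (GREATEST r. P r)"
  have "P r" unfolding r_def using \<open>P 0\<close> bnd by (rule GreatestI_nat)
  then obtain R K where R: "R \<in> carrier_mat n r" and K: "K \<in> \<K>"
    and i: "\<And>z. z \<in> carrier_vec r \<Longrightarrow> R *\<^sub>v z \<in> K \<Longrightarrow> z = 0\<^sub>v r" unfolding P_def by blast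
  have "x = 0\<^sub>v n" if x: "x \<in> K" for x
  proof (rule ccontr)
    assume x0: "x \<noteq> 0\<^sub>v n"
    obtain K' where K': "K' \<in> \<K>" "K' \<subseteq> K" "x \<notin> K'" using shrink[OF K x x0] by blast
    note s = sub[OF K, unfolded vec_subspace_def] and s' = sub[OF K'(1), unfolded vec_subspace_def]
    have xn: "x \<in> carrier_vec n" using s x by blast
    \<comment> \<open>x is appended as a last column. Independence modulo K' persists: the old
      columns are independent modulo K, which contains both K' and x, and x itself is not in
      K'.\<close>
    define R' where "R' = mat n (Suc r) (\<lambda>(i, j). if j < r then R $$ (i, j) else x $ i)"
    have R': "R' \<in> carrier_mat n (Suc r)" by (simp add: R'_def)
    have "z = 0\<^sub>v (Suc r)" if z: "z \<in> carrier_vec (Suc r)" "R' *\<^sub>v z \<in> K'" for z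
    proof -
      define u where "u = Matrix.vec r (\<lambda>j. z $ j)"
      have u: "u \<in> carrier_vec r" by (simp add: u_def)
      have eq: "R' *\<^sub>v z = R *\<^sub>v u + z $ r \<cdot>\<^sub>v x"
        using z R xn by (intro eq_vecI) (auto simp: R'_def u_def scalar_prod_def atLeast0LessThan mult.commute)
      have "R *\<^sub>v u = R' *\<^sub>v z + (- z $ r) \<cdot>\<^sub>v x"
        unfolding eq using R u xn by (intro eq_vecI) auto
      then have "R *\<^sub>v u \<in> K" using s z(2) K'(2) x by (metis subsetD)
      then have u0: "u = 0\<^sub>v r" using i u by blast
      then have zx: "R' *\<^sub>v z = z $ r \<cdot>\<^sub>v x" unfolding eq using R xn by simp
      have "z $ r = 0"
      proof (rule ccontr)
        assume "z $ r \<noteq> 0"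
        then have "x = 0\<^sub>v n + (1 / z $ r) \<cdot>\<^sub>v (R' *\<^sub>v z)" unfolding zx using xn by auto
        then show False using s' z(2) K'(3) by metis
      qed
      moreover have "z $ j = 0" if "j < r" for j
        using arg_cong[OF u0, of "\<lambda>v. v $ j"] that by (simp add: u_def)
      ultimately show ?thesis using z by (intro eq_vecI) (auto simp: less_Suc_eq)
    qed
    then have "P (Suc r)" unfolding P_def using R' K'(1) by blast
    then have "Suc r \<le> r" unfolding r_def using bnd by (rule Greatest_le_nat)
    then show False by simp
  qed
  then have "K = {0\<^sub>v n}" using sub[OF K] by (auto simp: vec_subspace_def)
  then show ?thesis using K by simp
qed

section \<open>Affine matrix families and system maps\<close>

lemma affine_mat_carrier [intro, simp]:
  assumes "\<And>i. M i \<in> carrier_mat m n" shows "affine_mat M q \<in> carrier_mat m n"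
  using assms[of None] by (auto simp: affine_mat_def)

lemma affine_mat_index:
  assumes "\<And>i. M i \<in> carrier_mat m n" "r < m" "c < n"
  shows "affine_mat M q $$ (r, c) = M None $$ (r, c) + (\<Sum>i\<in>UNIV. M (Some i) $$ (r, c) * vec_nth q i)"
  using assms(1)[of None] assms(2,3) by (auto simp: affine_mat_def)

lemma affine_mat_mult_left:
  fixes T :: "real mat" and M :: "'p::finite option \<Rightarrow> real mat"
  assumes M: "\<And>i. M i \<in> carrier_mat m n" and T: "T \<in> carrier_mat r m"
  shows "affine_mat (\<lambda>i. T * M i) q = T * affine_mat M q"
proof (rule eq_matI)
  fix a b assume "a < dim_row (T * affine_mat M q)" "b < dim_col (T * affine_mat M q)"
  then have ab: "a < r" "b < n" using T affine_mat_carrier[of M m n q, OF M] by auto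
  have e: "(T * N) $$ (a, b) = (\<Sum>k<m. T $$ (a, k) * N $$ (k, b))" if "N \<in> carrier_mat m n" for N
    using that T ab by (simp add: scalar_prod_def atLeast0LessThan)
  have "affine_mat (\<lambda>i. T * M i) q $$ (a, b) =
      (\<Sum>k<m. T $$ (a, k) * M None $$ (k, b)) + (\<Sum>i\<in>UNIV. (\<Sum>k<m. T $$ (a, k) * M (Some i) $$ (k, b)) * vec_nth q i)"
    by (subst affine_mat_index[of _ r n]) (use M T ab in \<open>auto simp: e[OF M]\<close>)
  also have "(\<Sum>i\<in>UNIV. (\<Sum>k<m. T $$ (a, k) * M (Some i) $$ (k, b)) * vec_nth q i) =
      (\<Sum>k<m. \<Sum>i\<in>UNIV. T $$ (a, k) * M (Some i) $$ (k, b) * vec_nth q i)"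
    unfolding sum_distrib_right by (rule sum.swap)
  finally show "affine_mat (\<lambda>i. T * M i) q $$ (a, b) = (T * affine_mat M q) $$ (a, b)"
    unfolding e[OF affine_mat_carrier[of M m n q, OF M]]
    by (simp add: affine_mat_index[OF M] ab distrib_left sum.distrib sum_distrib_left mult.assoc)
qed (use M[of None] T in \<open>auto simp: affine_mat_def\<close>)

lemma affine_mat_mult_right:
  fixes T :: "real mat" and M :: "'p::finite option \<Rightarrow> real mat"
  assumes M: "\<And>i. M i \<in> carrier_mat m n" and T: "T \<in> carrier_mat n r"
  shows "affine_mat (\<lambda>i. M i * T) q = affine_mat M q * T"
proof (rule eq_matI)
  fix a b assume "a < dim_row (affine_mat M q * T)" "b < dim_col (affine_mat M q * T)"
  then have ab: "a < m" "b < r" using T affine_mat_carrier[of M m n q, OF M] by auto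
  have e: "(N * T) $$ (a, b) = (\<Sum>k<n. N $$ (a, k) * T $$ (k, b))" if "N \<in> carrier_mat m n" for N
    using that T ab by (simp add: scalar_prod_def atLeast0LessThan)
  have "affine_mat (\<lambda>i. M i * T) q $$ (a, b) =
      (\<Sum>k<n. M None $$ (a, k) * T $$ (k, b)) + (\<Sum>i\<in>UNIV. (\<Sum>k<n. M (Some i) $$ (a, k) * T $$ (k, b)) * vec_nth q i)"
    by (subst affine_mat_index[of _ m r]) (use mult_carrier_mat[OF M T] ab in \<open>auto simp: e[OF M]\<close>)
  also have "(\<Sum>i\<in>UNIV. (\<Sum>k<n. M (Some i) $$ (a, k) * T $$ (k, b)) * vec_nth q i) =
      (\<Sum>k<n. \<Sum>i\<in>UNIV. M (Some i) $$ (a, k) * vec_nth q i * T $$ (k, b))"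
    unfolding sum_distrib_right by (subst sum.swap) (simp only: mult_ac)
  finally show "affine_mat (\<lambda>i. M i * T) q $$ (a, b) = (affine_mat M q * T) $$ (a, b)"
    unfolding e[OF affine_mat_carrier[of M m n q, OF M]]
    by (simp add: affine_mat_index[OF M] ab distrib_right sum.distrib sum_distrib_right)
qed (use M[of None] T in \<open>auto simp: affine_mat_def\<close>)

text \<open>An interior point and its translate along one axis by half the radius of a ball differ
  in a single coordinate, which isolates that coefficient; the constant term follows.\<close>

lemma affine_function_coefficients_unique:
  fixes a a' :: real and b b' :: "'p::finite \<Rightarrow> real"
  assumes P: "interior P \<noteq> {}"
    and eq: "\<And>q. q \<in> P \<Longrightarrow> a + (\<Sum>i\<in>UNIV. b i * vec_nth q i) = a' + (\<Sum>i\<in>UNIV. b' i * vec_nth q i)"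
  shows "a = a'" "b i = b' i"
proof -
  obtain q0 e where e: "e > 0" "ball q0 e \<subseteq> P"
    using P mem_interior by (metis equals0I)
  have "b i = b' i" for i
  proof -
    have q: "q0 \<in> P" "q0 + (e/2) *\<^sub>R axis i 1 \<in> P"
      using e by (auto simp: subset_iff dist_norm)
    have *: "(\<Sum>j\<in>UNIV. c j * vec_nth (q0 + (e/2) *\<^sub>R axis i 1) j) = (\<Sum>j\<in>UNIV. c j * vec_nth q0 j) + c i * (e/2)" for c :: "'p \<Rightarrow> real"
    proof -
      have "c j * vec_nth (q0 + (e/2) *\<^sub>R axis i 1) j = c j * vec_nth q0 j + (if j = i then c i * (e/2) else 0)" for j
        by (simp add: axis_def distrib_left)
      then show ?thesis by (simp add: sum.distrib sum.delta)
    qed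
    have "b i * (e/2) = b' i * (e/2)" using eq[OF q(1)] eq[OF q(2)] unfolding * by linarith
    then show ?thesis using e by simp
  qed
  then have "b = b'" by auto
  then show "a = a'" "b i = b' i" using eq[OF subsetD[OF e(2)], of q0] e(1) by auto
qed

lemma affine_mat_coefficients_unique:
  fixes M M' :: "'p::finite option \<Rightarrow> real mat"
  assumes P: "interior P \<noteq> {}" and M: "\<And>i. M i \<in> carrier_mat m n" and M': "\<And>i. M' i \<in> carrier_mat m n"
    and eq: "\<And>q. q \<in> P \<Longrightarrow> affine_mat M q = affine_mat M' q"
  shows "M i = M' i"
proof (rule eq_matI)
  fix r c assume "r < dim_row (M' i)" "c < dim_col (M' i)"
  then have rc: "r < m" "c < n" using M'[of i] by auto
  have "M None $$ (r, c) + (\<Sum>i\<in>UNIV. M (Some i) $$ (r, c) * vec_nth q i) =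
      M' None $$ (r, c) + (\<Sum>i\<in>UNIV. M' (Some i) $$ (r, c) * vec_nth q i)" if "q \<in> P" for q
    using arg_cong[OF eq[OF that], of "\<lambda>X. X $$ (r, c)"]
    by (simp only: affine_mat_index[OF M rc] affine_mat_index[OF M' rc])
  note u = affine_function_coefficients_unique[OF P this]
  show "M i $$ (r, c) = M' i $$ (r, c)" by (cases i) (simp_all add: u)
qed (use M[of i] M'[of i] in auto)

lemma mat_eq_mult_vecI:
  fixes A B :: "real mat"
  assumes A: "A \<in> carrier_mat m n" and B: "B \<in> carrier_mat m n"
    and eq: "\<And>v. v \<in> carrier_vec n \<Longrightarrow> A *\<^sub>v v = B *\<^sub>v v"
  shows "A = B"
proof (rule eq_matI)
  fix i j assume "i < dim_row B" "j < dim_col B"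
  then have ij: "i < m" "j < n" using B by auto
  have u: "(C *\<^sub>v unit_vec n j) $ i = C $$ (i, j)" if "C \<in> carrier_mat m n" for C :: "real mat"
    using that ij by simp
  show "A $$ (i, j) = B $$ (i, j)" using u[OF A] u[OF B] eq[OF unit_vec_carrier, of j] by simp
qed (use A B in auto)

lemma lpv_ssaD:
  assumes "is_lpv_ssa S"
  shows "Am S i \<in> carrier_mat (xdim S) (xdim S)" "Bm S i \<in> carrier_mat (xdim S) (udim S)"
    "Cm S i \<in> carrier_mat (ydim S) (xdim S)" "Dm S i \<in> carrier_mat (ydim S) (udim S)"
  using assms by (auto simp: is_lpv_ssa_def)

lemma affine_mat_coefficients_mult_vecI:
  fixes M M' :: "'p::finite option \<Rightarrow> real mat"
  assumes P: "interior P \<noteq> {}" and M: "\<And>i. M i \<in> carrier_mat m n" and M': "\<And>i. M' i \<in> carrier_mat m n"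
    and eq: "\<And>q v. q \<in> P \<Longrightarrow> v \<in> carrier_vec n \<Longrightarrow> affine_mat M q *\<^sub>v v = affine_mat M' q *\<^sub>v v"
  shows "M i = M' i"
  by (intro affine_mat_coefficients_unique[OF P M M'] mat_eq_mult_vecI[of _ m n] affine_mat_carrier M M' eq)

lemma lpv_carriers:
  assumes "is_lpv_ssa S"
  shows "affine_mat (Am S) q \<in> carrier_mat (xdim S) (xdim S)" "affine_mat (Bm S) q \<in> carrier_mat (xdim S) (udim S)"
    "affine_mat (Cm S) q \<in> carrier_mat (ydim S) (xdim S)" "affine_mat (Dm S) q \<in> carrier_mat (ydim S) (udim S)"
  using assms unfolding is_lpv_ssa_def by (blast intro: affine_mat_carrier)+

lemma add_lincomb_vec:
  fixes x x' y y' :: "real Matrix.vec"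
  assumes "x \<in> carrier_vec m" "x' \<in> carrier_vec m" "y \<in> carrier_vec m" "y' \<in> carrier_vec m"
  shows "(x + a \<cdot>\<^sub>v x') + (y + a \<cdot>\<^sub>v y') = (x + y) + a \<cdot>\<^sub>v (x' + y')"
  using assms by (intro eq_vecI) (auto simp: algebra_simps)

lemma add_mult_mat_vec_lincomb:
  fixes A B :: "real mat"
  assumes A: "A \<in> carrier_mat m n" and B: "B \<in> carrier_mat m k"
    and v: "v \<in> carrier_vec n" "v' \<in> carrier_vec n" "w \<in> carrier_vec k" "w' \<in> carrier_vec k"
  shows "A *\<^sub>v (v + a \<cdot>\<^sub>v v') + B *\<^sub>v (w + a \<cdot>\<^sub>v w') = (A *\<^sub>v v + B *\<^sub>v w) + a \<cdot>\<^sub>v (A *\<^sub>v v' + B *\<^sub>v w')"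
proof -
  have c: "A *\<^sub>v v \<in> carrier_vec m" "A *\<^sub>v v' \<in> carrier_vec m" "B *\<^sub>v w \<in> carrier_vec m" "B *\<^sub>v w' \<in> carrier_vec m"
    using A B v by auto
  show ?thesis unfolding mult_mat_vec_lincomb[OF A v(1,2)] mult_mat_vec_lincomb[OF B v(3,4)]
    using c by (rule add_lincomb_vec)
qed

lemma state_rhs_carrier:
  assumes "is_lpv_ssa S" shows "state_rhs S q v w \<in> carrier_vec (xdim S)"
  unfolding state_rhs_def by (rule carrier_vecI) (simp add: lpv_carriers(2)[OF assms, THEN carrier_matD(1)])

lemma output_rhs_carrier:
  assumes "is_lpv_ssa S" shows "output_rhs S q v w \<in> carrier_vec (ydim S)"
  unfolding output_rhs_def by (rule carrier_vecI) (simp add: lpv_carriers(4)[OF assms, THEN carrier_matD(1)])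

lemma state_rhs_lincomb:
  assumes "is_lpv_ssa S" "v \<in> carrier_vec (xdim S)" "v' \<in> carrier_vec (xdim S)" "w \<in> carrier_vec (udim S)" "w' \<in> carrier_vec (udim S)"
  shows "state_rhs S q (v + a \<cdot>\<^sub>v v') (w + a \<cdot>\<^sub>v w') = state_rhs S q v w + a \<cdot>\<^sub>v state_rhs S q v' w'"
  unfolding state_rhs_def by (rule add_mult_mat_vec_lincomb[OF lpv_carriers(1,2)[OF assms(1)] assms(2-5)])

lemma output_rhs_lincomb:
  assumes "is_lpv_ssa S" "v \<in> carrier_vec (xdim S)" "v' \<in> carrier_vec (xdim S)" "w \<in> carrier_vec (udim S)" "w' \<in> carrier_vec (udim S)"
  shows "output_rhs S q (v + a \<cdot>\<^sub>v v') (w + a \<cdot>\<^sub>v w') = output_rhs S q v w + a \<cdot>\<^sub>v output_rhs S q v' w'"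
  unfolding output_rhs_def by (rule add_mult_mat_vec_lincomb[OF lpv_carriers(3,4)[OF assms(1)] assms(2-5)])

lemma rhs_zero_input:
  assumes "is_lpv_ssa S" "v \<in> carrier_vec (xdim S)"
  shows "state_rhs S q v (0\<^sub>v (udim S)) = affine_mat (Am S) q *\<^sub>v v"
    "output_rhs S q v (0\<^sub>v (udim S)) = affine_mat (Cm S) q *\<^sub>v v"
  using lpv_carriers[OF assms(1), of q] assms(2) by (auto simp: state_rhs_def output_rhs_def)

lemma rhs_zero_state:
  assumes "is_lpv_ssa S" "w \<in> carrier_vec (udim S)"
  shows "state_rhs S q (0\<^sub>v (xdim S)) w = affine_mat (Bm S) q *\<^sub>v w"
    "output_rhs S q (0\<^sub>v (xdim S)) w = affine_mat (Dm S) q *\<^sub>v w"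
  using lpv_carriers[OF assms(1), of q] assms(2) by (auto simp: state_rhs_def output_rhs_def)

text \<open>States of two systems can be compared once both accept the same inputs and scheduling
  signals and have outputs of the same size; the state dimensions may differ.\<close>

definition same_interface :: "'p::finite lpv_ssa \<Rightarrow> 'p lpv_ssa \<Rightarrow> bool" where
  "same_interface S S' \<longleftrightarrow> is_lpv_ssa S \<and> is_lpv_ssa S' \<and> sched S' = sched S \<and> udim S' = udim S \<and> ydim S' = ydim S"

text \<open>The coefficients are recovered from the intertwining on the scheduling set because it
  has interior points.\<close>
lemma intertwining_isomorphism:
  fixes S S' :: "'p::finite lpv_ssa"
  assumes si: "same_interface S S'" and n: "xdim S' = xdim S" and P: "interior (sched S) \<noteq> {}"
    and T: "T \<in> carrier_mat (xdim S) (xdim S)" "invertible_mat T"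
    and st: "\<And>q v w. q \<in> sched S \<Longrightarrow> v \<in> carrier_vec (xdim S) \<Longrightarrow> w \<in> carrier_vec (udim S) \<Longrightarrow>
      state_rhs S' q (T *\<^sub>v v) w = T *\<^sub>v state_rhs S q v w"
    and out: "\<And>q v w. q \<in> sched S \<Longrightarrow> v \<in> carrier_vec (xdim S) \<Longrightarrow> w \<in> carrier_vec (udim S) \<Longrightarrow>
      output_rhs S' q (T *\<^sub>v v) w = output_rhs S q v w"
  shows "lpv_isomorphism T S S'"
proof -
  have S: "is_lpv_ssa S" and S': "is_lpv_ssa S'" and d: "sched S' = sched S" "udim S' = udim S" "ydim S' = ydim S"
    using si by (auto simp: same_interface_def)
  note c = lpv_ssaD[OF S] and c' = lpv_ssaD[OF S', unfolded n d]
  note l = lpv_carriers[OF S] and l' = lpv_carriers[OF S', unfolded n d]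
  note zi = rhs_zero_input[OF S] and zi' = rhs_zero_input[OF S', unfolded n d]
  note zs = rhs_zero_state[OF S] and zs' = rhs_zero_state[OF S', unfolded n d]
  have T0: "T *\<^sub>v 0\<^sub>v (xdim S) = 0\<^sub>v (xdim S)" using T(1) by simp
  have Tv: "T *\<^sub>v v \<in> carrier_vec (xdim S)" if "v \<in> carrier_vec (xdim S)" for v using T that by simp
  \<comment> \<open>Zero input isolates the A and C families, zero state the B and D
    families.\<close>
  have "Am S' i * T = T * Am S i" for i
  proof (rule affine_mat_coefficients_mult_vecI[OF P mult_carrier_mat[OF c'(1) T(1)] mult_carrier_mat[OF T(1) c(1)]])
    fix q and v :: "real Matrix.vec" assume q: "q \<in> sched S" and v: "v \<in> carrier_vec (xdim S)"
    show "affine_mat (\<lambda>i. Am S' i * T) q *\<^sub>v v = affine_mat (\<lambda>i. T * Am S i) q *\<^sub>v v"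
      unfolding affine_mat_mult_right[OF c'(1) T(1)] affine_mat_mult_left[OF c(1) T(1)]
        assoc_mult_mat_vec[OF l'(1) T(1) v] assoc_mult_mat_vec[OF T(1) l(1) v]
      using st[OF q v zero_carrier_vec] unfolding zi(1)[OF v] zi'(1)[OF Tv[OF v]] .
  qed
  moreover have "Bm S' i = T * Bm S i" for i
  proof (rule affine_mat_coefficients_mult_vecI[OF P c'(2) mult_carrier_mat[OF T(1) c(2)]])
    fix q and w :: "real Matrix.vec" assume q: "q \<in> sched S" and w: "w \<in> carrier_vec (udim S)"
    show "affine_mat (Bm S') q *\<^sub>v w = affine_mat (\<lambda>i. T * Bm S i) q *\<^sub>v w"
      unfolding affine_mat_mult_left[OF c(2) T(1)] assoc_mult_mat_vec[OF T(1) l(2) w]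
      using st[OF q zero_carrier_vec w] unfolding T0 zs(1)[OF w] zs'(1)[OF w] .
  qed
  moreover have "Cm S' i * T = Cm S i" for i
  proof (rule affine_mat_coefficients_mult_vecI[OF P mult_carrier_mat[OF c'(3) T(1)] c(3)])
    fix q and v :: "real Matrix.vec" assume q: "q \<in> sched S" and v: "v \<in> carrier_vec (xdim S)"
    show "affine_mat (\<lambda>i. Cm S' i * T) q *\<^sub>v v = affine_mat (Cm S) q *\<^sub>v v"
      unfolding affine_mat_mult_right[OF c'(3) T(1)] assoc_mult_mat_vec[OF l'(3) T(1) v]
      using out[OF q v zero_carrier_vec] unfolding zi(2)[OF v] zi'(2)[OF Tv[OF v]] .
  qed
  moreover have "Dm S' i = Dm S i" for i
  proof (rule affine_mat_coefficients_mult_vecI[OF P c'(4) c(4)])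
    fix q and w :: "real Matrix.vec" assume q: "q \<in> sched S" and w: "w \<in> carrier_vec (udim S)"
    show "affine_mat (Dm S') q *\<^sub>v w = affine_mat (Dm S) q *\<^sub>v w"
      using out[OF q zero_carrier_vec w] unfolding T0 zs(2)[OF w] zs'(2)[OF w] .
  qed
  ultimately show ?thesis unfolding lpv_isomorphism_def using d n T by simp
qed

section \<open>Absolutely continuous and piecewise continuous functions\<close>

text \<open>A gauge proof of the fundamental theorem for a derivative that exists only off a
  negligible set. At a tag with a derivative the gauge makes the increment of f nearly linear; an
  interval tagged in N is kept inside an open set of small measure, where absolute continuity makes
  the total increment small.\<close>

lemma abs_continuous_has_integral_derivative:
  fixes f f' :: "real \<Rightarrow> real"
  assumes ab: "a \<le> b"
    and ac: "\<And>e. e > 0 \<Longrightarrow> \<exists>d>0. \<forall>I :: (real \<times> real) set. finite I \<longrightarrow>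
      (\<forall>(u, v)\<in>I. a \<le> u \<and> u \<le> v \<and> v \<le> b) \<longrightarrow> disjoint_family_on (\<lambda>(u, v). {u<..<v}) I \<longrightarrow>
      (\<Sum>(u, v)\<in>I. v - u) < d \<longrightarrow> (\<Sum>(u, v)\<in>I. \<bar>f v - f u\<bar>) < e"
    and N: "negligible N"
    and deriv: "\<And>x. x \<in> {a..b} - N \<Longrightarrow> (f has_real_derivative f' x) (at x within {a..b})"
  shows "(f' has_integral (f b - f a)) {a..b}"
proof -
  \<comment> \<open>With the value 0 on N, a tag in N contributes only the increment of f.\<close>
  define g where "g x = (if x \<in> N then 0 else f' x)" for x
  have "(g has_integral (f b - f a)) (cbox a b)"
    unfolding has_integral
  proof (intro allI impI)
    fix e :: real assume e: "e > 0"
    \<comment> \<open>The summand 1 avoids division by zero for a = b and makes the estimate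
      strict.\<close>
    define e1 where "e1 = e / 2 / (b - a + 1)"
    have e1: "e1 > 0" "e1 * (b - a) < e / 2" using ab e
      by (auto simp: e1_def field_simps intro!: divide_pos_pos)
    obtain \<delta> where \<delta>: "\<delta> > 0" and ac\<delta>: "\<And>I :: (real \<times> real) set. finite I \<Longrightarrow>
      (\<forall>(u, v)\<in>I. a \<le> u \<and> u \<le> v \<and> v \<le> b) \<Longrightarrow> disjoint_family_on (\<lambda>(u, v). {u<..<v}) I \<Longrightarrow>
      (\<Sum>(u, v)\<in>I. v - u) < \<delta> \<Longrightarrow> (\<Sum>(u, v)\<in>I. \<bar>f v - f u\<bar>) < e / 2"
      using ac[of "e / 2"] e by auto
    have N0: "N \<in> null_sets lebesgue" using N negligible_iff_null_sets by blast
    obtain T where T: "open T" "N \<subseteq> T" "T - N \<in> lmeasurable" "emeasure lebesgue (T - N) < ennreal \<delta>"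
      using sets_lebesgue_outer_open[OF _ \<delta>, of N] N0 by blast
    have TN: "T = (T - N) \<union> N" using T(2) by blast
    have Tm: "T \<in> lmeasurable"
      by (subst TN, intro fmeasurable.Un T(3)) (use N0 in \<open>auto simp: negligible_iff_null_sets[symmetric] negligible_imp_measurable\<close>)
    have "emeasure lebesgue T = emeasure lebesgue (T - N)"
      by (metis N0 T(3) TN emeasure_Un_null_set fmeasurableD)
    then have T\<delta>: "measure lebesgue T < \<delta>"
      using T(4) Tm by (metis emeasure_eq_measure2 ennreal_less_iff measure_nonneg)
    have "\<forall>x. \<exists>d>0. (x \<in> {a..b} - N \<longrightarrow>
        (\<forall>y\<in>{a..b}. \<bar>y - x\<bar> < d \<longrightarrow> \<bar>f y - f x - f' x * (y - x)\<bar> \<le> e1 * \<bar>y - x\<bar>)) \<and> (x \<in> N \<longrightarrow> ball x d \<subseteq> T)" (is "\<forall>x. ?P x")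
    proof
      fix x
      consider "x \<in> N" | "x \<in> {a..b} - N" | "x \<notin> N" "x \<notin> {a..b}" by blast
      then show "?P x"
      proof cases
        case 1
        then show ?thesis using T(1,2) open_contains_ball by (metis DiffD2 subset_iff)
      next
        case 2
        then show ?thesis
          using deriv[OF 2, unfolded has_field_derivative_def has_derivative_within_alt] e1(1)
          by (simp add: mult.commute)
      next
        case 3
        then show ?thesis by (intro exI[of _ 1]) auto
      qed
    qed
    then obtain d where d0: "\<And>x. d x > 0" and dN: "\<And>x. x \<in> N \<Longrightarrow> ball x (d x) \<subseteq> T"
      and d: "\<And>x y. x \<in> {a..b} - N \<Longrightarrow> y \<in> {a..b} \<Longrightarrow> \<bar>y - x\<bar> < d x \<Longrightarrow>
         \<bar>f y - f x - f' x * (y - x)\<bar> \<le> e1 * \<bar>y - x\<bar>" by metis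
    show "\<exists>\<gamma>. gauge \<gamma> \<and> (\<forall>p. p tagged_division_of cbox a b \<and> \<gamma> fine p \<longrightarrow>
      norm ((\<Sum>(x, K)\<in>p. measure lborel K *\<^sub>R g x) - (f b - f a)) < e)"
    proof (intro exI conjI allI impI; (elim conjE)?)
      show "gauge (\<lambda>x. ball x (d x))" using d0 gauge_ball_dependent by blast
      fix p assume ptag: "p tagged_division_of cbox a b" and finep: "(\<lambda>x. ball x (d x)) fine p"
      have fp: "finite p" by (rule tagged_division_ofD(1)[OF ptag])
      have pK: "K = {Inf K..Sup K}" "Inf K \<le> x" "x \<le> Sup K" "a \<le> Inf K" "Sup K \<le> b" "K \<subseteq> ball x (d x)"
        if xK: "(x, K) \<in> p" for x K
      proof -
        obtain u v where K: "K = cbox u v" using tagged_division_ofD(4)[OF ptag xK] by blast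
        have "x \<in> K" "K \<subseteq> cbox a b" using tagged_division_ofD(2,3)[OF ptag xK] by auto
        moreover have "K \<subseteq> ball x (d x)" using finep xK by (auto simp: fine_def)
        ultimately show "K = {Inf K..Sup K}" "Inf K \<le> x" "x \<le> Sup K" "a \<le> Inf K" "Sup K \<le> b" "K \<subseteq> ball x (d x)"
          using K by auto
      qed
      define h where "h = (\<lambda>(x, K). measure lborel K * g x - (f (Sup K) - f (Inf K)))"
      define p1 where "p1 = {(x, K) \<in> p. x \<notin> N}"
      define p2 where "p2 = {(x, K) \<in> p. x \<in> N}"
      have pp: "p = p1 \<union> p2" "p1 \<inter> p2 = {}" "finite p1" "finite p2" using fp
        by (auto simp: p1_def p2_def elim: finite_subset[rotated])
      have ba: "b - a = (\<Sum>(x,K)\<in>p. Sup K - Inf K)" "f b - f a = (\<Sum>(x,K)\<in>p. f(Sup K) - f(Inf K))"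
        using additive_tagged_division_1[where f= "\<lambda>x. x"] additive_tagged_division_1[where f= f]
            \<open>a \<le> b\<close> ptag by auto
      have "(\<Sum>(x, K)\<in>p. measure lborel K *\<^sub>R g x) - (f b - f a) = sum h p"
        unfolding ba(2) h_def by (simp add: sum_subtractf split_def)
      also have "\<dots> = sum h p1 + sum h p2" using pp by (simp add: sum.union_disjoint)
      finally have split: "(\<Sum>(x, K)\<in>p. measure lborel K *\<^sub>R g x) - (f b - f a) = sum h p1 + sum h p2" .
      have "\<bar>sum h p1\<bar> \<le> (\<Sum>(x, K)\<in>p1. e1 * (Sup K - Inf K))"
      proof (rule order_trans[OF sum_abs], rule sum_mono, safe)
        fix x K assume "(x, K) \<in> p1"
        then have x: "(x, K) \<in> p" "x \<notin> N" by (auto simp: p1_def)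
        define u v where "u = Inf K" and "v = Sup K"
        note K = pK[OF x(1), folded u_def v_def]
        have x': "x \<in> {a..b} - N" using x K by auto
        have "u \<in> K" "v \<in> K" using K(1,2,3) by auto
        then have "u \<in> ball x (d x)" "v \<in> ball x (d x)" using K(6) by auto
        then have uv: "\<bar>u - x\<bar> < d x" "\<bar>v - x\<bar> < d x" by (auto simp: dist_real_def)
        \<comment> \<open>The tag lies between the endpoints, so the two errors add up to at most
          \<open>e1 * (v - u)\<close>.\<close>
        have "\<bar>f u - f x - f' x * (u - x)\<bar> \<le> e1 * \<bar>u - x\<bar>" "\<bar>f v - f x - f' x * (v - x)\<bar> \<le> e1 * \<bar>v - x\<bar>"
          using K uv by (intro d[OF x']; auto)+
        then have "\<bar>(v - u) * f' x - (f v - f u)\<bar> \<le> e1 * (v - u)"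
          using K(2,3) by (auto simp: algebra_simps abs_if split: if_splits)
        moreover have "measure lborel K = v - u" using K(1,2,3) by (metis content_real order_trans)
        ultimately show "\<bar>h (x, K)\<bar> \<le> e1 * (Sup K - Inf K)"
          using x by (simp add: h_def g_def u_def v_def)
      qed
      also have "\<dots> \<le> (\<Sum>(x, K)\<in>p. e1 * (Sup K - Inf K))"
      proof (rule sum_mono2[OF fp])
        fix z assume "z \<in> p - p1"
        then show "0 \<le> (case z of (x, K) \<Rightarrow> e1 * (Sup K - Inf K))"
          using pK(2,3)[of "fst z" "snd z"] e1(1) by (cases z) (auto intro!: mult_nonneg_nonneg)
      qed (use pp in auto)
      also have "\<dots> = e1 * (b - a)" unfolding ba(1) by (simp add: sum_distrib_left split_def)
      finally have h1: "\<bar>sum h p1\<bar> < e / 2" using e1(2) by simp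
      \<comment> \<open>Absolute continuity speaks of sets of endpoint pairs, so tagged intervals
        are turned into such pairs. Nothing is lost: two different entries with the same interval
        would have disjoint interiors, hence a degenerate interval and the same tag.\<close>
      define J where "J = (\<lambda>(x :: real, K). (Inf K, Sup K :: real))"
      have Jinj: "inj_on J p2"
      proof (rule inj_onI)
        fix r s assume "r \<in> p2" "s \<in> p2" "J r = J s"
        then obtain x K y L where rs: "r = (x, K)" "s = (y, L)"
          and xy: "(x, K) \<in> p2" "(y, L) \<in> p2" "J (x, K) = J (y, L)" by (metis surj_pair)
        then have xp: "(x, K) \<in> p" "(y, L) \<in> p" by (auto simp: p2_def)
        note K = pK[OF xp(1)] and L = pK[OF xp(2)]
        have KL: "K = L" using K(1) L(1) xy(3) by (simp add: J_def)
        have "x = y"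
        proof (rule ccontr)
          assume "x \<noteq> y"
          then have "interior K \<inter> interior L = {}" using tagged_division_ofD(5)[OF ptag xp] by blast
          then have "interior {Inf K..Sup K} = {}" using KL K(1) by simp
          then have "\<not> Inf K < Sup K" by (simp add: interior_atLeastAtMost_real)
          then show False using \<open>x \<noteq> y\<close> K(2,3) L(2,3) KL by simp
        qed
        then show "r = s" using KL rs by simp
      qed
      have sJ: "(\<Sum>(u, v)\<in>J ` p2. F u v) = (\<Sum>(x, K)\<in>p2. F (Inf K) (Sup K))" for F :: "real \<Rightarrow> real \<Rightarrow> real"
        by (subst sum.reindex[OF Jinj]) (simp add: J_def split_def o_def)
      have dis: "disjoint_family_on (\<lambda>(u, v). {u<..<v}) (J ` p2)"
        unfolding disjoint_family_on_def
      proof (intro ballI impI)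
        fix r s assume "r \<in> J ` p2" "s \<in> J ` p2" "r \<noteq> s"
        then obtain x K y L where rs: "r = J (x, K)" "s = J (y, L)" "(x, K) \<noteq> (y, L)" and xp: "(x, K) \<in> p" "(y, L) \<in> p"
          by (auto simp: p2_def)
        have "interior K \<inter> interior L = {}" by (rule tagged_division_ofD(5)[OF ptag xp rs(3)])
        then have "interior {Inf K..Sup K} \<inter> interior {Inf L..Sup L} = {}"
          using pK(1)[OF xp(1)] pK(1)[OF xp(2)] by simp
        then show "(case r of (u, v) \<Rightarrow> {u<..<v}) \<inter> (case s of (u, v) \<Rightarrow> {u<..<v}) = {}"
          using rs(1,2) by (simp add: J_def interior_atLeastAtMost_real)
      qed
      have rng: "a \<le> u \<and> u \<le> v \<and> v \<le> b \<and> {u<..<v} \<subseteq> T" if uv: "(u, v) \<in> J ` p2" for u v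
      proof -
        obtain x K where x: "(x, K) \<in> p" "x \<in> N" "u = Inf K" "v = Sup K" using uv by (auto simp: p2_def J_def)
        have "{Inf K<..<Sup K} \<subseteq> K" by (subst (3) pK(1)[OF x(1)]) auto
        then show ?thesis using pK(2-6)[OF x(1)] dN[OF x(2)] x(3,4) by auto
      qed
      have "(\<Sum>(u, v)\<in>J ` p2. v - u) = (\<Sum>i\<in>J ` p2. measure lebesgue ((\<lambda>(u, v). {u<..<v}) i))"
        by (intro sum.cong) (use rng in auto)
      also have "\<dots> = measure lebesgue (\<Union>i\<in>J ` p2. (\<lambda>(u, v). {u<..<v}) i)"
        using dis pp(4) by (intro measure_UNION'[symmetric])
          (auto simp: pairwise_def disjnt_def disjoint_family_on_def split: prod.splits)
      also have "\<dots> \<le> measure lebesgue T"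
      proof (rule measure_mono_fmeasurable[OF _ _ Tm])
        show "(\<Union>i\<in>J ` p2. (\<lambda>(u, v). {u<..<v}) i) \<subseteq> T"
        proof (rule UN_least)
          fix i assume "i \<in> J ` p2"
          then show "(\<lambda>(u, v). {u<..<v}) i \<subseteq> T" using rng[of "fst i" "snd i"] by (simp add: split_def)
        qed
        show "(\<Union>i\<in>J ` p2. (\<lambda>(u, v). {u<..<v}) i) \<in> sets lebesgue"
          using pp(4) by (intro sets.finite_UN) (auto simp: split_def)
      qed
      finally have "(\<Sum>(u, v)\<in>J ` p2. v - u) < \<delta>" using T\<delta> by simp
      then have "(\<Sum>(u, v)\<in>J ` p2. \<bar>f v - f u\<bar>) < e / 2"
      proof (intro ac\<delta> ballI dis)
        fix i assume "i \<in> J ` p2"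
        then show "case i of (u, v) \<Rightarrow> a \<le> u \<and> u \<le> v \<and> v \<le> b"
          using rng[of "fst i" "snd i"] by (simp add: split_def)
      qed (use pp(4) in auto)
      moreover have "\<bar>sum h p2\<bar> \<le> (\<Sum>(x, K)\<in>p2. \<bar>f (Sup K) - f (Inf K)\<bar>)"
        by (rule order_trans[OF sum_abs], rule sum_mono) (auto simp: h_def g_def p2_def)
      ultimately have h2: "\<bar>sum h p2\<bar> < e / 2" unfolding sJ by simp
      show "norm ((\<Sum>(x, K)\<in>p. measure lborel K *\<^sub>R g x) - (f b - f a)) < e"
        unfolding split using h1 h2 by simp
    qed
  qed
  then show ?thesis
    by (intro has_integral_spike[OF N, of "{a..b}" f' g]) (auto simp: g_def)
qed

section \<open>Piecewise continuous functions on the half-line: closure properties, boundedness,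
  integrability\<close>

lemma at_within_atLeast_eq_Icc:
  fixes t T :: real
  assumes "t < T" shows "at t within {0..} = at t within {0..T}"
  by (rule at_within_nhd[of _ "{..<T}"]) (use assms in auto)

lemma continuous_on_atLeastI:
  fixes f :: "real \<Rightarrow> 'a::topological_space"
  assumes "\<And>T. continuous_on {0..T} f"
  shows "continuous_on {0..} f"
  unfolding continuous_on_eq_continuous_within
proof
  fix t :: real assume t: "t \<in> {0..}"
  have "continuous (at t within {0..t+1}) f"
    using assms[of "t+1"] t unfolding continuous_on_eq_continuous_within by auto
  then show "continuous (at t within {0..}) f"
    using at_within_atLeast_eq_Icc[of t "t+1"] by (simp add: continuous_within)
qed

lemma continuous_within_atLeast_cong:
  fixes t :: real
  assumes "\<And>s. s \<ge> 0 \<Longrightarrow> f s = g s" "t \<ge> 0"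
  shows "continuous (at t within {0..}) f \<longleftrightarrow> continuous (at t within {0..}) g"
  unfolding continuous_within assms(1)[OF assms(2)]
  by (rule Lim_cong_within) (use assms in auto)

text \<open>Signals carry no information at negative times, so functions are only known to agree on
  the half-line. All limits in the definition see nonnegative times only: left limits are taken at t
  > 0 and are local.\<close>

lemma pw_continuous_cong:
  assumes "\<And>s. s \<ge> 0 \<Longrightarrow> f s = g s"
  shows "pw_continuous f \<longleftrightarrow> pw_continuous g"
proof -
  have "{t \<in> {0..T}. \<not> continuous (at t within {0..}) f} = {t \<in> {0..T}. \<not> continuous (at t within {0..}) g}" for T
    using continuous_within_atLeast_cong[of f g] assms by auto
  moreover have "(f \<longlongrightarrow> l) (at_right t) \<longleftrightarrow> (g \<longlongrightarrow> l) (at_right t)" if "t \<ge> 0" for t l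
    by (rule Lim_cong_within) (use assms that in auto)
  moreover have "(f \<longlongrightarrow> l) (at_left t) \<longleftrightarrow> (g \<longlongrightarrow> l) (at_left t)" if "t > 0" for t l
  proof (rule tendsto_cong)
    have "eventually (\<lambda>s. s \<in> {0<..<t}) (at_left t)" using that by (rule eventually_at_left_real)
    then show "\<forall>\<^sub>F s in at_left t. f s = g s" by eventually_elim (use assms in auto)
  qed
  ultimately show ?thesis unfolding pw_continuous_def by simp
qed

lemma pw_continuous_map:
  fixes f :: "real \<Rightarrow> 'a::topological_space" and h :: "'a \<Rightarrow> 'b::topological_space"
  assumes "pw_continuous f" "continuous_on UNIV h"
  shows "pw_continuous (\<lambda>t. h (f t))"
proof -
  have h: "(h \<longlongrightarrow> h l) (nhds l)" for l
    using assms(2) by (simp add: continuous_on_def tendsto_at_iff_tendsto_nhds)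
  have *: "((\<lambda>t. h (f t)) \<longlongrightarrow> h l) F" if "(f \<longlongrightarrow> l) F" for l F
    using filterlim_compose[OF h that] .
  have "{t \<in> {0..T}. \<not> continuous (at t within {0..}) (\<lambda>t. h (f t))} \<subseteq> {t \<in> {0..T}. \<not> continuous (at t within {0..}) f}" for T
    using * unfolding continuous_within by auto
  then have "finite {t \<in> {0..T}. \<not> continuous (at t within {0..}) (\<lambda>t. h (f t))}" if "T \<ge> 0" for T
    by (rule finite_subset) (use assms(1) that in \<open>auto simp: pw_continuous_def\<close>)
  moreover have "\<exists>l. ((\<lambda>t. h (f t)) \<longlongrightarrow> l) (at_right t)" if "t \<ge> 0" for t
    using assms(1) that * unfolding pw_continuous_def by blast
  moreover have "\<exists>l. ((\<lambda>t. h (f t)) \<longlongrightarrow> l) (at_left t)" if "t > 0" for t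
    using assms(1) that * unfolding pw_continuous_def by blast
  ultimately show ?thesis unfolding pw_continuous_def by simp
qed

lemma pw_continuous_Pair:
  assumes "pw_continuous f" "pw_continuous g"
  shows "pw_continuous (\<lambda>t. (f t, g t))"
proof -
  have "{t \<in> {0..T}. \<not> continuous (at t within {0..}) (\<lambda>t. (f t, g t))} \<subseteq>
    {t \<in> {0..T}. \<not> continuous (at t within {0..}) f} \<union> {t \<in> {0..T}. \<not> continuous (at t within {0..}) g}" for T
    by (auto intro: continuous_Pair)
  then have "finite {t \<in> {0..T}. \<not> continuous (at t within {0..}) (\<lambda>t. (f t, g t))}" if "T \<ge> 0" for T
    by (rule finite_subset) (use assms that in \<open>auto simp: pw_continuous_def\<close>)
  moreover have "\<exists>l. ((\<lambda>t. (f t, g t)) \<longlongrightarrow> l) (at_right t)" if t: "t \<ge> 0" for t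
  proof -
    have "\<exists>l. (f \<longlongrightarrow> l) (at_right t)" "\<exists>l. (g \<longlongrightarrow> l) (at_right t)"
      using assms t unfolding pw_continuous_def by simp_all
    then show ?thesis by (elim exE) (rule exI, rule tendsto_Pair)
  qed
  moreover have "\<exists>l. ((\<lambda>t. (f t, g t)) \<longlongrightarrow> l) (at_left t)" if t: "t > 0" for t
  proof -
    have "\<exists>l. (f \<longlongrightarrow> l) (at_left t)" "\<exists>l. (g \<longlongrightarrow> l) (at_left t)"
      using assms t unfolding pw_continuous_def by simp_all
    then show ?thesis by (elim exE) (rule exI, rule tendsto_Pair)
  qed
  ultimately show ?thesis unfolding pw_continuous_def by simp
qed

lemma pw_continuous_add:
  fixes f g :: "real \<Rightarrow> real"
  assumes "pw_continuous f" "pw_continuous g" shows "pw_continuous (\<lambda>t. f t + g t)"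
  using pw_continuous_map[OF pw_continuous_Pair[OF assms], of "\<lambda>z. fst z + snd z"]
  by (simp add: continuous_intros)

lemma pw_continuous_mult:
  fixes f g :: "real \<Rightarrow> real"
  assumes "pw_continuous f" "pw_continuous g" shows "pw_continuous (\<lambda>t. f t * g t)"
  using pw_continuous_map[OF pw_continuous_Pair[OF assms], of "\<lambda>z. fst z * snd z"]
  by (simp add: continuous_intros)

lemma pw_continuous_const: "pw_continuous (\<lambda>t. c)"
  unfolding pw_continuous_def by (auto intro: tendsto_const)

lemma pw_continuous_sum:
  fixes f :: "'i \<Rightarrow> real \<Rightarrow> real"
  assumes "\<And>i. i \<in> I \<Longrightarrow> pw_continuous (f i)"
  shows "pw_continuous (\<lambda>t. \<Sum>i\<in>I. f i t)"
  using assms by (induction I rule: infinite_finite_induct) (auto intro: pw_continuous_add pw_continuous_const)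

lemma pw_continuous_continuous_on:
  assumes "continuous_on {0..} f" shows "pw_continuous f"
proof -
  have c: "(f \<longlongrightarrow> f t) (at t within {0..})" if "t \<ge> 0" for t
    using assms that unfolding continuous_on by auto
  moreover have "(f \<longlongrightarrow> f t) (at_right t)" if "t \<ge> 0" for t
    using that by (intro tendsto_within_subset[OF c[OF that]]) auto
  moreover have "(f \<longlongrightarrow> f t) (at_left t)" if "t > 0" for t
  proof -
    have "at t within {0..} = at t" using that by (intro at_within_interior) simp
    then have "(f \<longlongrightarrow> f t) (at t)" using c[of t] that by simp
    then show ?thesis by (rule tendsto_within_subset) simp
  qed
  moreover have "{t \<in> {0..T}. \<not> continuous (at t within {0..}) f} = {}" for T
    using c by (simp add: continuous_within)
  ultimately show ?thesis unfolding pw_continuous_def by (metis finite.emptyI)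
qed

text \<open>The one-sided limits and the value at the point bound f on a neighbourhood of each point
  of [0,T]; compactness leaves finitely many neighbourhoods.\<close>

lemma pw_continuous_bounded:
  fixes f :: "real \<Rightarrow> real"
  assumes "pw_continuous f"
  shows "\<exists>K>0. \<forall>t\<in>{0..T}. \<bar>f t\<bar> \<le> K"
proof -
  have "\<exists>U K. open U \<and> t \<in> U \<and> (\<forall>s\<in>U \<inter> {0..}. \<bar>f s\<bar> \<le> K)" if t: "t \<in> {0..T}" for t
  proof -
    have side: "\<exists>U K. open U \<and> t \<in> U \<and> (\<forall>s\<in>U \<inter> S. \<bar>f s\<bar> \<le> K)" if l: "(f \<longlongrightarrow> l) (at t within S)" for l S
    proof -
      have "\<forall>\<^sub>F s in at t within S. dist (f s) l < 1" using l by (rule tendstoD) simp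
      then obtain U where U: "open U" "t \<in> U" "\<And>s. s \<in> U \<Longrightarrow> s \<noteq> t \<Longrightarrow> s \<in> S \<Longrightarrow> dist (f s) l < 1"
        unfolding eventually_at_topological by blast
      have "\<bar>f s\<bar> \<le> max \<bar>f t\<bar> (\<bar>l\<bar> + 1)" if "s \<in> U \<inter> S" for s
        using U(3)[of s] that by (cases "s = t") (auto simp: dist_real_def)
      then show ?thesis using U by blast
    qed
    obtain l where "(f \<longlongrightarrow> l) (at_right t)" using assms t unfolding pw_continuous_def by auto
    from side[OF this] obtain U K where U: "open U" "t \<in> U" "\<And>s. s \<in> U \<inter> {t<..} \<Longrightarrow> \<bar>f s\<bar> \<le> K" by blast
    have "\<exists>V L. open V \<and> t \<in> V \<and> (\<forall>s\<in>V \<inter> ({..<t} \<inter> {0..}). \<bar>f s\<bar> \<le> L)"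
    proof (cases "t > 0")
      case True
      then obtain l where "(f \<longlongrightarrow> l) (at_left t)" using assms unfolding pw_continuous_def by auto
      from side[OF this] show ?thesis by blast
    next
      case False
      then have "{..<t} \<inter> {0..} = {}" using t by auto
      then show ?thesis by auto
    qed
    then obtain V L where V: "open V" "t \<in> V" "\<And>s. s \<in> V \<inter> ({..<t} \<inter> {0..}) \<Longrightarrow> \<bar>f s\<bar> \<le> L" by blast
    have "\<bar>f s\<bar> \<le> max \<bar>f t\<bar> (max K L)" if "s \<in> (U \<inter> V) \<inter> {0..}" for s
      using U(3)[of s] V(3)[of s] that by (cases s t rule: linorder_cases) (auto simp: max_def)
    then show ?thesis using U V by (intro exI[of _ "U \<inter> V"]) (auto intro!: exI[of _ "max \<bar>f t\<bar> (max K L)"])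
  qed
  then obtain U K where U: "\<And>t. t \<in> {0..T} \<Longrightarrow> open (U t)" "\<And>t. t \<in> {0..T} \<Longrightarrow> t \<in> U t"
    and K: "\<And>t s. t \<in> {0..T} \<Longrightarrow> s \<in> U t \<inter> {0..} \<Longrightarrow> \<bar>f s\<bar> \<le> K t" by metis
  obtain C where C: "C \<subseteq> {0..T}" "finite C" "{0..T} \<subseteq> (\<Union>c\<in>C. U c)"
    using compactE_image[OF compact_Icc, of "{0..T}" U 0 T] U by blast
  \<comment> \<open>The summand 1 keeps the bound positive even for an empty cover, which occurs for
    T < 0.\<close>
  define B where "B = 1 + (\<Sum>c\<in>C. \<bar>K c\<bar>)"
  have "\<bar>f t\<bar> \<le> B" if t: "t \<in> {0..T}" for t
  proof -
    obtain c where c: "c \<in> C" "t \<in> U c" using C t by blast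
    have "\<bar>f t\<bar> \<le> K c" using K[of c t] c C t by auto
    also have "\<dots> \<le> \<bar>K c\<bar>" by simp
    also have "\<dots> \<le> (\<Sum>c\<in>C. \<bar>K c\<bar>)" using c C by (intro member_le_sum) auto
    finally show ?thesis by (simp add: B_def)
  qed
  moreover have "(\<Sum>c\<in>C. \<bar>K c\<bar>) \<ge> 0" by (intro sum_nonneg) simp
  then have "B > 0" unfolding B_def by linarith
  ultimately show ?thesis by blast
qed

text \<open>Off the finitely many discontinuities f is continuous, hence measurable, and it is
  bounded; the exceptional finite set is negligible.\<close>

lemma pw_continuous_integrable:
  fixes f :: "real \<Rightarrow> real"
  assumes f: "pw_continuous f"
  shows "f integrable_on {0..T}"
proof (cases "T \<ge> 0")
  case True
  define F where "F = {t \<in> {0..T}. \<not> continuous (at t within {0..}) f}"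
  have fF: "finite F" using f True unfolding pw_continuous_def F_def by blast
  obtain K where "K > 0" and K: "\<And>t. t \<in> {0..T} \<Longrightarrow> \<bar>f t\<bar> \<le> K"
    using pw_continuous_bounded[OF f, of T] by blast
  have S: "{0..T} - F \<in> sets lebesgue" using fF by (intro sets.Diff) (auto simp: finite_imp_closed)
  have "continuous_on ({0..T} - F) f"
    unfolding continuous_on_eq_continuous_within
    by (auto simp: F_def intro: continuous_within_subset)
  then have "f \<in> borel_measurable (lebesgue_on ({0..T} - F))"
    using S by (rule continuous_imp_measurable_on_sets_lebesgue)
  moreover have "(\<lambda>t. K) integrable_on ({0..T} - F)"
    by (rule integrable_spike_set[of "\<lambda>t. K" "{0..T}"])
      (use fF in \<open>auto intro!: negligible_subset[OF negligible_finite[OF fF]] integrable_const_ivl\<close>)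
  ultimately have "f integrable_on ({0..T} - F)"
    using K S by (intro measurable_bounded_by_integrable_imp_integrable[of f _ "\<lambda>t. K"]) auto
  then show ?thesis
    by (rule integrable_spike_set) (auto intro!: negligible_subset[OF negligible_finite[OF fF]])
qed (use integrable_on_empty in auto)

lemma pw_continuous_integral_continuous:
  fixes f :: "real \<Rightarrow> real"
  assumes "pw_continuous f"
  shows "continuous_on {0..} (\<lambda>t. integral {0..t} f)"
  by (intro continuous_on_atLeastI indefinite_integral_continuous_1 pw_continuous_integrable assms)

text \<open>Each term of the exponential series, multiplied by K, integrates to the next one; this
  drives the induction of the Picard estimate.\<close>

lemma has_integral_power_over_fact:
  fixes K t :: real
  assumes "t \<ge> 0"
  shows "((\<lambda>s. K * (C * (K * s) ^ k / fact k)) has_integral C * (K * t) ^ Suc k / fact (Suc k)) {0..t}"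
proof -
  have "((\<lambda>s. K * (C * (K * s) ^ k / fact k)) has_integral
      (C * (K * t) ^ Suc k / fact (Suc k) - C * (K * 0) ^ Suc k / fact (Suc k))) {0..t}"
  proof (rule fundamental_theorem_of_calculus[OF assms])
    fix s assume "s \<in> {0..t}"
    have "((\<lambda>s. K * s) has_real_derivative K) (at s within {0..t})"
      by (auto intro!: derivative_eq_intros)
    from DERIV_cmult[OF DERIV_power_Suc[OF this, of k], of "C / fact (Suc k)"]
    have "((\<lambda>s. C * (K * s) ^ Suc k / fact (Suc k)) has_real_derivative
        C / fact (Suc k) * ((1 + real k) * (K * (K * s) ^ k))) (at s within {0..t})"
      by (simp only: times_divide_eq_left)
    also have "C / fact (Suc k) * ((1 + real k) * (K * (K * s) ^ k)) = K * (C * (K * s) ^ k / fact k)"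
    proof -
      have "fact (Suc k) = (1 + real k) * fact k" "1 + real k \<noteq> 0" by simp_all
      then show ?thesis by (simp only: times_divide_eq_left times_divide_eq_right mult.left_commute[of _ "1 + real k"]) simp
    qed
    finally show "((\<lambda>s. C * (K * s) ^ Suc k / fact (Suc k)) has_vector_derivative K * (C * (K * s) ^ k / fact k)) (at s within {0..t})"
      by (simp add: has_real_derivative_iff_has_vector_derivative)
  qed
  then show ?thesis by simp
qed

text \<open>The sequence is left arbitrary because two are needed: the successive differences of the
  Picard iteration, and a sequence constant in k, for which the bound tends to zero and forces the
  function to vanish.\<close>

lemma iterated_integral_bound:
  fixes m :: "nat \<Rightarrow> real \<Rightarrow> real"
  assumes m0: "\<And>t. t \<in> {0..T} \<Longrightarrow> m 0 t \<le> C" and K: "K \<ge> 0"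
    and int: "\<And>k. m k integrable_on {0..T}"
    and step: "\<And>k t. t \<in> {0..T} \<Longrightarrow> m (Suc k) t \<le> K * integral {0..t} (m k)"
    and t: "t \<in> {0..T}"
  shows "m k t \<le> C * (K * t) ^ k / fact k"
  using t
proof (induction k arbitrary: t)
  case 0
  then show ?case using m0 by simp
next
  case (Suc k)
  have "m k integrable_on {0..t}" using int[of k] by (rule integrable_on_subinterval) (use Suc.prems in auto)
  then have i: "((\<lambda>s. K * m k s) has_integral K * integral {0..t} (m k)) {0..t}"
    by (intro has_integral_mult_right) auto
  have "m (Suc k) t \<le> K * integral {0..t} (m k)" by (rule step[OF Suc.prems])
  also have "\<dots> \<le> C * (K * t) ^ Suc k / fact (Suc k)"
  proof (rule has_integral_le[OF i has_integral_power_over_fact])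
    fix s assume "s \<in> {0..t}"
    then show "K * m k s \<le> K * (C * (K * s) ^ k / fact k)"
      using Suc.IH[of s] Suc.prems K by (intro mult_left_mono) auto
  qed (use Suc.prems in auto)
  finally show ?case .
qed

section \<open>Linear integral equations\<close>

lemma power_over_fact_tendsto_zero: "(\<lambda>k. C * x ^ k / fact k) \<longlonglongrightarrow> (0 :: real)"
proof -
  have "(\<lambda>k. C * (inverse (fact k) * x ^ k)) \<longlonglongrightarrow> C * 0"
    by (intro tendsto_mult_left summable_LIMSEQ_zero summable_exp)
  then show ?thesis by (simp add: divide_inverse mult_ac)
qed

text \<open>Iterating this bound yields both uniqueness and convergence of the Picard iteration.\<close>
lemma linear_integral_sum_abs_le:
  fixes a :: "nat \<Rightarrow> nat \<Rightarrow> real \<Rightarrow> real" and d e :: "nat \<Rightarrow> real \<Rightarrow> real"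
  assumes int: "\<And>i. i < n \<Longrightarrow> ((\<lambda>s. \<Sum>j<n. a i j s * e j s) has_integral d i t) {0..t}"
    and a: "\<And>i j s. i < n \<Longrightarrow> j < n \<Longrightarrow> s \<in> {0..t} \<Longrightarrow> \<bar>a i j s\<bar> \<le> K"
    and e: "(\<lambda>s. \<Sum>j<n. \<bar>e j s\<bar>) integrable_on {0..t}"
  shows "(\<Sum>i<n. \<bar>d i t\<bar>) \<le> (real n * K) * integral {0..t} (\<lambda>s. \<Sum>j<n. \<bar>e j s\<bar>)"
proof -
  define m where "m s = (\<Sum>j<n. \<bar>e j s\<bar>)" for s
  have K: "((\<lambda>s. K * m s) has_integral K * integral {0..t} m) {0..t}"
    using e unfolding m_def by (intro has_integral_mult_right integrable_integral)
  have "\<bar>d i t\<bar> \<le> K * integral {0..t} m" if i: "i < n" for i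
  proof -
    have *: "\<bar>\<Sum>j<n. a i j s * e j s\<bar> \<le> K * m s" if s: "s \<in> {0..t}" for s
    proof -
      have "\<bar>\<Sum>j<n. a i j s * e j s\<bar> \<le> (\<Sum>j<n. \<bar>a i j s\<bar> * \<bar>e j s\<bar>)"
        using sum_abs[of "\<lambda>j. a i j s * e j s" "{..<n}"] by (simp add: abs_mult)
      also have "\<dots> \<le> (\<Sum>j<n. K * \<bar>e j s\<bar>)" using a[OF i _ s] by (intro sum_mono mult_right_mono) auto
      finally show ?thesis by (simp add: m_def sum_distrib_left)
    qed
    have "d i t \<le> K * integral {0..t} m"
      by (rule has_integral_le[OF int[OF i] K]) (use * in \<open>fastforce simp: abs_le_iff\<close>)
    moreover have "- d i t \<le> K * integral {0..t} m"
      by (rule has_integral_le[OF has_integral_neg[OF int[OF i]] K]) (use * in \<open>fastforce simp: abs_le_iff\<close>)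
    ultimately show ?thesis by (simp add: abs_le_iff)
  qed
  then have "(\<Sum>i<n. \<bar>d i t\<bar>) \<le> (\<Sum>i<n. K * integral {0..t} m)" by (intro sum_mono) auto
  then show ?thesis by (simp add: m_def[abs_def])
qed

text \<open>Meant for differences of two solutions, where it gives uniqueness, and for time-reversed
  solutions, where it gives injectivity of the flow.\<close>

lemma linear_integral_equation_zero:
  fixes a :: "nat \<Rightarrow> nat \<Rightarrow> real \<Rightarrow> real" and d :: "nat \<Rightarrow> real \<Rightarrow> real"
  assumes int: "\<And>i t. i < n \<Longrightarrow> t \<in> {0..T} \<Longrightarrow> ((\<lambda>s. \<Sum>j<n. a i j s * d j s) has_integral d i t) {0..t}"
    and a: "\<And>i j s. i < n \<Longrightarrow> j < n \<Longrightarrow> s \<in> {0..T} \<Longrightarrow> \<bar>a i j s\<bar> \<le> K" and K: "K \<ge> 0"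
    and i: "i < n" and t: "t \<in> {0..T}"
  shows "d i t = 0"
proof -
  have T: "T \<in> {0..T}" using t by auto
  define m where "m s = (\<Sum>j<n. \<bar>d j s\<bar>)" for s
  have cont: "continuous_on {0..T} (d i)" if i: "i < n" for i
  proof -
    have "continuous_on {0..T} (\<lambda>t. integral {0..t} (\<lambda>s. \<Sum>j<n. a i j s * d j s))"
      by (intro indefinite_integral_continuous_1 has_integral_integrable[OF int[OF i T]])
    then show ?thesis
      by (rule continuous_on_eq) (use int[OF i] in \<open>simp add: integral_unique\<close>)
  qed
  have mc: "continuous_on {0..T} m" unfolding m_def by (intro continuous_intros cont) auto
  then obtain C where C: "\<And>s. s \<in> {0..T} \<Longrightarrow> m s \<le> C"
    using continuous_attains_sup[OF compact_Icc _ mc] T by (metis emptyE)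
  have mi: "m integrable_on {0..s}" if "s \<in> {0..T}" for s
    by (rule integrable_continuous_interval, rule continuous_on_subset[OF mc]) (use that in auto)
  \<comment> \<open>The sequence constant in k satisfies the iteration hypothesis, so
    \<open>m t\<close> lies below every term of a null sequence.\<close>
  have "m t \<le> C * ((real n * K) * t) ^ k / fact k" for k
  proof (rule iterated_integral_bound[where m = "\<lambda>k. m" and T = T])
    fix s assume s: "s \<in> {0..T}"
    show "m s \<le> real n * K * integral {0..s} m"
      using linear_integral_sum_abs_le[of n a d d s K] int a mi s unfolding m_def[abs_def] by auto
  qed (use C K mi[OF T] t in auto)
  then have "m t \<le> 0"
    using LIMSEQ_le_const[OF power_over_fact_tendsto_zero] by blast
  moreover have "\<bar>d i t\<bar> \<le> m t" unfolding m_def using i by (intro member_le_sum[of i "{..<n}" "\<lambda>j. \<bar>d j t\<bar>"]) auto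
  ultimately show ?thesis by simp
qed

text \<open>The coefficients are only piecewise continuous, so the limit of the Picard iteration is
  taken in the integral equation by dominated convergence, and no derivative is involved.\<close>

lemma picard_existence:
  fixes a :: "nat \<Rightarrow> nat \<Rightarrow> real \<Rightarrow> real" and b :: "nat \<Rightarrow> real \<Rightarrow> real" and \<xi> :: "nat \<Rightarrow> real"
  assumes a: "\<And>i j. i < n \<Longrightarrow> j < n \<Longrightarrow> pw_continuous (a i j)"
    and b: "\<And>i. i < n \<Longrightarrow> pw_continuous (b i)"
  shows "\<exists>x. \<forall>i<n. \<forall>t\<ge>0. ((\<lambda>s. (\<Sum>j<n. a i j s * x j s) + b i s) has_integral (x i t - \<xi> i)) {0..t}"
proof -
  let ?F = "\<lambda>y i s. (\<Sum>j<n. a i j s * y j s) + b i s"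
  define x where "x = rec_nat (\<lambda>i t. \<xi> i) (\<lambda>k xk i t. \<xi> i + integral {0..t} (\<lambda>s. ?F xk i s))"
  have x0: "x 0 i t = \<xi> i" and xS: "x (Suc k) i t = \<xi> i + integral {0..t} (\<lambda>s. ?F (x k) i s)" for k i t
    by (simp_all add: x_def)
  have pw: "pw_continuous (\<lambda>s. ?F y i s)"
    if "i < n" "\<And>j. j < n \<Longrightarrow> continuous_on {0..} (y j)" for i y
    using that a b by (intro pw_continuous_add pw_continuous_sum pw_continuous_mult) (simp_all add: pw_continuous_continuous_on)
  have xc: "continuous_on {0..} (x k i)" if "i < n" for k i
    using that
  proof (induction k arbitrary: i)
    case 0
    show ?case by (simp add: x0 cong: continuous_on_cong)
  next
    case (Suc k)
    show ?case
      using pw_continuous_integral_continuous[OF pw[OF Suc.prems Suc.IH]] Suc.prems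
      by (simp add: xS[abs_def] continuous_intros cong: continuous_on_cong)
  qed
  have xint: "((\<lambda>s. ?F (x k) i s) has_integral (x (Suc k) i t - \<xi> i)) {0..t}" if "i < n" for k i t
    using integrable_integral[OF pw_continuous_integrable[OF pw[OF that xc[of _ k]], where T = t]] by (simp add: xS)
  define f where "f k i t = x (Suc k) i t - x k i t" for k i t
  define m where "m k t = (\<Sum>i<n. \<bar>f k i t\<bar>)" for k t
  \<comment> \<open>Summable bounds are obtained on each [0,T] separately, since the constants
    depend on T. The limit X is defined by the series alone and so is common to all T.\<close>
  have bnd: "\<exists>M. summable M \<and> (\<forall>k. \<forall>i<n. \<forall>t\<in>{0..T}. \<bar>f k i t\<bar> \<le> M k)" if T: "T \<ge> 0" for T
  proof -
    have "\<forall>i j. \<exists>K. i < n \<longrightarrow> j < n \<longrightarrow> (\<forall>s\<in>{0..T}. \<bar>a i j s\<bar> \<le> K)"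
      using pw_continuous_bounded[OF a] by metis
    then obtain Kf where Kf: "\<And>i j s. i < n \<Longrightarrow> j < n \<Longrightarrow> s \<in> {0..T} \<Longrightarrow> \<bar>a i j s\<bar> \<le> Kf i j" by metis
    define K where "K = (\<Sum>i<n. \<Sum>j<n. \<bar>Kf i j\<bar>)"
    have K0: "K \<ge> 0" unfolding K_def by (intro sum_nonneg) auto
    have aK: "\<bar>a i j s\<bar> \<le> K" if "i < n" "j < n" "s \<in> {0..T}" for i j s
    proof -
      have "\<bar>a i j s\<bar> \<le> \<bar>Kf i j\<bar>" using Kf[OF that] by simp
      also have "\<dots> \<le> (\<Sum>j<n. \<bar>Kf i j\<bar>)" using that by (intro member_le_sum) auto
      also have "\<dots> \<le> K" unfolding K_def using that
        by (intro member_le_sum[of i "{..<n}" "\<lambda>i. \<Sum>j<n. \<bar>Kf i j\<bar>"] sum_nonneg) auto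
      finally show ?thesis .
    qed
    have mc: "continuous_on {0..} (m k)" for k
      unfolding m_def f_def by (intro continuous_intros xc) auto
    have mi: "m k integrable_on {0..s}" for k s
      by (intro pw_continuous_integrable pw_continuous_continuous_on mc)
    have "\<exists>C. \<forall>s\<in>{0..T}. \<bar>m 0 s\<bar> \<le> C"
      using pw_continuous_bounded[OF pw_continuous_continuous_on[OF mc]] by metis
    then obtain C where C: "\<And>s. s \<in> {0..T} \<Longrightarrow> \<bar>m 0 s\<bar> \<le> C" by blast
    have step: "m (Suc k) t \<le> real n * K * integral {0..t} (m k)" if t: "t \<in> {0..T}" for k t
      unfolding m_def[abs_def]
    proof (rule linear_integral_sum_abs_le)
      fix i assume i: "i < n"
      have "((\<lambda>s. ?F (x (Suc k)) i s - ?F (x k) i s)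
        has_integral (x (Suc (Suc k)) i t - \<xi> i - (x (Suc k) i t - \<xi> i))) {0..t}"
        by (intro has_integral_diff xint i)
      moreover have "?F (x (Suc k)) i s - ?F (x k) i s =
          (\<Sum>j<n. a i j s * f k j s)" for s
        by (simp add: f_def right_diff_distrib sum_subtractf)
      ultimately show "((\<lambda>s. \<Sum>j<n. a i j s * f k j s) has_integral f (Suc k) i t) {0..t}"
        by (simp add: f_def)
    next
      show "(\<lambda>s. \<Sum>j<n. \<bar>f k j s\<bar>) integrable_on {0..t}" using mi[of k t] by (simp add: m_def[abs_def])
    qed (use aK t in auto)
    define M where "M k = C * ((real n * K) * T) ^ k / fact k" for k
    have mM: "m k t \<le> M k" if t: "t \<in> {0..T}" for k t
    proof -
      have C0: "C \<ge> 0" using C[OF t] by simp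
      have "m k t \<le> C * ((real n * K) * t) ^ k / fact k"
        by (rule iterated_integral_bound[where m = m and T = T])
          (use C step K0 mi t in \<open>auto simp: abs_le_iff\<close>)
      also have "\<dots> \<le> M k" unfolding M_def using C0 K0 t
        by (intro divide_right_mono mult_left_mono power_mono mult_nonneg_nonneg) auto
      finally show ?thesis .
    qed
    have "\<bar>f k i t\<bar> \<le> M k" if "i < n" "t \<in> {0..T}" for k i t
      using mM[OF that(2), of k] member_le_sum[of i "{..<n}" "\<lambda>i. \<bar>f k i t\<bar>"] that by (simp add: m_def)
    moreover have "summable M"
      unfolding M_def using summable_mult[OF summable_exp[of "(real n * K) * T"], of C]
      by (simp add: divide_inverse mult_ac)
    ultimately show ?thesis by blast
  qed
  have xsum: "x N i t = \<xi> i + (\<Sum>k<N. f k i t)" for N i t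
    by (induction N) (auto simp: x0 f_def)
  define X where "X i t = \<xi> i + (\<Sum>k. f k i t)" for i t
  have "((\<lambda>s. ?F X i s) has_integral (X i T - \<xi> i)) {0..T}" if i: "i < n" and T: "T \<ge> 0" for i T
  proof -
    obtain M where M: "summable M" "\<And>k i t. i < n \<Longrightarrow> t \<in> {0..T} \<Longrightarrow> \<bar>f k i t\<bar> \<le> M k" using bnd[OF T] by metis
    have lim: "(\<lambda>k. x k i t) \<longlonglongrightarrow> X i t" if "i < n" "t \<in> {0..T}" for i t
    proof -
      have "summable (\<lambda>k. f k i t)" by (rule summable_comparison_test'[OF M(1)]) (use M(2) that in auto)
      then show ?thesis unfolding xsum X_def by (intro tendsto_add tendsto_const summable_LIMSEQ)
    qed
    have M0: "M k \<ge> 0" for k using M(2)[OF i, of T k] T by fastforce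
    have xb: "\<bar>x k i t\<bar> \<le> \<bar>\<xi> i\<bar> + suminf M" if "i < n" "t \<in> {0..T}" for k i t
    proof -
      have "\<bar>\<Sum>k<k. f k i t\<bar> \<le> (\<Sum>k<k. M k)" using M(2)[OF that] by (intro order_trans[OF sum_abs] sum_mono)
      also have "\<dots> \<le> suminf M" using M0 by (intro sum_le_suminf M(1)) auto
      finally show ?thesis unfolding xsum by simp
    qed
    \<comment> \<open>All iterates stay within \<open>\<bar>\<xi> j\<bar> + suminf M\<close>, so h
      dominates every integrand.\<close>
    define h where "h s = (\<Sum>j<n. \<bar>a i j s\<bar> * (\<bar>\<xi> j\<bar> + suminf M)) + \<bar>b i s\<bar>" for s
    have abs: "continuous_on UNIV (abs :: real \<Rightarrow> real)" by (rule continuous_on_rabs[OF continuous_on_id])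
    have hpw: "pw_continuous h" unfolding h_def
      by (intro pw_continuous_add pw_continuous_sum pw_continuous_mult pw_continuous_const)
        (use pw_continuous_map[OF a[OF i] abs] pw_continuous_map[OF b[OF i] abs] in auto)
    note dc = dominated_convergence[of "\<lambda>k s. ?F (x k) i s" "{0..T}" h "\<lambda>s. ?F X i s"]
    have 1: "(\<lambda>s. ?F (x k) i s) integrable_on {0..T}" for k
      using xint[OF i] by (rule has_integral_integrable)
    have 2: "norm (?F (x k) i s) \<le> h s" if s: "s \<in> {0..T}" for k s
    proof -
      have "\<bar>\<Sum>j<n. a i j s * x k j s\<bar> \<le> (\<Sum>j<n. \<bar>a i j s\<bar> * \<bar>x k j s\<bar>)"
        using sum_abs[of "\<lambda>j. a i j s * x k j s" "{..<n}"] by (simp add: abs_mult)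
      also have "\<dots> \<le> (\<Sum>j<n. \<bar>a i j s\<bar> * (\<bar>\<xi> j\<bar> + suminf M))"
        using xb s by (intro sum_mono mult_left_mono) auto
      finally show ?thesis unfolding h_def by simp
    qed
    have 3: "(\<lambda>k. ?F (x k) i s) \<longlonglongrightarrow> ?F X i s" if "s \<in> {0..T}" for s
      using lim that by (intro tendsto_add tendsto_sum tendsto_mult tendsto_const) auto
    have int: "(\<lambda>s. ?F X i s) integrable_on {0..T}"
      by (rule dc(1)[OF 1 pw_continuous_integrable[OF hpw] 2 3])
    have "(\<lambda>k. integral {0..T} (\<lambda>s. ?F (x k) i s)) \<longlonglongrightarrow> integral {0..T} (\<lambda>s. ?F X i s)"
      by (rule dc(2)[OF 1 pw_continuous_integrable[OF hpw] 2 3])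
    moreover have "(\<lambda>k. integral {0..T} (\<lambda>s. ?F (x k) i s)) = (\<lambda>k. x (Suc k) i T - \<xi> i)"
      by (simp add: xS)
    ultimately have L1: "(\<lambda>k. x (Suc k) i T - \<xi> i) \<longlonglongrightarrow> integral {0..T} (\<lambda>s. ?F X i s)"
      by simp
    have L2: "(\<lambda>k. x (Suc k) i T - \<xi> i) \<longlonglongrightarrow> X i T - \<xi> i"
      using LIMSEQ_Suc[OF lim[OF i, of T]] T by (intro tendsto_diff tendsto_const) auto
    have "integral {0..T} (\<lambda>s. ?F X i s) = X i T - \<xi> i"
      by (rule LIMSEQ_unique[OF L1 L2])
    then show ?thesis using integrable_integral[OF int] by simp
  qed
  then show ?thesis by blast
qed

section \<open>Systems over an abstract time axis\<close>

text \<open>At time L the value is already that of g, so the first piece governs the half-open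
  window \<open>{..<L}\<close>. The subtraction is applied only for t \<ge> L, where it is exact on
  the naturals as well.\<close>

definition cat :: "'t::linordered_semidom \<Rightarrow> ('t \<Rightarrow> 'a) \<Rightarrow> ('t \<Rightarrow> 'a) \<Rightarrow> 't \<Rightarrow> 'a" where
  "cat L f g t = (if t < L then f t else g (t - L))"

text \<open>Signals are extensional functions on the nonnegative times, and the restriction keeps
  combinations in that class; on the naturals it does nothing.\<close>

abbreviation lincomb :: "('t::linordered_semidom \<Rightarrow> real Matrix.vec) \<Rightarrow> real \<Rightarrow> ('t \<Rightarrow> real Matrix.vec) \<Rightarrow> 't \<Rightarrow> real Matrix.vec" where
  "lincomb f a g \<equiv> (\<lambda>t\<in>{0..}. f t + a \<cdot>\<^sub>v g t)"

abbreviation const :: "'a \<Rightarrow> 't::linordered_semidom \<Rightarrow> 'a" where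
  "const c \<equiv> (\<lambda>t\<in>{0..}. c)"

abbreviation zero_input :: "'p::finite lpv_ssa \<Rightarrow> 't::linordered_semidom \<Rightarrow> real Matrix.vec" where
  "zero_input S \<equiv> const (0\<^sub>v (udim S))"

text \<open>The state part \<open>ssol\<close> is separated from the output because in continuous
  time it is an integral equation, while outputs are compared up to null sets of M; the counting
  measure makes this comparison pointwise in discrete time. \<open>generator\<close> is the
  infinitesimal step stated without derivatives: a linear functional vanishing along a pair of
  trajectories vanishes on their right-hand sides at time 0, which are derivatives in one case and
  the states at time 1 in the other. \<open>initial_output\<close> recovers an identity at time 0
  from an almost everywhere one, and \<open>backward_unique\<close> is where \<open>reg\<close>
  enters.\<close>

locale lpv_time =
  fixes M :: "'t::linordered_semidom measure"
    and ssol :: "'p::finite lpv_ssa \<Rightarrow> (('t \<Rightarrow> real Matrix.vec) \<times> ('t \<Rightarrow> real Matrix.vec) \<times> ('t \<Rightarrow> real ^ 'p)) set"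
    and sigs :: "nat \<Rightarrow> ('t \<Rightarrow> real Matrix.vec) set"
    and scheds :: "(real ^ 'p) set \<Rightarrow> ('t \<Rightarrow> real ^ 'p) set"
    and sol :: "'p lpv_ssa \<Rightarrow> ('t, 'p) trajectory set"
    and reg :: "'p lpv_ssa \<Rightarrow> bool"
  assumes sol_iff: "\<And>S x y u p. is_lpv_ssa S \<Longrightarrow> (x, y, u, p) \<in> sol S \<longleftrightarrow> (x, u, p) \<in> ssol S \<and> y \<in> sigs (ydim S) \<and>
      (AE t in M. 0 \<le> t \<longrightarrow> y t = output_rhs S (p t) (x t) (u t))"
    and ssolD: "\<And>S x u p. is_lpv_ssa S \<Longrightarrow> (x, u, p) \<in> ssol S \<Longrightarrow>
      x \<in> {0..} \<rightarrow>\<^sub>E carrier_vec (xdim S) \<and> u \<in> sigs (udim S) \<and> p \<in> scheds (sched S)"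
    and sigs_sub: "\<And>m. sigs m \<subseteq> {0..} \<rightarrow>\<^sub>E carrier_vec m"
    and scheds_sub: "\<And>P. scheds P \<subseteq> {0..} \<rightarrow>\<^sub>E P"
    and const_sigs: "\<And>v m. v \<in> carrier_vec m \<Longrightarrow> const v \<in> sigs m"
    and const_scheds: "\<And>q P. q \<in> P \<Longrightarrow> const q \<in> scheds P"
    and cat_sigs: "\<And>L m w w'. 0 \<le> L \<Longrightarrow> w \<in> sigs m \<Longrightarrow> w' \<in> sigs m \<Longrightarrow> cat L w w' \<in> sigs m"
    and cat_scheds: "\<And>L P p p'. 0 \<le> L \<Longrightarrow> p \<in> scheds P \<Longrightarrow> p' \<in> scheds P \<Longrightarrow> cat L p p' \<in> scheds P"
    and output_sigs: "\<And>S x u p. is_lpv_ssa S \<Longrightarrow> (x, u, p) \<in> ssol S \<Longrightarrow> (\<lambda>t\<in>{0..}. output_rhs S (p t) (x t) (u t)) \<in> sigs (ydim S)"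
    and ssol_exists: "\<And>S x0 u p. is_lpv_ssa S \<Longrightarrow> x0 \<in> carrier_vec (xdim S) \<Longrightarrow> u \<in> sigs (udim S) \<Longrightarrow> p \<in> scheds (sched S) \<Longrightarrow>
      \<exists>x. (x, u, p) \<in> ssol S \<and> x 0 = x0"
    and ssol_unique: "\<And>S x x' u p. is_lpv_ssa S \<Longrightarrow> (x, u, p) \<in> ssol S \<Longrightarrow> (x', u, p) \<in> ssol S \<Longrightarrow> x 0 = x' 0 \<Longrightarrow> x = x'"
    and ssol_lincomb: "\<And>S x x' u u' p a. is_lpv_ssa S \<Longrightarrow> (x, u, p) \<in> ssol S \<Longrightarrow> (x', u', p) \<in> ssol S \<Longrightarrow>
      (lincomb x a x', lincomb u a u', p) \<in> ssol S"
    and ssol_cat: "\<And>S x x' u u' p p' L. is_lpv_ssa S \<Longrightarrow> (x, u, p) \<in> ssol S \<Longrightarrow> (x', u', p') \<in> ssol S \<Longrightarrow> 0 \<le> L \<Longrightarrow> x L = x' 0 \<Longrightarrow>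
      (cat L x x', cat L u u', cat L p p') \<in> ssol S"
    and ssol_image: "\<And>S S' Q x u p. same_interface S S' \<Longrightarrow> Q \<in> carrier_mat (xdim S') (xdim S) \<Longrightarrow>
      (\<And>q v w. q \<in> sched S \<Longrightarrow> v \<in> carrier_vec (xdim S) \<Longrightarrow> w \<in> carrier_vec (udim S) \<Longrightarrow>
        state_rhs S' q (Q *\<^sub>v v) w = Q *\<^sub>v state_rhs S q v w) \<Longrightarrow>
      (x, u, p) \<in> ssol S \<Longrightarrow> (\<lambda>t\<in>{0..}. Q *\<^sub>v x t, u, p) \<in> ssol S'"
    and generator: "\<And>S S' x x' v q c c'. same_interface S S' \<Longrightarrow> (x, const v, const q) \<in> ssol S \<Longrightarrow> (x', const v, const q) \<in> ssol S' \<Longrightarrow>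
      c \<in> carrier_vec (xdim S) \<Longrightarrow> c' \<in> carrier_vec (xdim S') \<Longrightarrow> (\<And>t. 0 \<le> t \<Longrightarrow> c \<bullet> x t + c' \<bullet> x' t = 0) \<Longrightarrow>
      c \<bullet> state_rhs S q (x 0) v + c' \<bullet> state_rhs S' q (x' 0) v = 0"
    and initial_output: "\<And>S S' x x' v q. same_interface S S' \<Longrightarrow> (x, const v, const q) \<in> ssol S \<Longrightarrow> (x', const v, const q) \<in> ssol S' \<Longrightarrow>
      AE t in M. 0 \<le> t \<longrightarrow> output_rhs S q (x t) v = output_rhs S' q (x' t) v \<Longrightarrow>
      output_rhs S q (x 0) v = output_rhs S' q (x' 0) v"
    and backward_unique: "\<And>S x p L. is_lpv_ssa S \<Longrightarrow> reg S \<Longrightarrow> (x, zero_input S, p) \<in> ssol S \<Longrightarrow> 0 \<le> L \<Longrightarrow>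
      x L = 0\<^sub>v (xdim S) \<Longrightarrow> x 0 = 0\<^sub>v (xdim S)"
    and AE_shift: "\<And>L R. 0 \<le> L \<Longrightarrow> (AE t in M. L \<le> t \<longrightarrow> R (t - L)) \<longleftrightarrow> (AE t in M. 0 \<le> t \<longrightarrow> R t)"
    and AE_bounded: "\<And>R. (\<And>L. 0 \<le> L \<Longrightarrow> AE t in M. 0 \<le> t \<and> t < L \<longrightarrow> R t) \<Longrightarrow> AE t in M. 0 \<le> t \<longrightarrow> R t"
begin

section \<open>Trajectories, their concatenation and superposition\<close>

definition adm :: "'p lpv_ssa \<Rightarrow> ('t \<Rightarrow> real Matrix.vec) \<Rightarrow> ('t \<Rightarrow> real ^ 'p) \<Rightarrow> bool" where
  "adm S u p \<longleftrightarrow> u \<in> sigs (udim S) \<and> p \<in> scheds (sched S)"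

definition traj :: "'p lpv_ssa \<Rightarrow> real Matrix.vec \<Rightarrow> ('t \<Rightarrow> real Matrix.vec) \<Rightarrow> ('t \<Rightarrow> real ^ 'p) \<Rightarrow> 't \<Rightarrow> real Matrix.vec" where
  "traj S x0 u p = (SOME x. (x, u, p) \<in> ssol S \<and> x 0 = x0)"

abbreviation states :: "'p lpv_ssa \<Rightarrow> real Matrix.vec set" where
  "states S \<equiv> carrier_vec (xdim S)"

lemma traj:
  assumes "is_lpv_ssa S" "adm S u p" "x0 \<in> states S"
  shows "(traj S x0 u p, u, p) \<in> ssol S" "traj S x0 u p 0 = x0"
  using someI_ex[OF ssol_exists[of S x0 u p]] assms unfolding traj_def adm_def by blast+

lemma traj_eqI:
  assumes "is_lpv_ssa S" "(x, u, p) \<in> ssol S" "x 0 = x0"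
  shows "traj S x0 u p = x"
proof -
  have "adm S u p" and x: "x \<in> {0..} \<rightarrow>\<^sub>E states S" using ssolD[OF assms(1,2)] by (auto simp: adm_def)
  moreover have "x0 \<in> states S" using x assms(3) by (auto dest!: PiE_mem[of _ _ _ 0])
  ultimately show ?thesis using traj[OF assms(1)] assms by (intro ssol_unique[OF assms(1)]) auto
qed

lemma traj_carrier:
  assumes "is_lpv_ssa S" "adm S u p" "x0 \<in> states S" "0 \<le> t"
  shows "traj S x0 u p t \<in> states S"
  using ssolD[OF assms(1) traj(1)[OF assms(1-3)]] assms(4) by auto

lemma adm_mem:
  assumes "adm S u p" "0 \<le> t"
  shows "u t \<in> carrier_vec (udim S)" "p t \<in> sched S"
  using assms sigs_sub[of "udim S"] scheds_sub[of "sched S"] by (auto simp: adm_def)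

lemma adm_cat:
  assumes "adm S u p" "adm S u' p'" "0 \<le> L" shows "adm S (cat L u u') (cat L p p')"
  using assms cat_sigs cat_scheds by (simp add: adm_def)

lemma adm_const:
  assumes "v \<in> carrier_vec (udim S)" "q \<in> sched S" shows "adm S (const v) (const q)"
  using assms const_sigs const_scheds by (simp add: adm_def)

lemma adm_zero:
  assumes "adm S u p" shows "adm S (zero_input S) p"
  using assms const_sigs[of "0\<^sub>v (udim S)" "udim S"] by (simp add: adm_def)

lemma cat_const:
  assumes "0 \<le> L" shows "cat L (const c) (const c) = const c"
proof
  fix t show "cat L (const c) (const c) t = const c t"
    using assms by (cases "0 \<le> t") (auto simp: cat_def dest: le_add_diff_inverse2, (metis le_add_diff_inverse le_add_same_cancel1 not_le)+)
qed

lemma traj_cat: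
  assumes S: "is_lpv_ssa S" and a: "adm S u p" "adm S u' p'" and L: "0 \<le> L" and x0: "x0 \<in> states S"
  shows "traj S x0 (cat L u u') (cat L p p') = cat L (traj S x0 u p) (traj S (traj S x0 u p L) u' p')"
proof (rule traj_eqI[OF S])
  note t1 = traj[OF S a(1) x0] and t2 = traj[OF S a(2) traj_carrier[OF S a(1) x0 L]]
  show "(cat L (traj S x0 u p) (traj S (traj S x0 u p L) u' p'), cat L u u', cat L p p') \<in> ssol S"
    by (rule ssol_cat[OF S t1(1) t2(1) L]) (use t2 in simp)
  show "cat L (traj S x0 u p) (traj S (traj S x0 u p L) u' p') 0 = x0"
    using L t1(2) t2(2) by (cases "L = 0") (auto simp: cat_def)
qed

lemma traj_lincomb:
  assumes S: "is_lpv_ssa S" and a: "adm S u p" "adm S u' p" and x: "x \<in> states S" "x' \<in> states S"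
  shows "traj S (x + a \<cdot>\<^sub>v x') (lincomb u a u') p = lincomb (traj S x u p) a (traj S x' u' p)" "adm S (lincomb u a u') p"
proof -
  note t1 = traj[OF S a(1) x(1)] and t2 = traj[OF S a(2) x(2)]
  have l: "(lincomb (traj S x u p) a (traj S x' u' p), lincomb u a u', p) \<in> ssol S"
    by (rule ssol_lincomb[OF S t1(1) t2(1)])
  show "traj S (x + a \<cdot>\<^sub>v x') (lincomb u a u') p = lincomb (traj S x u p) a (traj S x' u' p)"
    by (rule traj_eqI[OF S l]) (use t1 t2 in simp)
  show "adm S (lincomb u a u') p" using ssolD[OF S l] by (simp add: adm_def)
qed

lemma lincomb_zero:
  assumes "u \<in> sigs m" shows "lincomb u a (const (0\<^sub>v m)) = u"
proof
  fix t
  have u: "u \<in> {0..} \<rightarrow>\<^sub>E carrier_vec m" using assms sigs_sub by blast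
  show "lincomb u a (const (0\<^sub>v m)) t = u t"
  proof (cases "0 \<le> t")
    case True
    then have "u t \<in> carrier_vec m" using u by auto
    then show ?thesis using True by auto
  next
    case False
    then show ?thesis using u by (auto simp: PiE_def extensional_def)
  qed
qed

text \<open>Subtracting the trajectory from itself leaves initial state and input unchanged, so by
  uniqueness it equals that difference, which is zero.\<close>

lemma traj_zero:
  assumes S: "is_lpv_ssa S" and a: "adm S (zero_input S) p" and t: "0 \<le> t"
  shows "traj S (0\<^sub>v (xdim S)) (zero_input S) p t = 0\<^sub>v (xdim S)"
proof -
  let ?z = "0\<^sub>v (xdim S) :: real Matrix.vec" and ?u = "zero_input S :: 't \<Rightarrow> real Matrix.vec"
  have c: "traj S ?z ?u p t \<in> states S" by (rule traj_carrier[OF S a _ t]) simp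
  have "?z + (-1) \<cdot>\<^sub>v ?z = ?z" by auto
  moreover have "lincomb ?u (-1) ?u = ?u" by (rule lincomb_zero) (rule a[unfolded adm_def, THEN conjunct1])
  ultimately have "traj S ?z ?u p = lincomb (traj S ?z ?u p) (-1) (traj S ?z ?u p)"
    using traj_lincomb(1)[OF S a a, of ?z ?z "-1"] by simp
  then have "traj S ?z ?u p t = traj S ?z ?u p t + (-1) \<cdot>\<^sub>v traj S ?z ?u p t"
    using t by (metis (mono_tags, lifting) atLeast_iff restrict_apply')
  also have "\<dots> = ?z" using c by auto
  finally show ?thesis .
qed

section \<open>Almost everywhere agreement of outputs\<close>

abbreviation outp :: "'p lpv_ssa \<Rightarrow> real Matrix.vec \<Rightarrow> ('t \<Rightarrow> real Matrix.vec) \<Rightarrow> ('t \<Rightarrow> real ^ 'p) \<Rightarrow> 't \<Rightarrow> real Matrix.vec" where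
  "outp S x u p t \<equiv> output_rhs S (p t) (traj S x u p t) (u t)"

text \<open>The window I is all of time for indistinguishability and \<open>{..<L}\<close> for what
  a finite experiment sees. Both systems are driven by the same signals, but the two states may live
  in different dimensions.\<close>

definition agree :: "'t set \<Rightarrow> 'p lpv_ssa \<Rightarrow> 'p lpv_ssa \<Rightarrow> real Matrix.vec \<Rightarrow> real Matrix.vec \<Rightarrow>
    ('t \<Rightarrow> real Matrix.vec) \<Rightarrow> ('t \<Rightarrow> real ^ 'p) \<Rightarrow> bool" where
  "agree I S S' x x' u p \<longleftrightarrow> (AE t in M. 0 \<le> t \<and> t \<in> I \<longrightarrow>
     outp S x u p t = outp S' x' u p t)"

lemma agree_refl: "agree I S S x x u p"
  by (simp add: agree_def)

lemma agree_sym: "agree I S S' x x' u p \<Longrightarrow> agree I S' S x' x u p"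
  by (simp add: agree_def eq_commute)

lemma agree_trans:
  assumes "agree I S S' x x' u p" "agree I S' S'' x' x'' u p" shows "agree I S S'' x x'' u p"
  using assms unfolding agree_def by eventually_elim auto

lemma agree_subset:
  assumes "agree I S S' x x' u p" "J \<subseteq> I" shows "agree J S S' x x' u p"
  using assms(1) unfolding agree_def by eventually_elim (use assms(2) in auto)

lemma same_interfaceD:
  assumes "same_interface S S'"
  shows "is_lpv_ssa S" "is_lpv_ssa S'" "sched S' = sched S" "udim S' = udim S" "ydim S' = ydim S" "adm S' = adm S"
  using assms by (auto simp: same_interface_def adm_def fun_eq_iff)

lemma agree_lincomb:
  assumes si: "same_interface S S'" and a: "adm S u p" "adm S v p"
    and x: "x \<in> states S" "y \<in> states S" "x' \<in> states S'" "y' \<in> states S'"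
    and ag: "agree I S S' x x' u p" "agree I S S' y y' v p"
  shows "agree I S S' (x + a \<cdot>\<^sub>v y) (x' + a \<cdot>\<^sub>v y') (lincomb u a v) p"
proof -
  note d = same_interfaceD[OF si]
  have a': "adm S' u p" "adm S' v p" using a d by auto
  note tl = traj_lincomb(1)[OF d(1) a x(1,2), of a] traj_lincomb(1)[OF d(2) a' x(3,4), of a]
  show ?thesis
    using ag unfolding agree_def
  proof eventually_elim
    case (elim t)
    show ?case
    proof (intro impI, elim conjE)
      assume t: "0 \<le> t" "t \<in> I"
      have "output_rhs S (p t) (traj S x u p t + a \<cdot>\<^sub>v traj S y v p t) (u t + a \<cdot>\<^sub>v v t) =
          outp S x u p t + a \<cdot>\<^sub>v outp S y v p t"
        using traj_carrier[OF d(1)] a x t(1) adm_mem by (intro output_rhs_lincomb[OF d(1)]) auto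
      moreover have "output_rhs S' (p t) (traj S' x' u p t + a \<cdot>\<^sub>v traj S' y' v p t) (u t + a \<cdot>\<^sub>v v t) =
          outp S' x' u p t + a \<cdot>\<^sub>v outp S' y' v p t"
        using traj_carrier[OF d(2)] a' x t(1) adm_mem by (intro output_rhs_lincomb[OF d(2)]) auto
      ultimately show "output_rhs S (p t) (traj S (x + a \<cdot>\<^sub>v y) (lincomb u a v) p t) (lincomb u a v t) =
          output_rhs S' (p t) (traj S' (x' + a \<cdot>\<^sub>v y') (lincomb u a v) p t) (lincomb u a v t)"
        unfolding tl using elim t by simp
    qed
  qed
qed

text \<open>Adding zero-input responses leaves the input u unchanged. In this way questions about
  separating states are reduced to zero input.\<close>

lemma agree_lincomb_zero_input:
  assumes si: "same_interface S S'" and a: "adm S u p"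
    and x: "x \<in> states S" "y \<in> states S" "x' \<in> states S'" "y' \<in> states S'"
    and ag: "agree I S S' x x' u p" "agree I S S' y y' (zero_input S) p"
  shows "agree I S S' (x + a \<cdot>\<^sub>v y) (x' + a \<cdot>\<^sub>v y') u p"
  using agree_lincomb[OF si a adm_zero[OF a] x ag, of a] lincomb_zero[of u "udim S" a] a by (simp add: adm_def)

lemma agree_zero:
  assumes si: "same_interface S S'" and a: "adm S u p"
  shows "agree I S S' (0\<^sub>v (xdim S)) (0\<^sub>v (xdim S')) (zero_input S) p"
proof -
  note d = same_interfaceD[OF si]
  have "output_rhs T q (0\<^sub>v (xdim T)) (0\<^sub>v (udim T)) = 0\<^sub>v (ydim T)" if "is_lpv_ssa T" for T :: "'p lpv_ssa" and q
    using rhs_zero_input(2)[OF that, of "0\<^sub>v (xdim T)" q] lpv_carriers(3)[OF that, of q] by simp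
  from this[OF d(1)] this[OF d(2)] have o: "output_rhs S q (0\<^sub>v (xdim S)) (0\<^sub>v (udim S)) =
      output_rhs S' q (0\<^sub>v (xdim S')) (0\<^sub>v (udim S))" for q using d by metis
  have "adm S' (zero_input S') p" using adm_zero a d by metis
  then have z: "traj S' (0\<^sub>v (xdim S')) (zero_input S) p t = 0\<^sub>v (xdim S')" if "0 \<le> t" for t
    using traj_zero[OF d(2) _ that] d(4) by metis
  show ?thesis unfolding agree_def
    by (intro AE_I2) (use o z traj_zero[OF d(1) adm_zero[OF a]] in auto)
qed

text \<open>By uniqueness the motion after time L is a fresh motion from the state reached at L.
  Writing the second window with t + L avoids truncated subtraction on the naturals.\<close>

lemma agree_cat:
  assumes si: "same_interface S S'" and a: "adm S u p" "adm S v r" and L: "0 \<le> L"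
    and x: "x \<in> states S" "x' \<in> states S'"
  shows "agree I S S' x x' (cat L u v) (cat L p r) \<longleftrightarrow>
    agree ({..<L} \<inter> I) S S' x x' u p \<and> agree {t. t + L \<in> I} S S' (traj S x u p L) (traj S' x' u p L) v r"
proof -
  note d = same_interfaceD[OF si]
  have a': "adm S' u p" "adm S' v r" using a d by auto
  define R where "R t \<longleftrightarrow> output_rhs S (r t) (traj S (traj S x u p L) v r t) (v t) =
     output_rhs S' (r t) (traj S' (traj S' x' u p L) v r t) (v t)" for t
  \<comment> \<open>\<open>t - L + L\<close> is t here, and brings the second part into the form
    required by \<open>AE_shift\<close>.\<close>
  have "agree I S S' x x' (cat L u v) (cat L p r) \<longleftrightarrow> (AE t in M. (0 \<le> t \<and> t \<in> {..<L} \<inter> I \<longrightarrow>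
      outp S x u p t = outp S' x' u p t) \<and>
      (L \<le> t \<longrightarrow> (t - L + L \<in> I \<longrightarrow> R (t - L))))"
    unfolding agree_def traj_cat[OF d(1) a L x(1)] traj_cat[OF d(2) a' L x(2)] R_def
    by (rule arg_cong2[where f = almost_everywhere], rule refl)
       (use L in \<open>auto simp: cat_def fun_eq_iff not_less not_le split: if_splits dest: order_trans\<close>)
  also have "\<dots> \<longleftrightarrow> agree ({..<L} \<inter> I) S S' x x' u p \<and> (AE t in M. L \<le> t \<longrightarrow> (t - L + L \<in> I \<longrightarrow> R (t - L)))"
    unfolding agree_def by (rule AE_conj_iff)
  also have "(AE t in M. L \<le> t \<longrightarrow> (t - L + L \<in> I \<longrightarrow> R (t - L))) \<longleftrightarrow> (AE t in M. 0 \<le> t \<longrightarrow> (t + L \<in> I \<longrightarrow> R t))"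
    by (rule AE_shift[OF L, of "\<lambda>t. t + L \<in> I \<longrightarrow> R t"])
  finally show ?thesis unfolding agree_def R_def by (simp add: imp_conjL)
qed

lemma agree_cat_UNIV:
  assumes "same_interface S S'" "adm S u p" "adm S v r" "0 \<le> L" "x \<in> states S" "x' \<in> states S'"
  shows "agree UNIV S S' x x' (cat L u v) (cat L p r) \<longleftrightarrow>
    agree {..<L} S S' x x' u p \<and> agree UNIV S S' (traj S x u p L) (traj S' x' u p L) v r"
  using agree_cat[OF assms, of UNIV] by simp

section \<open>Observability and behaviors in terms of agreement\<close>

text \<open>A value of the output map is the set of all representatives, among them the pointwise
  output of the trajectory; so two values coincide exactly if the pointwise outputs agree almost
  everywhere.\<close>

lemma observable_iff:
  assumes S: "is_lpv_ssa S"
  shows "observable sol S \<longleftrightarrow> (\<forall>x\<in>states S. \<forall>x'\<in>states S.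
    (\<forall>u p. adm S u p \<longrightarrow> agree UNIV S S x x' u p) \<longrightarrow> x = x')"
proof -
  have om: "output_map sol S x (u, p) = (if adm S u p then
      {y \<in> sigs (ydim S). AE t in M. 0 \<le> t \<longrightarrow> y t = outp S x u p t} else {})"
    if x: "x \<in> states S" for x u p
  proof (cases "adm S u p")
    case True
    have "(\<exists>z. (z, y, u, p) \<in> sol S \<and> z 0 = x) \<longleftrightarrow> (traj S x u p, y, u, p) \<in> sol S" for y
    proof
      assume "\<exists>z. (z, y, u, p) \<in> sol S \<and> z 0 = x"
      then obtain z where z: "(z, y, u, p) \<in> sol S" "z 0 = x" by (elim exE conjE)
      then have "(z, u, p) \<in> ssol S" using sol_iff[OF S] by simp
      then have "traj S x u p = z" using z(2) by (rule traj_eqI[OF S])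
      then show "(traj S x u p, y, u, p) \<in> sol S" using z(1) by simp
    next
      assume "(traj S x u p, y, u, p) \<in> sol S"
      then show "\<exists>z. (z, y, u, p) \<in> sol S \<and> z 0 = x" using traj(2)[OF S True x] by (intro exI conjI)
    qed
    then show ?thesis using True traj(1)[OF S True x] by (simp add: output_map_def sol_iff[OF S])
  next
    case False
    then show ?thesis using ssolD[OF S] by (auto simp: output_map_def sol_iff[OF S] adm_def)
  qed
  have h: "output_map sol S x = output_map sol S x' \<longleftrightarrow> (\<forall>u p. adm S u p \<longrightarrow> agree UNIV S S x x' u p)"
    if x: "x \<in> states S" "x' \<in> states S" for x x'
  proof
    assume eq: "output_map sol S x = output_map sol S x'"
    show "\<forall>u p. adm S u p \<longrightarrow> agree UNIV S S x x' u p"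
    proof (intro allI impI)
      fix u p assume a: "adm S u p"
      let ?y = "\<lambda>t\<in>{0..}. outp S x u p t"
      have "?y \<in> output_map sol S x (u, p)"
        using om[OF x(1), of u p] a output_sigs[OF S traj(1)[OF S a x(1)]] by simp
      then have "AE t in M. 0 \<le> t \<longrightarrow> ?y t = outp S x' u p t"
        unfolding eq using om[OF x(2), of u p] a by simp
      then show "agree UNIV S S x x' u p" unfolding agree_def by eventually_elim simp
    qed
  next
    assume ag: "\<forall>u p. adm S u p \<longrightarrow> agree UNIV S S x x' u p"
    show "output_map sol S x = output_map sol S x'"
    proof
      fix up :: "('t \<Rightarrow> real Matrix.vec) \<times> ('t \<Rightarrow> real ^ 'p)"
      obtain u p where up: "up = (u, p)" by (cases up)
      have "(AE t in M. 0 \<le> t \<longrightarrow> y t = outp S x u p t) \<longleftrightarrow>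
          (AE t in M. 0 \<le> t \<longrightarrow> y t = outp S x' u p t)" if "adm S u p" for y
      proof -
        have e: "AE t in M. 0 \<le> t \<longrightarrow> outp S x u p t = outp S x' u p t"
          using ag that by (simp add: agree_def)
        show ?thesis by (rule eventually_subst) (use e in \<open>eventually_elim, auto\<close>)
      qed
      then show "output_map sol S x up = output_map sol S x' up"
        unfolding up using om[OF x(1), of u p] om[OF x(2), of u p] by simp
    qed
  qed
  show ?thesis unfolding observable_def
  proof (intro ball_cong refl)
    fix x x' :: "real Matrix.vec" assume x: "x \<in> states S" "x' \<in> states S"
    show "(x \<noteq> x' \<longrightarrow> output_map sol S x \<noteq> output_map sol S x') \<longleftrightarrow>
      ((\<forall>u p. adm S u p \<longrightarrow> agree UNIV S S x x' u p) \<longrightarrow> x = x')"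
      unfolding h[OF x] by argo
  qed
qed

text \<open>The state x' found here depends on u and p; removing this dependence is the task of the
  separating scheduling signal below.\<close>

lemma same_behavior_agree:
  assumes si: "same_interface S S'" and B: "manifest_behavior sol S = manifest_behavior sol S'"
    and a: "adm S u p" and x: "x \<in> states S"
  shows "\<exists>x'\<in>states S'. agree UNIV S S' x x' u p"
proof -
  note d = same_interfaceD[OF si]
  let ?y = "\<lambda>t\<in>{0..}. outp S x u p t"
  have "(?y, u, p) \<in> manifest_behavior sol S"
    using traj(1)[OF d(1) a x] output_sigs[OF d(1) traj(1)[OF d(1) a x]]
    by (auto simp: manifest_behavior_def sol_iff[OF d(1)] intro!: exI[of _ "traj S x u p"])
  then obtain z where z: "(z, ?y, u, p) \<in> sol S'" unfolding B by (auto simp: manifest_behavior_def)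
  then have zs: "(z, u, p) \<in> ssol S'" and ae: "AE t in M. 0 \<le> t \<longrightarrow> ?y t = output_rhs S' (p t) (z t) (u t)"
    using sol_iff[OF d(2)] by auto
  have "z 0 \<in> states S'" using ssolD[OF d(2) zs] by auto
  moreover have "agree UNIV S S' x (z 0) u p"
    using ae unfolding agree_def traj_eqI[OF d(2) zs refl] by eventually_elim simp
  ultimately show ?thesis by blast
qed

text \<open>The interface can be read off from the behavior: each scheduling value occurs in it as a
  constant signal with zero input, and the vectors at time 0 reveal the dimensions. An empty
  scheduling set would give an empty behavior.\<close>

lemma same_behavior_interface:
  assumes S: "is_lpv_ssa S" and S': "is_lpv_ssa S'" and ne: "sched S \<noteq> {}"
    and B: "manifest_behavior sol S = manifest_behavior sol S'"
  shows "same_interface S S'"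
proof -
  have ex: "\<exists>y\<in>sigs (ydim T). (y, zero_input T, const q) \<in> manifest_behavior sol T"
    if T: "is_lpv_ssa T" and q: "q \<in> sched T" for T q
  proof -
    have a: "adm T (zero_input T) (const q)" using q by (intro adm_const) auto
    note t = traj(1)[OF T a zero_carrier_vec]
    show ?thesis using t output_sigs[OF T t]
      by (intro bexI[OF _ output_sigs[OF T t]]) (auto simp: manifest_behavior_def sol_iff[OF T] intro!: exI[of _ "traj T (0\<^sub>v (xdim T)) (zero_input T) (const q)"])
  qed
  have mem: "y \<in> sigs (ydim T)" "u 0 \<in> carrier_vec (udim T)" "p 0 \<in> sched T"
    if T: "is_lpv_ssa T" and B: "(y, u, p) \<in> manifest_behavior sol T" for T y u p
  proof -
    obtain x where "(x, y, u, p) \<in> sol T" using B by (auto simp: manifest_behavior_def)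
    then have y: "y \<in> sigs (ydim T)" and xs: "(x, u, p) \<in> ssol T" using sol_iff[OF T] by auto
    have "adm T u p" using ssolD[OF T xs] by (simp add: adm_def)
    then show "y \<in> sigs (ydim T)" "u 0 \<in> carrier_vec (udim T)" "p 0 \<in> sched T" using y adm_mem by auto
  qed
  have 1: "q \<in> sched S' \<and> udim S' = udim S \<and> ydim S' = ydim S" if q: "q \<in> sched S" for q
  proof -
    obtain y where y: "y \<in> sigs (ydim S)" "(y, zero_input S, const q) \<in> manifest_behavior sol S" using ex[OF S q] by blast
    note m = mem[OF S' y(2)[unfolded B]]
    have "y 0 \<in> carrier_vec (ydim S)" "y 0 \<in> carrier_vec (ydim S')" using y(1) m(1) sigs_sub by (auto dest: PiE_mem)
    from carrier_vecD[OF this(1)] carrier_vecD[OF this(2)] have "ydim S' = ydim S" by linarith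
    moreover have "udim S' = udim S" using carrier_vecD[OF m(2)] by simp
    ultimately show ?thesis using m(3) by simp
  qed
  moreover have "q \<in> sched S" if q: "q \<in> sched S'" for q
  proof -
    obtain y where y: "(y, zero_input S', const q) \<in> manifest_behavior sol S'" using ex[OF S' q] by blast
    show ?thesis using mem(3)[OF S y[folded B]] by simp
  qed
  moreover obtain q0 where "q0 \<in> sched S" using ne by blast
  ultimately have "sched S' = sched S" "udim S' = udim S" "ydim S' = ydim S" by auto
  then show ?thesis using S S' by (simp add: same_interface_def)
qed


section \<open>The unobservable subspace and the quotient system\<close>

text \<open>Zero input is enough, since by superposition an input contributes the same response from
  either state.\<close>

definition unobservable :: "'p lpv_ssa \<Rightarrow> real Matrix.vec set" where
  "unobservable S = {x \<in> states S. \<forall>p\<in>scheds (sched S).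
     agree UNIV S S x (0\<^sub>v (xdim S)) (zero_input S) p}"

lemma adm_zero_iff: "adm S (zero_input S) p \<longleftrightarrow> p \<in> scheds (sched S)"
  using const_sigs[of "0\<^sub>v (udim S)" "udim S"] by (simp add: adm_def)

lemma zero_vec_lincomb: "0\<^sub>v n + a \<cdot>\<^sub>v 0\<^sub>v n = (0\<^sub>v n :: real Matrix.vec)"
  by auto

lemma vec_add_neg_self: "x \<in> carrier_vec n \<Longrightarrow> x + (-1) \<cdot>\<^sub>v x = (0\<^sub>v n :: real Matrix.vec)"
  by auto

lemma same_interface_refl: "is_lpv_ssa S \<Longrightarrow> same_interface S S"
  by (simp add: same_interface_def)

lemma unobservable_subspace:
  assumes S: "is_lpv_ssa S" shows "vec_subspace (xdim S) (unobservable S)"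
proof -
  note si = same_interface_refl[OF S]
  have "x + a \<cdot>\<^sub>v y \<in> unobservable S" if x: "x \<in> unobservable S" and y: "y \<in> unobservable S" for x y a
  proof -
    have c: "x \<in> states S" "y \<in> states S" using x y by (auto simp: unobservable_def)
    have "agree UNIV S S (x + a \<cdot>\<^sub>v y) (0\<^sub>v (xdim S)) (zero_input S) p" if p: "p \<in> scheds (sched S)" for p
      using agree_lincomb_zero_input[OF si, of "zero_input S" p x y "0\<^sub>v (xdim S)" "0\<^sub>v (xdim S)" UNIV a] c x y p
      unfolding zero_vec_lincomb adm_zero_iff by (auto simp: unobservable_def)
    then show ?thesis using c by (simp add: unobservable_def)
  qed
  then show ?thesis by (auto simp: vec_subspace_def unobservable_def agree_refl)
qed

lemma unobservable_nontrivial: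
  assumes S: "is_lpv_ssa S" and n: "\<not> observable sol S"
  obtains v where "v \<in> unobservable S" "v \<noteq> 0\<^sub>v (xdim S)"
proof -
  note si = same_interface_refl[OF S]
  obtain x y where x: "x \<in> states S" "y \<in> states S" "x \<noteq> y"
    and ag: "\<And>u p. adm S u p \<Longrightarrow> agree UNIV S S x y u p"
    using n unfolding observable_iff[OF S] by blast
  define v where "v = x + (-1) \<cdot>\<^sub>v y"
  have yy: "y + (-1) \<cdot>\<^sub>v y = 0\<^sub>v (xdim S)" using x(2) by auto
  have "agree UNIV S S v (0\<^sub>v (xdim S)) (zero_input S) p" if p: "p \<in> scheds (sched S)" for p
  proof -
    have a: "adm S (zero_input S) p" using p by (simp only: adm_zero_iff)
    show ?thesis
      using agree_lincomb_zero_input[OF si a x(1,2) x(2,2) ag[OF a] agree_refl, of "-1"] unfolding yy v_def .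
  qed
  then have "v \<in> unobservable S" using x by (simp add: unobservable_def v_def)
  moreover have "v \<noteq> 0\<^sub>v (xdim S)"
  proof
    assume "v = 0\<^sub>v (xdim S)"
    then have "v $ i = 0" if "i < xdim S" for i using that by simp
    then have "x = y" using x by (intro eq_vecI) (auto simp: v_def)
    then show False using x by simp
  qed
  ultimately show ?thesis by (rule that)
qed

text \<open>Running the constant schedule q for time s and then any other schedule shows that the
  trajectory never leaves the subspace. The functionals that cut out the subspace vanish along it,
  and \<open>generator\<close> passes this on to A(q) x.\<close>

lemma unobservable_invariant:
  assumes S: "is_lpv_ssa S" and x: "x \<in> unobservable S" and q: "q \<in> sched S"
  shows "affine_mat (Am S) q *\<^sub>v x \<in> unobservable S" "affine_mat (Cm S) q *\<^sub>v x = 0\<^sub>v (ydim S)"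
proof -
  note si = same_interface_refl[OF S]
  let ?n = "xdim S" and ?z = "0\<^sub>v (xdim S) :: real Matrix.vec" and ?o = "0\<^sub>v (udim S) :: real Matrix.vec"
  let ?u = "const ?o :: 't \<Rightarrow> real Matrix.vec" and ?q = "const q :: 't \<Rightarrow> real ^ 'p"
  have xn: "x \<in> carrier_vec ?n" using x by (simp add: unobservable_def)
  have a: "adm S ?u ?q" using q by (intro adm_const) auto
  note t = traj[OF S a xn] and t0 = traj[OF S a zero_carrier_vec]
  have inv: "traj S x ?u ?q s \<in> unobservable S" if s: "0 \<le> s" for s
  proof -
    have "agree UNIV S S (traj S x ?u ?q s) ?z ?u p" if p: "p \<in> scheds (sched S)" for p
    proof -
      have ap: "adm S ?u p" using p by (simp only: adm_zero_iff)
      have "agree UNIV S S x ?z ?u (cat s ?q p)"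
        using x adm_cat[OF a ap s] unfolding cat_const[OF s] adm_zero_iff by (simp add: unobservable_def)
      then have "agree UNIV S S x ?z (cat s ?u ?u) (cat s ?q p)" unfolding cat_const[OF s] .
      then show ?thesis
        unfolding agree_cat_UNIV[OF si a ap s xn zero_carrier_vec] traj_zero[OF S a s] by simp
    qed
    then show ?thesis using traj_carrier[OF S a xn s] by (simp add: unobservable_def)
  qed
  obtain r Q R where Q: "Q \<in> carrier_mat r ?n"
    and ker: "\<And>x. x \<in> carrier_vec ?n \<Longrightarrow> Q *\<^sub>v x = 0\<^sub>v r \<longleftrightarrow> x \<in> unobservable S"
    by (rule subspace_as_kernel[OF unobservable_subspace[OF S]]) blast
  have Ax: "state_rhs S q x ?o = affine_mat (Am S) q *\<^sub>v x" by (rule rhs_zero_input(1)[OF S xn])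
  have Axn: "affine_mat (Am S) q *\<^sub>v x \<in> carrier_vec ?n" using state_rhs_carrier[OF S, of q x ?o] unfolding Ax .
  have "Q *\<^sub>v (affine_mat (Am S) q *\<^sub>v x) = 0\<^sub>v r"
  proof (rule eq_vecI)
    fix i assume "i < dim_vec (0\<^sub>v r :: real Matrix.vec)"
    then have i: "i < r" by simp
    have c: "Matrix.row Q i \<in> carrier_vec ?n" using Q by (metis carrier_matD(2) row_carrier)
    have row: "Matrix.row Q i \<bullet> y = (Q *\<^sub>v y) $ i" if "y \<in> carrier_vec ?n" for y using Q i by simp
    \<comment> \<open>\<open>generator\<close> expects a pair of trajectories; the second one is the
      same trajectory with the zero functional.\<close>
    have "Matrix.row Q i \<bullet> traj S x ?u ?q s + ?z \<bullet> traj S x ?u ?q s = 0" if s: "0 \<le> s" for s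
    proof -
      have "Q *\<^sub>v traj S x ?u ?q s = 0\<^sub>v r" using inv[OF s] ker[OF traj_carrier[OF S a xn s]] by blast
      then show ?thesis using row[OF traj_carrier[OF S a xn s]] i traj_carrier[OF S a xn s] by simp
    qed
    then have "Matrix.row Q i \<bullet> state_rhs S q (traj S x ?u ?q 0) ?o + ?z \<bullet> state_rhs S q (traj S x ?u ?q 0) ?o = 0"
      by (rule generator[OF si t(1) t(1) c zero_carrier_vec])
    then show "(Q *\<^sub>v (affine_mat (Am S) q *\<^sub>v x)) $ i = 0\<^sub>v r $ i"
      unfolding t(2) Ax using row[OF Axn] i Axn by simp
  qed (use Q in auto)
  then show "affine_mat (Am S) q *\<^sub>v x \<in> unobservable S" using ker[OF Axn] by blast
  have "agree UNIV S S x ?z ?u ?q" using x const_scheds[OF q] by (simp add: unobservable_def)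
  then have "AE s in M. 0 \<le> s \<longrightarrow> output_rhs S q (traj S x ?u ?q s) ?o = output_rhs S q (traj S ?z ?u ?q s) ?o"
    unfolding agree_def by eventually_elim auto
  from initial_output[OF si t(1) t0(1) this]
  show "affine_mat (Cm S) q *\<^sub>v x = 0\<^sub>v (ydim S)"
    unfolding t(2) t0(2) rhs_zero_input(2)[OF S xn] rhs_zero_input(2)[OF S zero_carrier_vec]
    using lpv_carriers(3)[OF S, of q] by simp
qed

text \<open>The quotient of S by the kernel of Q in coordinates: R picks a representative, the
  system moves it, and Q projects back.\<close>

definition reduced :: "'p lpv_ssa \<Rightarrow> nat \<Rightarrow> real mat \<Rightarrow> real mat \<Rightarrow> 'p lpv_ssa" where
  "reduced S r Q R = S\<lparr>xdim := r, Am := \<lambda>i. Q * Am S i * R, Bm := \<lambda>i. Q * Bm S i, Cm := \<lambda>i. Cm S i * R\<rparr>"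

text \<open>Dividing by the unobservable subspace keeps the behavior: Q maps solutions of S to
  solutions of the quotient, and every solution of the quotient arises in this way.\<close>

lemma minimal_imp_observable:
  assumes S: "is_lpv_ssa S" and min: "minimal sol S"
  shows "observable sol S"
proof (rule ccontr)
  assume "\<not> observable sol S"
  then obtain v0 where v0: "v0 \<in> unobservable S" "v0 \<noteq> 0\<^sub>v (xdim S)" by (rule unobservable_nontrivial[OF S])
  let ?n = "xdim S"
  obtain r Q R where Q: "Q \<in> carrier_mat r ?n" and R: "R \<in> carrier_mat ?n r" and QR: "Q * R = 1\<^sub>m r"
    and ker: "\<And>x. x \<in> carrier_vec ?n \<Longrightarrow> Q *\<^sub>v x = 0\<^sub>v r \<longleftrightarrow> x \<in> unobservable S"
    by (rule subspace_as_kernel[OF unobservable_subspace[OF S]]) blast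
  have "v0 \<in> carrier_vec ?n" using v0 by (simp add: unobservable_def)
  then have rn: "r < ?n" using right_inverse_dim_less[OF Q R QR _ v0(2)] ker v0(1) by blast
  define S' where "S' = reduced S r Q R"
  have d: "sched S' = sched S" "udim S' = udim S" "ydim S' = ydim S" "xdim S' = r"
    and m: "Am S' = (\<lambda>i. Q * Am S i * R)" "Bm S' = (\<lambda>i. Q * Bm S i)" "Cm S' = (\<lambda>i. Cm S i * R)" "Dm S' = Dm S"
    by (simp_all add: S'_def reduced_def)
  note c = lpv_ssaD[OF S]
  have S': "is_lpv_ssa S'" unfolding is_lpv_ssa_def d m
    by (intro allI conjI mult_carrier_mat[OF mult_carrier_mat[OF Q c(1)] R] mult_carrier_mat[OF Q c(2)] mult_carrier_mat[OF c(3) R] c(4))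
  have si: "same_interface S S'" using S S' d by (simp add: same_interface_def)
  note l = lpv_carriers[OF S]
  have af: "affine_mat (Am S') q = Q * affine_mat (Am S) q * R" "affine_mat (Bm S') q = Q * affine_mat (Bm S) q"
      "affine_mat (Cm S') q = affine_mat (Cm S) q * R" for q
    unfolding m affine_mat_mult_right[OF mult_carrier_mat[OF Q c(1)] R] affine_mat_mult_left[OF c(1) Q]
      affine_mat_mult_left[OF c(2) Q] affine_mat_mult_right[OF c(3) R] by (rule refl)+
  \<comment> \<open>The difference between v and its representative lies in the kernel of Q, hence
    is unobservable.\<close>
  have RQ: "R *\<^sub>v (Q *\<^sub>v v) \<in> carrier_vec ?n" "v + (-1) \<cdot>\<^sub>v (R *\<^sub>v (Q *\<^sub>v v)) \<in> unobservable S" if v: "v \<in> carrier_vec ?n" for v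
  proof -
    have Qv: "Q *\<^sub>v v \<in> carrier_vec r" using Q v by simp
    show c: "R *\<^sub>v (Q *\<^sub>v v) \<in> carrier_vec ?n" using R Qv by simp
    have "Q *\<^sub>v (v + (-1) \<cdot>\<^sub>v (R *\<^sub>v (Q *\<^sub>v v))) = Q *\<^sub>v v + (-1) \<cdot>\<^sub>v ((Q * R) *\<^sub>v (Q *\<^sub>v v))"
      unfolding mult_mat_vec_lincomb[OF Q v c] assoc_mult_mat_vec[OF Q R Qv] ..
    also have "\<dots> = 0\<^sub>v r" unfolding QR using vec_add_neg_self[OF Qv] Qv by simp
    finally show "v + (-1) \<cdot>\<^sub>v (R *\<^sub>v (Q *\<^sub>v v)) \<in> unobservable S" using ker v c by simp
  qed
  have eq_of: "N *\<^sub>v v = N *\<^sub>v w" if N: "N \<in> carrier_mat k ?n" and v: "v \<in> carrier_vec ?n" "w \<in> carrier_vec ?n"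
    and z: "N *\<^sub>v (v + (-1) \<cdot>\<^sub>v w) = 0\<^sub>v k" for N :: "real mat" and k v w
  proof (rule eq_vecI)
    fix i assume "i < dim_vec (N *\<^sub>v w)"
    then have i: "i < k" using N by simp
    have "(N *\<^sub>v v + (-1) \<cdot>\<^sub>v (N *\<^sub>v w)) $ i = 0" using z i unfolding mult_mat_vec_lincomb[OF N v] by simp
    then show "(N *\<^sub>v v) $ i = (N *\<^sub>v w) $ i" using N i by simp
  qed (use N in simp)
  \<comment> \<open>A(q) sends that difference into the kernel of Q by invariance, so Q A(q) takes
    the same value on v and on its representative.\<close>
  have st: "state_rhs S' q (Q *\<^sub>v v) w = Q *\<^sub>v state_rhs S q v w"
    if q: "q \<in> sched S" and v: "v \<in> carrier_vec ?n" and w: "w \<in> carrier_vec (udim S)" for q v w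
  proof -
    have Qv: "Q *\<^sub>v v \<in> carrier_vec r" using Q v by simp
    have QA: "Q * affine_mat (Am S) q \<in> carrier_mat r ?n" using Q l by simp
    have cc: "v + (-1) \<cdot>\<^sub>v (R *\<^sub>v (Q *\<^sub>v v)) \<in> carrier_vec ?n" using RQ[OF v] v by simp
    have iv: "affine_mat (Am S) q *\<^sub>v (v + (-1) \<cdot>\<^sub>v (R *\<^sub>v (Q *\<^sub>v v))) \<in> unobservable S"
      by (rule unobservable_invariant(1)[OF S RQ(2)[OF v] q])
    then have "affine_mat (Am S) q *\<^sub>v (v + (-1) \<cdot>\<^sub>v (R *\<^sub>v (Q *\<^sub>v v))) \<in> carrier_vec ?n" by (simp add: unobservable_def)
    then have "Q *\<^sub>v (affine_mat (Am S) q *\<^sub>v (v + (-1) \<cdot>\<^sub>v (R *\<^sub>v (Q *\<^sub>v v)))) = 0\<^sub>v r"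
      using ker iv by blast
    then have "(Q * affine_mat (Am S) q) *\<^sub>v (v + (-1) \<cdot>\<^sub>v (R *\<^sub>v (Q *\<^sub>v v))) = 0\<^sub>v r"
      unfolding assoc_mult_mat_vec[OF Q l(1) cc] .
    from eq_of[OF QA v RQ(1)[OF v] this]
    have "(Q * affine_mat (Am S) q) *\<^sub>v v = (Q * affine_mat (Am S) q) *\<^sub>v (R *\<^sub>v (Q *\<^sub>v v))" .
    then have "affine_mat (Am S') q *\<^sub>v (Q *\<^sub>v v) = Q *\<^sub>v (affine_mat (Am S) q *\<^sub>v v)"
      unfolding af assoc_mult_mat_vec[OF QA R Qv] assoc_mult_mat_vec[OF Q l(1) v] by simp
    moreover have "affine_mat (Bm S') q *\<^sub>v w = Q *\<^sub>v (affine_mat (Bm S) q *\<^sub>v w)"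
      unfolding af by (rule assoc_mult_mat_vec[OF Q l(2) w])
    ultimately show ?thesis unfolding state_rhs_def
      using mult_add_distrib_mat_vec[OF Q mult_mat_vec_carrier[OF l(1) v] mult_mat_vec_carrier[OF l(2) w]] by simp
  qed
  have out: "output_rhs S' q (Q *\<^sub>v v) w = output_rhs S q v w"
    if q: "q \<in> sched S" and v: "v \<in> carrier_vec ?n" for q v w
  proof -
    have Qv: "Q *\<^sub>v v \<in> carrier_vec r" using Q v by simp
    have "affine_mat (Cm S) q *\<^sub>v v = affine_mat (Cm S) q *\<^sub>v (R *\<^sub>v (Q *\<^sub>v v))"
      by (rule eq_of[OF l(3) v RQ(1)[OF v]]) (rule unobservable_invariant(2)[OF S RQ(2)[OF v] q])
    then show ?thesis unfolding output_rhs_def af m(4) assoc_mult_mat_vec[OF l(3) R Qv] by simp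
  qed
  have Q': "Q \<in> carrier_mat (xdim S') ?n" using Q d by simp
  have "manifest_behavior sol S = manifest_behavior sol S'"
  proof (intro Set.set_eqI iffI)
    fix yup assume "yup \<in> manifest_behavior sol S"
    then obtain x y u p where yup: "yup = (y, u, p)" and "(x, y, u, p) \<in> sol S" by (cases yup) (auto simp: manifest_behavior_def)
    then have x: "(x, u, p) \<in> ssol S" "y \<in> sigs (ydim S)" "AE t in M. 0 \<le> t \<longrightarrow> y t = output_rhs S (p t) (x t) (u t)"
      using sol_iff[OF S] by auto
    have a: "adm S u p" and xc: "\<And>t. 0 \<le> t \<Longrightarrow> x t \<in> carrier_vec ?n" using ssolD[OF S x(1)] by (auto simp: adm_def)
    have "((\<lambda>t\<in>{0..}. Q *\<^sub>v x t), u, p) \<in> ssol S'" by (rule ssol_image[OF si Q' st x(1)])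
    moreover have "AE t in M. 0 \<le> t \<longrightarrow> y t = output_rhs S' (p t) ((\<lambda>t\<in>{0..}. Q *\<^sub>v x t) t) (u t)"
      using x(3) by eventually_elim (use out xc adm_mem[OF a] in simp)
    ultimately have "((\<lambda>t\<in>{0..}. Q *\<^sub>v x t), y, u, p) \<in> sol S'" unfolding sol_iff[OF S'] d using x(2) by (intro conjI)
    then show "yup \<in> manifest_behavior sol S'" unfolding yup manifest_behavior_def by blast
  next
    fix yup assume "yup \<in> manifest_behavior sol S'"
    then obtain x' y u p where yup: "yup = (y, u, p)" and "(x', y, u, p) \<in> sol S'" by (cases yup) (auto simp: manifest_behavior_def)
    then have x': "(x', u, p) \<in> ssol S'" "y \<in> sigs (ydim S)" "AE t in M. 0 \<le> t \<longrightarrow> y t = output_rhs S' (p t) (x' t) (u t)"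
      using sol_iff[OF S'] d by auto
    have a: "adm S u p" and x'0: "x' 0 \<in> carrier_vec r" using ssolD[OF S' x'(1)] d by (auto simp: adm_def)
    have R0: "R *\<^sub>v x' 0 \<in> carrier_vec ?n" using R x'0 by simp
    \<comment> \<open>Lifting the initial state by R suffices: the image of the lifted trajectory
      starts at x' 0 and equals x' by uniqueness.\<close>
    define x where "x = traj S (R *\<^sub>v x' 0) u p"
    note t = traj[OF S a R0, folded x_def] and xc = traj_carrier[OF S a R0, folded x_def]
    have "(\<lambda>t\<in>{0..}. Q *\<^sub>v x t) = x'"
    proof (rule ssol_unique[OF S' ssol_image[OF si Q' st t(1)] x'(1)])
      have "Q *\<^sub>v (R *\<^sub>v x' 0) = (Q * R) *\<^sub>v x' 0" using assoc_mult_mat_vec[OF Q R x'0] by simp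
      then show "(\<lambda>t\<in>{0..}. Q *\<^sub>v x t) 0 = x' 0" using t(2) QR x'0 by simp
    qed
    then have "x' t = Q *\<^sub>v x t" if "0 \<le> t" for t using that by (metis (mono_tags, lifting) atLeast_iff restrict_apply')
    then have "AE t in M. 0 \<le> t \<longrightarrow> y t = output_rhs S (p t) (x t) (u t)"
      using x'(3) by (elim AE_mp, intro AE_I2) (use out xc adm_mem[OF a] in simp)
    then have "(x, y, u, p) \<in> sol S" unfolding sol_iff[OF S] using x'(2) t(1) by (intro conjI)
    then show "yup \<in> manifest_behavior sol S" unfolding yup manifest_behavior_def by blast
  qed
  then have "realization sol S' (manifest_behavior sol S)" using S' by (simp add: realization_def)
  then have "?n \<le> xdim S'" using min unfolding minimal_def minimal_realization_def by blast
  then show False using rn d by simp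
qed


section \<open>A finite scheduling signal separating all states, and its consequences\<close>

text \<open>Superposition removes the input from a separating pair (u, p), and
  \<open>AE_bounded\<close> cuts the horizon: outputs equal on every finite window would be equal on
  all of time.\<close>

lemma zero_input_distinguishes:
  assumes S: "is_lpv_ssa S" and obs: "observable sol S" and x: "x \<in> states S" "x \<noteq> 0\<^sub>v (xdim S)"
  obtains p L where "p \<in> scheds (sched S)" "0 \<le> L" "\<not> agree {..<L} S S x (0\<^sub>v (xdim S)) (zero_input S) p"
proof -
  note si = same_interface_refl[OF S]
  obtain u p where a: "adm S u p" and n: "\<not> agree UNIV S S x (0\<^sub>v (xdim S)) u p"
    using obs x unfolding observable_iff[OF S] by (metis zero_carrier_vec)
  have z: "0\<^sub>v (xdim S) + 1 \<cdot>\<^sub>v x = x" using x(1) by auto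
  have "\<not> agree UNIV S S x (0\<^sub>v (xdim S)) (zero_input S) p"
  proof
    assume "agree UNIV S S x (0\<^sub>v (xdim S)) (zero_input S) p"
    from agree_lincomb_zero_input[OF si a zero_carrier_vec x(1) zero_carrier_vec zero_carrier_vec agree_refl this, of 1] n
    show False unfolding z zero_vec_lincomb by blast
  qed
  then obtain L where "0 \<le> L" "\<not> agree {..<L} S S x (0\<^sub>v (xdim S)) (zero_input S) p"
    using AE_bounded[of "\<lambda>t. output_rhs S (p t) (traj S x (zero_input S) p t) (zero_input S t) =
      output_rhs S (p t) (traj S (0\<^sub>v (xdim S)) (zero_input S) p t) (zero_input S t)"]
    unfolding agree_def by auto
  moreover have "p \<in> scheds (sched S)" using a by (simp add: adm_def)
  ultimately show ?thesis using that by blast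
qed

text \<open>Since the flow is injective, a state that is still indistinguishable from zero at time L can be
  separated from it by continuing the scheduling signal appropriately.\<close>
lemma universal_scheduling:
  assumes S: "is_lpv_ssa S" and reg: "reg S" and ne: "sched S \<noteq> {}" and obs: "observable sol S"
  obtains p L where "p \<in> scheds (sched S)" "0 \<le> L"
    "\<And>x. x \<in> states S \<Longrightarrow> agree {..<L} S S x (0\<^sub>v (xdim S)) (zero_input S) p \<Longrightarrow> x = 0\<^sub>v (xdim S)"
proof -
  note si = same_interface_refl[OF S]
  let ?n = "xdim S" and ?z = "0\<^sub>v (xdim S) :: real Matrix.vec" and ?u = "zero_input S :: 't \<Rightarrow> real Matrix.vec"
  define K where "K p L = {x \<in> carrier_vec ?n. agree {..<L} S S x ?z ?u p}" for p L
  \<comment> \<open>Each pair (p, L) leaves a subspace of states not yet separated from zero; while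
    it contains a nonzero vector, extending p removes that vector.\<close>
  have "{?z} \<in> {K p L | p L. p \<in> scheds (sched S) \<and> 0 \<le> L}"
  proof (rule trivial_member_of_shrinking_subspaces)
    fix V assume "V \<in> {K p L | p L. p \<in> scheds (sched S) \<and> 0 \<le> L}"
    then obtain p L where V: "V = K p L" and p: "p \<in> scheds (sched S)" and L: "0 \<le> L" by blast
    have a: "adm S ?u p" using p by (simp only: adm_zero_iff)
    show "vec_subspace ?n V"
      unfolding vec_subspace_def V
    proof (intro conjI ballI allI)
      fix x y c assume xy: "x \<in> K p L" "y \<in> K p L"
      then have x: "x \<in> carrier_vec ?n" "y \<in> carrier_vec ?n" and ag: "agree {..<L} S S x ?z ?u p" "agree {..<L} S S y ?z ?u p"
        by (auto simp: K_def)
      have "agree {..<L} S S (x + c \<cdot>\<^sub>v y) ?z ?u p"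
        using agree_lincomb_zero_input[OF si a x zero_carrier_vec zero_carrier_vec ag, of c] unfolding zero_vec_lincomb .
      then show "x + c \<cdot>\<^sub>v y \<in> K p L" using x by (simp add: K_def)
    qed (auto simp: K_def agree_refl)
    fix x assume x: "x \<in> V" "x \<noteq> ?z"
    have xn: "x \<in> carrier_vec ?n" using x V by (simp add: K_def)
    define y where "y = traj S x ?u p L"
    have y: "y \<in> carrier_vec ?n" unfolding y_def by (rule traj_carrier[OF S a xn L])
    have y0: "y \<noteq> ?z"
      using backward_unique[OF S reg traj(1)[OF S a xn] L] x(2) unfolding y_def traj(2)[OF S a xn] by blast
    obtain p' L' where p': "p' \<in> scheds (sched S)" and L': "0 \<le> L'" and n: "\<not> agree {..<L'} S S y ?z ?u p'"
      by (rule zero_input_distinguishes[OF S obs y y0])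
    have a': "adm S ?u p'" using p' by (simp only: adm_zero_iff)
    have I: "{..<L} \<inter> {..<L + L'} = {..<L}" "{t. t + L \<in> {..<L + L'}} = {..<L'}"
      using L' by (auto simp: add.commute[of _ L] intro: less_le_trans)
    have split: "agree {..<L + L'} S S w ?z ?u (cat L p p') \<longleftrightarrow>
        agree {..<L} S S w ?z ?u p \<and> agree {..<L'} S S (traj S w ?u p L) ?z ?u p'" if w: "w \<in> carrier_vec ?n" for w
      using agree_cat[OF si a a' L w zero_carrier_vec, of "{..<L + L'}"]
      unfolding I cat_const[OF L] traj_zero[OF S a L] .
    have "K (cat L p p') (L + L') \<subseteq> V" unfolding V K_def using split by blast
    moreover have "x \<notin> K (cat L p p') (L + L')" using split[OF xn] n unfolding K_def y_def by blast
    moreover have "cat L p p' \<in> scheds (sched S)" by (rule cat_scheds[OF L p p'])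
    moreover have "0 \<le> L + L'" using L L' by simp
    ultimately show "\<exists>V'\<in>{K p L | p L. p \<in> scheds (sched S) \<and> 0 \<le> L}. V' \<subseteq> V \<and> x \<notin> V'" by blast
  next
    obtain q where "q \<in> sched S" using ne by blast
    then show "{K p L | p L. p \<in> scheds (sched S) \<and> 0 \<le> L} \<noteq> {}" using const_scheds by blast
  qed
  then obtain p L where pL: "p \<in> scheds (sched S)" "0 \<le> L" and K: "K p L = {?z}" by blast
  have "x = ?z" if "x \<in> carrier_vec ?n" "agree {..<L} S S x ?z ?u p" for x
    using K that by (auto simp: K_def)
  then show ?thesis using that pL by blast
qed

text \<open>A matching state exists for each x and the matching relation is linear, so the choice
  can be made linearly. If N x = 0, then x agrees with zero on the window and is zero by the
  separation hypothesis.\<close>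

lemma finite_horizon_embedding:
  assumes si: "same_interface S S'" and B: "manifest_behavior sol S = manifest_behavior sol S'"
    and p: "p \<in> scheds (sched S)"
    and inj: "\<And>x. x \<in> states S \<Longrightarrow> agree I S S x (0\<^sub>v (xdim S)) (zero_input S) p \<Longrightarrow> x = 0\<^sub>v (xdim S)"
  shows "\<exists>N\<in>carrier_mat (xdim S') (xdim S). (\<forall>x\<in>states S.
    agree I S S' x (N *\<^sub>v x) (zero_input S) p \<and> (N *\<^sub>v x = 0\<^sub>v (xdim S') \<longrightarrow> x = 0\<^sub>v (xdim S)))"
proof -
  let ?u = "zero_input S :: 't \<Rightarrow> real Matrix.vec"
  have a: "adm S ?u p" using p by (simp only: adm_zero_iff)
  obtain N where N: "N \<in> carrier_mat (xdim S') (xdim S)"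
    and ag: "\<And>x. x \<in> states S \<Longrightarrow> agree I S S' x (N *\<^sub>v x) ?u p"
  proof (rule linear_relation_mat[of "xdim S" "xdim S'" "\<lambda>x x'. agree I S S' x x' ?u p"])
    fix x :: "real Matrix.vec" assume x: "x \<in> states S"
    show "\<exists>x'\<in>states S'. agree I S S' x x' ?u p"
      using same_behavior_agree[OF si B a x] agree_subset by blast
  next
    show "agree I S S' (0\<^sub>v (xdim S)) (0\<^sub>v (xdim S')) ?u p" by (rule agree_zero[OF si a])
  next
    fix x y x' y' c assume "x \<in> states S" "x' \<in> states S" "y \<in> states S'"
      "y' \<in> states S'" "agree I S S' x y ?u p" "agree I S S' x' y' ?u p"
    then show "agree I S S' (x + c \<cdot>\<^sub>v x') (y + c \<cdot>\<^sub>v y') ?u p" by (intro agree_lincomb_zero_input[OF si a])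
  qed blast
  have "x = 0\<^sub>v (xdim S)" if x: "x \<in> states S" "N *\<^sub>v x = 0\<^sub>v (xdim S')" for x
    using agree_trans[OF ag[OF x(1), unfolded x(2)] agree_sym[OF agree_zero[OF si a]]] by (rule inj[OF x(1)])
  then show ?thesis using N ag by blast
qed

lemma observable_imp_minimal:
  assumes S: "is_lpv_ssa S" and reg: "reg S" and ne: "sched S \<noteq> {}" and obs: "observable sol S"
  shows "minimal sol S"
  unfolding minimal_def minimal_realization_def
proof (intro conjI allI impI)
  show "realization sol S (manifest_behavior sol S)" using S by (simp add: realization_def)
  fix S' assume "realization sol S' (manifest_behavior sol S)"
  then have S': "is_lpv_ssa S'" and B: "manifest_behavior sol S = manifest_behavior sol S'" by (auto simp: realization_def)
  have si: "same_interface S S'" by (rule same_behavior_interface[OF S S' ne B])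
  obtain p L where p: "p \<in> scheds (sched S)" and inj: "\<And>x. x \<in> states S \<Longrightarrow>
      agree {..<L} S S x (0\<^sub>v (xdim S)) (zero_input S) p \<Longrightarrow> x = 0\<^sub>v (xdim S)"
    by (rule universal_scheduling[OF S reg ne obs]) blast
  from finite_horizon_embedding[OF si B p inj]
  show "xdim S \<le> xdim S'" using injective_mat_dim_le by blast
qed

text \<open>After the universal scheduling signal the states of S and S' are matched once and for all:
  the initial states are already determined by the first outputs, so the matching does not depend on
  the continuation of the input. The flow of S is onto, hence every state of S is matched.\<close>
lemma equivalent_state_exists:
  assumes si: "same_interface S S'" and B: "manifest_behavior sol S = manifest_behavior sol S'"
    and n: "xdim S' = xdim S" and reg: "reg S" and ne: "sched S \<noteq> {}" and obs: "observable sol S"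
    and y: "y \<in> states S"
  shows "\<exists>y'\<in>states S'. \<forall>u p. adm S u p \<longrightarrow> agree UNIV S S' y y' u p"
proof -
  note d = same_interfaceD[OF si]
  note S = d(1) and siS = same_interface_refl[OF d(1)]
  let ?u = "zero_input S :: 't \<Rightarrow> real Matrix.vec"
  obtain p L where p: "p \<in> scheds (sched S)" and L: "0 \<le> L" and inj: "\<And>x. x \<in> states S \<Longrightarrow>
      agree {..<L} S S x (0\<^sub>v (xdim S)) ?u p \<Longrightarrow> x = 0\<^sub>v (xdim S)"
    by (rule universal_scheduling[OF S reg ne obs]) blast
  have a: "adm S ?u p" using p by (simp only: adm_zero_iff)
  have a': "adm S' ?u p" using a d by simp
  obtain N where N: "N \<in> carrier_mat (xdim S) (xdim S)"
    and Nag: "\<And>x. x \<in> states S \<Longrightarrow> agree {..<L} S S' x (N *\<^sub>v x) ?u p"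
    and Ninj: "\<And>x. x \<in> states S \<Longrightarrow> N *\<^sub>v x = 0\<^sub>v (xdim S) \<Longrightarrow> x = 0\<^sub>v (xdim S)"
    using finite_horizon_embedding[OF si B p inj] unfolding n by blast
  obtain N' where N': "N' \<in> carrier_mat (xdim S) (xdim S)" "N * N' = 1\<^sub>m (xdim S)"
    by (rule injective_mat_invertible[OF N Ninj])
  \<comment> \<open>The square injective N is onto, so x' is N z for some z. Then x and z produce
    the same output on the separating window and coincide.\<close>
  have uniq: "x' = N *\<^sub>v x"
    if x: "x \<in> states S" "x' \<in> states S" and ag: "agree {..<L} S S' x x' ?u p" for x x'
  proof -
    define z where "z = N' *\<^sub>v x'"
    have z: "z \<in> states S" using N'(1) x(2) by (simp add: z_def)
    have Nz: "N *\<^sub>v z = x'" unfolding z_def using assoc_mult_mat_vec[OF N N'(1) x(2)] N'(2) x(2) by simp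
    have e: "agree {..<L} S S x z ?u p"
      by (rule agree_trans[OF ag agree_sym]) (use Nag[OF z] Nz in simp)
    have "agree {..<L} S S (x + (-1) \<cdot>\<^sub>v z) (z + (-1) \<cdot>\<^sub>v z) ?u p"
      by (rule agree_lincomb_zero_input[OF siS a x(1) z z z e agree_refl])
    then have "x + (-1) \<cdot>\<^sub>v z = 0\<^sub>v (xdim S)"
      unfolding vec_add_neg_self[OF z] using x(1) z by (intro inj) auto
    then have "(x + (-1) \<cdot>\<^sub>v z) $ i = 0" if "i < xdim S" for i using that by simp
    then have "x = z" using x(1) z by (intro eq_vecI) auto
    then show ?thesis using Nz by simp
  qed
  \<comment> \<open>F is the flow over the time L as a matrix. It is injective by backward
    uniqueness, hence invertible, and y is reached from F' y.\<close>
  obtain F where F: "F \<in> carrier_mat (xdim S) (xdim S)"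
    and Fx: "\<And>x. x \<in> states S \<Longrightarrow> F *\<^sub>v x = traj S x ?u p L"
  proof (rule linear_relation_mat[of "xdim S" "xdim S" "\<lambda>x y. y = traj S x ?u p L"])
    fix x :: "real Matrix.vec" assume "x \<in> states S"
    then show "\<exists>y\<in>states S. y = traj S x ?u p L" using traj_carrier[OF S a _ L] by blast
  next
    show "0\<^sub>v (xdim S) = traj S (0\<^sub>v (xdim S)) ?u p L" using traj_zero[OF S a L] by simp
  next
    fix x y x' y' :: "real Matrix.vec" and c
    assume x: "x \<in> states S" "x' \<in> states S" and "y = traj S x ?u p L" "y' = traj S x' ?u p L"
    moreover have "lincomb ?u c ?u = ?u" by (rule lincomb_zero) (rule a[unfolded adm_def, THEN conjunct1])
    ultimately show "y + c \<cdot>\<^sub>v y' = traj S (x + c \<cdot>\<^sub>v x') ?u p L"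
      using fun_cong[OF traj_lincomb(1)[OF S a a x, of c], of L] L by simp
  qed blast
  obtain F' where F': "F' \<in> carrier_mat (xdim S) (xdim S)" "F * F' = 1\<^sub>m (xdim S)"
  proof (rule injective_mat_invertible[OF F])
    fix x assume x: "x \<in> states S" "F *\<^sub>v x = 0\<^sub>v (xdim S)"
    show "x = 0\<^sub>v (xdim S)"
      using backward_unique[OF S reg traj(1)[OF S a x(1)] L] x Fx[OF x(1)] traj(2)[OF S a x(1)] by simp
  qed blast
  define x where "x = F' *\<^sub>v y"
  have x: "x \<in> states S" using F' y by (simp add: x_def)
  have xy: "traj S x ?u p L = y"
    using Fx[OF x] assoc_mult_mat_vec[OF F F'(1) y] F'(2) y by (simp add: x_def)
  have Nx: "N *\<^sub>v x \<in> states S'" using N x n by simp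
  show ?thesis
  proof (intro bexI allI impI)
    \<comment> \<open>The witness is fixed before the continuation (v, r) is chosen. The state x'
      obtained below could depend on the continuation, but the outputs before L force x' = N
      x.\<close>
    show "traj S' (N *\<^sub>v x) ?u p L \<in> states S'" by (rule traj_carrier[OF d(2) a' Nx L])
    fix v r assume av: "adm S v r"
    obtain x' where x': "x' \<in> states S'" and ag: "agree UNIV S S' x x' (cat L ?u v) (cat L p r)"
      using same_behavior_agree[OF si B adm_cat[OF a av L] x] by blast
    note ag' = ag[unfolded agree_cat_UNIV[OF si a av L x x']]
    have "x' = N *\<^sub>v x" using uniq[OF x] x' ag' n by simp
    then show "agree UNIV S S' y (traj S' (N *\<^sub>v x) ?u p L) v r" using ag' xy by simp
  qed
qed

section \<open>Isomorphism of minimal realizations\<close>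

lemma minimal_realizations_isomorphic:
  assumes S: "is_lpv_ssa S" and S': "is_lpv_ssa S'" and reg: "reg S" and int: "interior (sched S) \<noteq> {}"
    and min: "minimal sol S" "minimal sol S'" and B: "manifest_behavior sol S = manifest_behavior sol S'"
  shows "\<exists>T. lpv_isomorphism T S S'"
proof -
  have ne: "sched S \<noteq> {}" using int interior_subset by blast
  have si: "same_interface S S'" by (rule same_behavior_interface[OF S S' ne B])
  note d = same_interfaceD[OF si]
  have "realization sol S' (manifest_behavior sol S)" "realization sol S (manifest_behavior sol S')"
    using S S' B by (auto simp: realization_def)
  then have n: "xdim S' = xdim S" using min unfolding minimal_def minimal_realization_def by (metis le_antisym)
  note obs = minimal_imp_observable[OF S min(1)] and obs' = minimal_imp_observable[OF S' min(2)]
  \<comment> \<open>G compares two states under all continuations. Observability of S' makes it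
    single-valued, that of S makes it injective.\<close>
  define G where "G y y' \<longleftrightarrow> (\<forall>u p. adm S u p \<longrightarrow> agree UNIV S S' y y' u p)" for y y'
  have Gtotal: "\<exists>y'\<in>states S. G y y'" if "y \<in> states S" for y
    using equivalent_state_exists[OF si B n reg ne obs that] n by (simp add: G_def)
  have Guniq: "y' = y''" if y: "y' \<in> states S" "y'' \<in> states S" and G: "G y y'" "G y y''" for y y' y''
  proof -
    have "agree UNIV S' S' y' y'' u p" if a: "adm S' u p" for u p
      using G a d(6) agree_trans[OF agree_sym] unfolding G_def by metis
    then show ?thesis using obs' y n unfolding observable_iff[OF S'] by auto
  qed
  have Ginj: "x = y" if x: "x \<in> states S" "y \<in> states S" and G: "G x y'" "G y y'" for x y y'
  proof -
    have "agree UNIV S S x y u p" if a: "adm S u p" for u p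
      using G a agree_trans[OF _ agree_sym] unfolding G_def by metis
    then show ?thesis using obs x unfolding observable_iff[OF S] by auto
  qed
  have Glin: "G (x + c \<cdot>\<^sub>v x') (y + c \<cdot>\<^sub>v y')"
    if c: "x \<in> states S" "x' \<in> states S" "y \<in> states S" "y' \<in> states S"
      and G: "G x y" "G x' y'" for x x' y y' c
    unfolding G_def
  proof (intro allI impI)
    fix u p assume a: "adm S u p"
    have "agree UNIV S S' x y u p" "agree UNIV S S' x' y' (zero_input S) p"
      using G a adm_zero[OF a] unfolding G_def by blast+
    then show "agree UNIV S S' (x + c \<cdot>\<^sub>v x') (y + c \<cdot>\<^sub>v y') u p"
      using c n by (intro agree_lincomb_zero_input[OF si a]) auto
  qed
  \<comment> \<open>Some state is equivalent to zero by totality; subtracting this pair from itself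
    leaves the pair of zeros.\<close>
  have G0: "G (0\<^sub>v (xdim S)) (0\<^sub>v (xdim S))"
  proof -
    obtain y where y: "y \<in> states S" and Gy: "G (0\<^sub>v (xdim S)) y" using Gtotal[OF zero_carrier_vec] by blast
    show ?thesis
      using Glin[OF zero_carrier_vec zero_carrier_vec y y Gy Gy, of "-1"] unfolding vec_add_neg_self[OF y] zero_vec_lincomb .
  qed
  obtain T where T: "T \<in> carrier_mat (xdim S) (xdim S)" and GT: "\<And>x. x \<in> states S \<Longrightarrow> G x (T *\<^sub>v x)"
    by (rule linear_relation_mat[of "xdim S" "xdim S" G, OF Gtotal G0 Glin]) blast+
  obtain T' where T': "T' \<in> carrier_mat (xdim S) (xdim S)" "T * T' = 1\<^sub>m (xdim S)" "T' * T = 1\<^sub>m (xdim S)"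
  proof (rule injective_mat_invertible[OF T])
    fix x assume x: "x \<in> states S" "T *\<^sub>v x = 0\<^sub>v (xdim S)"
    show "x = 0\<^sub>v (xdim S)" using GT[OF x(1)] G0 x by (intro Ginj[OF x(1) zero_carrier_vec]) auto
  qed blast
  have inv: "invertible_mat T"
    unfolding invertible_mat_def inverts_mat_def square_mat.simps using T T' by auto
  have step: "state_rhs S' q (T *\<^sub>v v) w = T *\<^sub>v state_rhs S q v w" "output_rhs S' q (T *\<^sub>v v) w = output_rhs S q v w"
    if q: "q \<in> sched S" and v: "v \<in> states S" and w: "w \<in> carrier_vec (udim S)" for q v w
  proof -
    let ?w = "const w :: 't \<Rightarrow> real Matrix.vec" and ?q = "const q :: 't \<Rightarrow> real ^ 'p"
    have a: "adm S ?w ?q" by (rule adm_const[OF w q])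
    have a': "adm S' ?w ?q" using a d by simp
    have Tv: "T *\<^sub>v v \<in> states S'" using T v n by simp
    note t = traj[OF S a v] and t' = traj[OF S' a' Tv]
    \<comment> \<open>Equivalence survives a common initial segment of the signals, so the states
      reached at time s are again matched, and single-valuedness identifies them through T.\<close>
    have xs: "traj S' (T *\<^sub>v v) ?w ?q s = T *\<^sub>v traj S v ?w ?q s" if s: "0 \<le> s" for s
    proof (rule Guniq)
      note c = traj_carrier[OF S a v s]
      show "T *\<^sub>v traj S v ?w ?q s \<in> states S" using T c by simp
      show "traj S' (T *\<^sub>v v) ?w ?q s \<in> states S" using traj_carrier[OF S' a' Tv s] n by simp
      show "G (traj S v ?w ?q s) (T *\<^sub>v traj S v ?w ?q s)" by (rule GT[OF c])
      show "G (traj S v ?w ?q s) (traj S' (T *\<^sub>v v) ?w ?q s)" unfolding G_def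
      proof (intro allI impI)
        fix u p assume au: "adm S u p"
        have "agree UNIV S S' v (T *\<^sub>v v) (cat s ?w u) (cat s ?q p)"
          using GT[OF v] adm_cat[OF a au s] unfolding G_def by blast
        then show "agree UNIV S S' (traj S v ?w ?q s) (traj S' (T *\<^sub>v v) ?w ?q s) u p"
          unfolding agree_cat_UNIV[OF si a au s v Tv] by simp
      qed
    qed
    let ?f = "state_rhs S q v w" and ?f' = "state_rhs S' q (T *\<^sub>v v) w"
    have fc: "?f \<in> states S" "?f' \<in> states S"
      using state_rhs_carrier[OF S] state_rhs_carrier[OF S', of q "T *\<^sub>v v" w] n by auto
    show "?f' = T *\<^sub>v ?f"
    proof (rule eq_vecI)
      fix i assume "i < dim_vec (T *\<^sub>v ?f)"
      then have i: "i < xdim S" using T by simp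
      \<comment> \<open>The functional formed by row i of T and minus the i-th coordinate vanishes
        along the two trajectories; \<open>generator\<close> turns this into coordinate i of the
        intertwining relation.\<close>
      have c: "Matrix.row T i \<in> states S" using T by (metis carrier_matD(2) row_carrier)
      have c': "(-1) \<cdot>\<^sub>v unit_vec (xdim S) i \<in> states S'" using n by simp
      have row: "Matrix.row T i \<bullet> z = (T *\<^sub>v z) $ i" for z using T i by simp
      have un: "((-1) \<cdot>\<^sub>v unit_vec (xdim S) i) \<bullet> z = - z $ i" if "z \<in> states S" for z :: "real Matrix.vec"
        using that i by simp
      have "Matrix.row T i \<bullet> traj S v ?w ?q s + ((-1) \<cdot>\<^sub>v unit_vec (xdim S) i) \<bullet> traj S' (T *\<^sub>v v) ?w ?q s = 0" if s: "0 \<le> s" for s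
        unfolding xs[OF s] row using un[of "T *\<^sub>v traj S v ?w ?q s"] T traj_carrier[OF S a v s] by simp
      then have "Matrix.row T i \<bullet> state_rhs S q (traj S v ?w ?q 0) w +
          ((-1) \<cdot>\<^sub>v unit_vec (xdim S) i) \<bullet> state_rhs S' q (traj S' (T *\<^sub>v v) ?w ?q 0) w = 0"
        by (rule generator[OF si t(1) t'(1) c c'])
      then show "?f' $ i = (T *\<^sub>v ?f) $ i" unfolding t(2) t'(2) row un[OF fc(2)] by simp
    qed (use T fc in simp)
    have "agree UNIV S S' v (T *\<^sub>v v) ?w ?q" using GT[OF v] a unfolding G_def by blast
    then have "AE s in M. 0 \<le> s \<longrightarrow> output_rhs S q (traj S v ?w ?q s) w = output_rhs S' q (traj S' (T *\<^sub>v v) ?w ?q s) w"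
      unfolding agree_def by eventually_elim auto
    from initial_output[OF si t(1) t'(1) this]
    show "output_rhs S' q (T *\<^sub>v v) w = output_rhs S q v w" unfolding t(2) t'(2) by simp
  qed
  show ?thesis using intertwining_isomorphism[OF si n int T inv step] by blast
qed

end

section \<open>Discrete time\<close>

definition dt_ssol :: "'p::finite lpv_ssa \<Rightarrow> ((nat \<Rightarrow> real Matrix.vec) \<times> (nat \<Rightarrow> real Matrix.vec) \<times> (nat \<Rightarrow> real ^ 'p)) set" where
  "dt_ssol S = {(x, u, p). x \<in> UNIV \<rightarrow> carrier_vec (xdim S) \<and> u \<in> UNIV \<rightarrow> carrier_vec (udim S) \<and> p \<in> UNIV \<rightarrow> sched S \<and>
     (\<forall>t. x (Suc t) = state_rhs S (p t) (x t) (u t))}"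

text \<open>Every natural number is nonnegative, so the extensionality conventions of the locale
  disappear in discrete time.\<close>

lemma restrict_nat [simp]: "restrict f {0::nat..} = f"
  by (simp add: restrict_def)

lemma PiE_nat: "({0::nat..} \<rightarrow>\<^sub>E A) = (UNIV \<rightarrow> A)"
  by (simp add: PiE_def Pi_def extensional_def)

lemma dt_ssolD:
  assumes "(x, u, p) \<in> dt_ssol S"
  shows "x t \<in> carrier_vec (xdim S)" "u t \<in> carrier_vec (udim S)" "p t \<in> sched S" "x (Suc t) = state_rhs S (p t) (x t) (u t)"
  using assms by (auto simp: dt_ssol_def)

lemma dt_ssolI:
  assumes "\<And>t. x t \<in> carrier_vec (xdim S)" "\<And>t. u t \<in> carrier_vec (udim S)" "\<And>t. p t \<in> sched S"
    "\<And>t. x (Suc t) = state_rhs S (p t) (x t) (u t)"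
  shows "(x, u, p) \<in> dt_ssol S"
  using assms by (simp add: dt_ssol_def)

lemma invertible_mat_kernel:
  fixes A :: "real mat"
  assumes A: "A \<in> carrier_mat n n" and i: "invertible_mat A" and x: "x \<in> carrier_vec n" "A *\<^sub>v x = 0\<^sub>v n"
  shows "x = 0\<^sub>v n"
proof -
  obtain B where B: "B * A = 1\<^sub>m (dim_row B)" "A * B = 1\<^sub>m (dim_row A)"
    using i unfolding invertible_mat_def inverts_mat_def by blast
  have Bc: "B \<in> carrier_mat n n"
    using arg_cong[OF B(1), of dim_col] arg_cong[OF B(2), of dim_col] A by (intro carrier_matI) simp_all
  have "x = (B * A) *\<^sub>v x" using B(1) Bc x by simp
  also have "\<dots> = 0\<^sub>v n" using assoc_mult_mat_vec[OF Bc A x(1)] x(2) Bc by simp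
  finally show ?thesis .
qed

lemma dt_ssol_first_step:
  assumes "same_interface S S'" "(x, const v, const q) \<in> dt_ssol S" "(x', const v, const q) \<in> dt_ssol S'"
  shows "x 1 = state_rhs S q (x 0) v" "x' 1 = state_rhs S' q (x' 0) v"
  using dt_ssolD(4)[OF assms(2), of 0] dt_ssolD(4)[OF assms(3), of 0] by simp_all

text \<open>The cases follow the order of the locale assumptions. With the counting measure, almost
  everywhere means everywhere.\<close>

interpretation dt: lpv_time "count_space UNIV" dt_ssol "\<lambda>m. UNIV \<rightarrow> carrier_vec m" "\<lambda>P. UNIV \<rightarrow> P"
  dt_solutions dt_regular
proof (unfold_locales, goal_cases)
  case (1 S x y u p)
  then show ?case by (auto simp: dt_solutions_def dt_ssol_def AE_count_space)
next
  case (2 S x u p)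
  then show ?case unfolding PiE_nat by (simp add: dt_ssol_def)
next
  case (3 m)
  show ?case unfolding PiE_nat ..
next
  case (4 P)
  show ?case unfolding PiE_nat ..
next
  case (5 v m)
  then show ?case by simp
next
  case (6 q P)
  then show ?case by simp
next
  case (7 L m w w')
  then show ?case by (simp add: cat_def Pi_def)
next
  case (8 L P p p')
  then show ?case by (simp add: cat_def Pi_def)
next
  case (9 S x u p)
  then show ?case by (simp add: output_rhs_carrier)
next
  case (10 S x0 u p)
  define x where "x = rec_nat x0 (\<lambda>t xt. state_rhs S (p t) xt (u t))"
  have x: "x 0 = x0" "\<And>t. x (Suc t) = state_rhs S (p t) (x t) (u t)" by (simp_all add: x_def)
  have "x t \<in> carrier_vec (xdim S)" for t
    by (cases t) (use x 10 state_rhs_carrier[OF 10(1)] in auto)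
  then have "(x, u, p) \<in> dt_ssol S" using 10 x by (intro dt_ssolI) auto
  then show ?case using x(1) by blast
next
  case (11 S x x' u p)
  have "x t = x' t" for t
    by (induction t) (use 11 dt_ssolD(4)[OF 11(2)] dt_ssolD(4)[OF 11(3)] in auto)
  then show ?case by blast
next
  case (12 S x x' u u' p a)
  note d = dt_ssolD[OF 12(2)] and d' = dt_ssolD[OF 12(3)]
  show ?case unfolding restrict_nat
  proof (rule dt_ssolI)
    fix t
    show "x (Suc t) + a \<cdot>\<^sub>v x' (Suc t) = state_rhs S (p t) (x t + a \<cdot>\<^sub>v x' t) (u t + a \<cdot>\<^sub>v u' t)"
      unfolding d(4) d'(4) by (rule state_rhs_lincomb[OF 12(1) d(1) d'(1) d(2) d'(2), symmetric])
  qed (use d d' in auto)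
next
  case (13 S x x' u u' p p' L)
  note d = dt_ssolD[OF 13(2)] and d' = dt_ssolD[OF 13(3)]
  show ?case
  proof (rule dt_ssolI)
    fix t
    show "cat L x x' (Suc t) = state_rhs S (cat L p p' t) (cat L x x' t) (cat L u u' t)"
    proof (cases "t < L")
      case True
      show ?thesis
      proof (cases "Suc t < L")
        case False
        \<comment> \<open>At the switch the old recursion still produces x L, which is x' 0, the
          first value of the new piece.\<close>
        then have "Suc t = L" using True by simp
        then show ?thesis using True d(4)[of t] 13(5) by (simp add: cat_def)
      qed (use d(4)[of t] in \<open>simp add: cat_def\<close>)
    next
      case False
      then have "Suc t - L = Suc (t - L)" by simp
      then show ?thesis using False d'(4)[of "t - L"] by (simp add: cat_def)
    qed
  qed (use d d' in \<open>auto simp: cat_def\<close>)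
next
  case (14 S S' Q x u p)
  note d = dt_ssolD[OF 14(4)]
  have si: "sched S' = sched S" "udim S' = udim S" using 14(1) by (auto simp: same_interface_def)
  show ?case unfolding restrict_nat
    by (rule dt_ssolI) (use d 14(2,3) si in auto)
next
  case (15 S S' x x' v q c c')
  \<comment> \<open>The states at time 1 are the right-hand sides at time 0.\<close>
  show ?case using 15(6)[of 1] dt_ssol_first_step[OF 15(1-3)] by simp
next
  case (16 S S' x x' v q)
  then show ?case by (simp add: AE_count_space)
next
  case (17 S x p L)
  note d = dt_ssolD[OF 17(3)]
  \<comment> \<open>Backward induction from time L: each A(p t) is invertible and the input is zero,
    so a zero state has a zero predecessor.\<close>
  have "x (L - k) = 0\<^sub>v (xdim S)" if "k \<le> L" for k
    using that
  proof (induction k)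
    case 0
    then show ?case using 17(5) by simp
  next
    case (Suc k)
    define t where "t = L - Suc k"
    have t: "Suc t = L - k" using Suc.prems by (simp add: t_def)
    have "affine_mat (Am S) (p t) *\<^sub>v x t = 0\<^sub>v (xdim S)"
      using d(4)[of t] rhs_zero_input(1)[OF 17(1) d(1), of "p t" t] Suc t by simp
    moreover have "invertible_mat (affine_mat (Am S) (p t))" using 17(2) d(3) by (simp add: dt_regular_def)
    ultimately show ?case unfolding t_def[symmetric]
      using invertible_mat_kernel[OF lpv_carriers(1)[OF 17(1)] _ d(1)] by blast
  qed
  from this[of L] show ?case by simp
next
  case (18 L R)
  show ?case unfolding AE_count_space
  proof (intro iffI ballI impI)
    fix t assume *: "\<forall>t\<in>UNIV. L \<le> t \<longrightarrow> R (t - L)"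
    from *[rule_format, of "t + L"] show "R t" by simp
  qed simp
next
  case (19 R)
  have "R t" for t using 19[of "Suc t"] by (simp add: AE_count_space)
  then show ?case by simp
qed

section \<open>Continuous time\<close>

lemma AE_lebesgue_iff_negligible: "(AE t in lebesgue. P t) \<longleftrightarrow> negligible {t. \<not> P t}"
proof
  assume "AE t in lebesgue. P t"
  then obtain N where "N \<in> null_sets lebesgue" "{t. \<not> P t} \<subseteq> N" unfolding eventually_ae_filter by auto
  then show "negligible {t. \<not> P t}" using negligible_iff_null_sets negligible_subset by blast
next
  assume "negligible {t. \<not> P t}"
  then have "{t. \<not> P t} \<in> null_sets lebesgue" using negligible_iff_null_sets by blast
  then show "AE t in lebesgue. P t" by (rule AE_I') auto
qed

lemma AE_lebesgue_shift:
  fixes L :: real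
  shows "(AE t in lebesgue. L \<le> t \<longrightarrow> R (t - L)) \<longleftrightarrow> (AE t in lebesgue. 0 \<le> t \<longrightarrow> R t)"
proof -
  have e: "{t. \<not> (L \<le> t \<longrightarrow> R (t - L))} = (+) L ` {t. \<not> (0 \<le> t \<longrightarrow> R t)}" (is "?A = ?B")
  proof (intro Set.set_eqI iffI)
    fix t assume "t \<in> ?A"
    then show "t \<in> ?B" by (intro image_eqI[of _ _ "t - L"]) auto
  qed auto
  show ?thesis unfolding AE_lebesgue_iff_negligible e
    using negligible_translation negligible_translation_rev by blast
qed

text \<open>Countably many horizons suffice, and a countable union of null sets is null.\<close>

lemma AE_lebesgue_bounded:
  assumes "\<And>L::real. 0 \<le> L \<Longrightarrow> AE t in lebesgue. 0 \<le> t \<and> t < L \<longrightarrow> R t"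
  shows "AE t in lebesgue. 0 \<le> t \<longrightarrow> R t"
proof -
  have "AE t in lebesgue. \<forall>k::nat. 0 \<le> t \<and> t < real k \<longrightarrow> R t"
    unfolding AE_all_countable using assms by simp
  then show ?thesis by eventually_elim (use reals_Archimedean2 in blast)
qed

lemma has_integral_abs_continuous:
  assumes ac: "loc_abs_continuous g"
    and d: "AE t in lebesgue. 0 \<le> t \<longrightarrow> (g has_real_derivative f t) (at t within {0..})" and t: "t \<ge> 0"
  shows "(f has_integral (g t - g 0)) {0..t}"
proof (rule abs_continuous_has_integral_derivative[OF t])
  show "negligible {t. \<not> (0 \<le> t \<longrightarrow> (g has_real_derivative f t) (at t within {0..}))}"
    using d unfolding AE_lebesgue_iff_negligible .
  fix s assume "s \<in> {0..t} - {t. \<not> (0 \<le> t \<longrightarrow> (g has_real_derivative f t) (at t within {0..}))}"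
  then have "(g has_real_derivative f s) (at s within {0..})" by simp
  then show "(g has_real_derivative f s) (at s within {0..t})" by (rule has_field_derivative_subset) auto
next
  fix e :: real assume "e > 0"
  then show "\<exists>d>0. \<forall>I. finite I \<longrightarrow> (\<forall>(u, v)\<in>I. 0 \<le> u \<and> u \<le> v \<and> v \<le> t) \<longrightarrow>
      disjoint_family_on (\<lambda>(u, v). {u<..<v}) I \<longrightarrow> (\<Sum>(u, v)\<in>I. v - u) < d \<longrightarrow> (\<Sum>(u, v)\<in>I. \<bar>g v - g u\<bar>) < e"
    using ac t unfolding loc_abs_continuous_def by simp
qed

lemma has_integral_Icc_diff:
  fixes f :: "real \<Rightarrow> real"
  assumes "(f has_integral I) {0..a}" "(f has_integral J) {0..b}" "0 \<le> a" "a \<le> b"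
  shows "(f has_integral (J - I)) {a..b}"
proof -
  have "f integrable_on {a..b}" by (rule integrable_on_subinterval[OF has_integral_integrable[OF assms(2)]]) (use assms in auto)
  then obtain K where K: "(f has_integral K) {a..b}" by (auto simp: integrable_on_def)
  have "(f has_integral (I + K)) {0..b}" by (rule has_integral_combine[OF assms(3,4,1) K])
  then have "I + K = J" using assms(2) by (rule has_integral_unique)
  then have "J - I = K" by simp
  then show ?thesis using K by simp
qed

lemma integral_form_continuous_on:
  fixes f g :: "real \<Rightarrow> real"
  assumes "\<And>t. t \<ge> 0 \<Longrightarrow> (f has_integral (g t - g 0)) {0..t}"
  shows "continuous_on {0..} g"
proof (rule continuous_on_atLeastI)
  fix T :: real
  show "continuous_on {0..T} g"
  proof (cases "T \<ge> 0")
    case True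
    have "continuous_on {0..T} (\<lambda>t. g 0 + integral {0..t} f)"
      by (intro continuous_intros indefinite_integral_continuous_1 has_integral_integrable[OF assms[OF True]])
    then show ?thesis by (rule continuous_on_eq) (simp add: integral_unique[OF assms])
  qed simp
qed

text \<open>Continuity enters pointwise, since a piecewise continuous f has it only at almost every
  t.\<close>

lemma integral_form_has_derivative:
  fixes f g :: "real \<Rightarrow> real"
  assumes int: "\<And>t. t \<ge> 0 \<Longrightarrow> (f has_integral (g t - g 0)) {0..t}" and t: "t \<ge> 0"
    and c: "continuous (at t within {0..}) f"
  shows "(g has_real_derivative f t) (at t within {0..})"
proof -
  have T: "t \<in> {0..t+1}" "t + 1 \<ge> 0" using t by auto
  have w: "at t within {0..} = at t within {0..t+1}" by (rule at_within_atLeast_eq_Icc) simp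
  have "((\<lambda>u. integral {0..u} f) has_vector_derivative f t) (at t within {0..t+1})"
    using integral_has_vector_derivative_continuous_at[OF has_integral_integrable[OF int[OF T(2)]] _ finite.emptyI] T(1) c w
    by (simp add: continuous_within)
  then have "((\<lambda>u. integral {0..u} f) has_real_derivative f t) (at t within {0..t+1})"
    by (simp add: has_real_derivative_iff_has_vector_derivative)
  then have "((\<lambda>u. g 0 + integral {0..u} f) has_real_derivative f t) (at t within {0..t+1})"
    by (auto intro!: derivative_eq_intros)
  then have "(g has_real_derivative f t) (at t within {0..t+1})"
    by (rule has_field_derivative_transform_within[where d = 1]) (use T in \<open>simp_all add: integral_unique[OF int]\<close>)
  then show ?thesis unfolding w .
qed

text \<open>A piecewise continuous integrand is bounded by some K on [0,T], so its primitive is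
  Lipschitz there and total length below \<open>e / K\<close> suffices.\<close>

lemma integral_form_loc_abs_continuous:
  fixes f g :: "real \<Rightarrow> real"
  assumes int: "\<And>t. t \<ge> 0 \<Longrightarrow> (f has_integral (g t - g 0)) {0..t}" and f: "pw_continuous f"
  shows "loc_abs_continuous g"
  unfolding loc_abs_continuous_def
proof (intro allI impI)
  fix T e :: real assume T: "0 \<le> T" and e: "0 < e"
  obtain K where K: "K > 0" "\<And>t. t \<in> {0..T} \<Longrightarrow> \<bar>f t\<bar> \<le> K" using pw_continuous_bounded[OF f, of T] by blast
  have lip: "\<bar>g b - g a\<bar> \<le> K * (b - a)" if ab: "0 \<le> a" "a \<le> b" "b \<le> T" for a b
  proof -
    have i: "(f has_integral ((g b - g 0) - (g a - g 0))) {a..b}"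
      by (rule has_integral_Icc_diff[OF int int]) (use ab in auto)
    have "norm ((g b - g 0) - (g a - g 0)) \<le> K * measure lborel {a..b}"
      by (rule has_integral_bound_real[OF _ finite.emptyI i]) (use K ab in auto)
    then show ?thesis using ab by simp
  qed
  show "\<exists>d>0. \<forall>I. finite I \<longrightarrow> (\<forall>(a, b)\<in>I. 0 \<le> a \<and> a \<le> b \<and> b \<le> T) \<longrightarrow>
     disjoint_family_on (\<lambda>(a, b). {a<..<b}) I \<longrightarrow> (\<Sum>(a, b)\<in>I. b - a) < d \<longrightarrow> (\<Sum>(a, b)\<in>I. \<bar>g b - g a\<bar>) < e"
  proof (intro exI[of _ "e / K"] conjI allI impI)
    fix I :: "(real \<times> real) set"
    assume I: "\<forall>(a, b)\<in>I. 0 \<le> a \<and> a \<le> b \<and> b \<le> T" and s: "(\<Sum>(a, b)\<in>I. b - a) < e / K"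
    have "(\<Sum>(a, b)\<in>I. \<bar>g b - g a\<bar>) \<le> (\<Sum>(a, b)\<in>I. K * (b - a))"
      by (rule sum_mono) (use I lip in auto)
    also have "\<dots> = K * (\<Sum>(a, b)\<in>I. b - a)" by (simp add: sum_distrib_left split_def)
    also have "\<dots> < e" using s K(1) by (simp add: field_simps)
    finally show "(\<Sum>(a, b)\<in>I. \<bar>g b - g a\<bar>) < e" .
  qed (use e K in auto)
qed

text \<open>There are finitely many discontinuities on each [0,k], hence countably many in
  all.\<close>

lemma pw_continuous_AE_continuous:
  assumes "pw_continuous f" shows "AE t in lebesgue. 0 \<le> t \<longrightarrow> continuous (at t within {0..}) f"
  unfolding AE_lebesgue_iff_negligible
proof (rule negligible_subset)
  let ?D = "\<lambda>k. {t \<in> {0..real k}. \<not> continuous (at t within {0..}) f}"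
  have "finite (?D k)" for k using assms unfolding pw_continuous_def by simp
  then have "countable (\<Union>k. ?D k)" by (intro countable_UN[OF countableI_type] countable_finite)
  then show "negligible (\<Union>k. ?D k)" unfolding negligible_iff_null_sets by (intro null_sets_completionI countable_imp_null_set_lborel)
  show "{t. \<not> (0 \<le> t \<longrightarrow> continuous (at t within {0..}) f)} \<subseteq> (\<Union>k. ?D k)"
    using real_arch_simple by auto
qed

text \<open>By continuity f 0 is the one-sided derivative at 0 of the primitive, and that primitive
  is constant.\<close>

lemma integral_zero_imp_initial_zero:
  fixes f :: "real \<Rightarrow> real"
  assumes int: "\<And>t. t \<ge> 0 \<Longrightarrow> (f has_integral 0) {0..t}" and c: "continuous_on {0..} f"
  shows "f 0 = 0"
proof -
  have "continuous (at 0 within {0..}) f" using c by (simp add: continuous_on_eq_continuous_within)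
  then have "((\<lambda>t. 0) has_real_derivative f 0) (at 0 within {0..})"
    by (intro integral_form_has_derivative) (use int in auto)
  then have "((\<lambda>t. 0 :: real) \<longlongrightarrow> f 0) (at_right (0 :: real))"
    by (simp add: has_field_derivative_iff at_within_Ici_at_right)
  then show ?thesis using tendsto_unique[OF trivial_limit_at_right_real _ tendsto_const] by metis
qed

lemma AE_zero_imp_initial_zero:
  fixes f :: "real \<Rightarrow> real"
  assumes ae: "AE t in lebesgue. 0 \<le> t \<longrightarrow> f t = 0" and c: "continuous_on {0..} f"
  shows "f 0 = 0"
proof (rule integral_zero_imp_initial_zero[OF _ c])
  fix t :: real
  show "(f has_integral 0) {0..t}"
    by (rule has_integral_spike[OF ae[unfolded AE_lebesgue_iff_negligible], of _ _ "\<lambda>_. 0"]) auto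
qed

section \<open>Shift and concatenation of piecewise continuous signals\<close>

lemma filterlim_minus_at_within:
  fixes t L :: real
  assumes "\<And>s. s \<in> S \<Longrightarrow> s - L \<in> S'"
  shows "filterlim (\<lambda>s. s - L) (at (t - L) within S') (at t within S)"
  unfolding filterlim_at
proof
  show "\<forall>\<^sub>F s in at t within S. s - L \<in> S' \<and> s - L \<noteq> t - L"
    using assms by (auto simp: eventually_at_filter)
  show "((\<lambda>s. s - L) \<longlongrightarrow> t - L) (at t within S)" by (intro tendsto_intros)
qed

text \<open>Discontinuities of the concatenation come from f, from the shifted g, or from the switch
  at L. Near any other point, and on each side of L, it coincides with one of the two
  pieces.\<close>

lemma pw_continuous_cat:
  fixes f g :: "real \<Rightarrow> 'a::topological_space"
  assumes f: "pw_continuous f" and g: "pw_continuous g" and L: "0 \<le> L"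
  shows "pw_continuous (cat L f g)"
proof -
  have left: "(cat L f g \<longlongrightarrow> l) (at t within S) \<longleftrightarrow> (f \<longlongrightarrow> l) (at t within S)" if tL: "t < L" for l t S
  proof (rule tendsto_cong)
    have "\<forall>\<^sub>F s in at t within S. s < L" using tL by (intro order_tendstoD(2)[OF tendsto_ident_at])
    then show "\<forall>\<^sub>F s in at t within S. cat L f g s = f s" by eventually_elim (simp add: cat_def)
  qed
  have left': "(cat L f g \<longlongrightarrow> l) (at_left t) \<longleftrightarrow> (f \<longlongrightarrow> l) (at_left t)" if tL: "t \<le> L" for l t
    by (rule tendsto_cong) (use tL in \<open>auto simp: eventually_at_filter cat_def\<close>)
  have right: "(cat L f g \<longlongrightarrow> l) (at t within S) \<longleftrightarrow> ((\<lambda>s. g (s - L)) \<longlongrightarrow> l) (at t within S)" if tL: "t > L" for l t S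
  proof (rule tendsto_cong)
    have "\<forall>\<^sub>F s in at t within S. s > L" using tL by (intro order_tendstoD(1)[OF tendsto_ident_at])
    then show "\<forall>\<^sub>F s in at t within S. cat L f g s = g (s - L)" by eventually_elim (simp add: cat_def)
  qed
  have right': "(cat L f g \<longlongrightarrow> l) (at_right t) \<longleftrightarrow> ((\<lambda>s. g (s - L)) \<longlongrightarrow> l) (at_right t)" if tL: "t \<ge> L" for l t
    by (rule tendsto_cong) (use tL in \<open>auto simp: eventually_at_filter cat_def\<close>)
  have sh: "((\<lambda>s. g (s - L)) \<longlongrightarrow> l) (at t within S)" if "(g \<longlongrightarrow> l) (at (t - L) within S')" "\<And>s. s \<in> S \<Longrightarrow> s - L \<in> S'" for l t S S'
    using filterlim_compose[OF that(1) filterlim_minus_at_within[OF that(2)]] .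
  have "finite {t \<in> {0..T}. \<not> continuous (at t within {0..}) (cat L f g)}" if T: "T \<ge> 0" for T
  proof (rule finite_subset)
    let ?F = "{t \<in> {0..T}. \<not> continuous (at t within {0..}) f}" and ?G = "{t \<in> {0..T}. \<not> continuous (at t within {0..}) g}"
    show "finite (?F \<union> {L} \<union> (\<lambda>s. s + L) ` ?G)" using f g T by (simp add: pw_continuous_def)
    show "{t \<in> {0..T}. \<not> continuous (at t within {0..}) (cat L f g)} \<subseteq> ?F \<union> {L} \<union> (\<lambda>s. s + L) ` ?G"
    proof
      fix t assume "t \<in> {t \<in> {0..T}. \<not> continuous (at t within {0..}) (cat L f g)}"
      then have t: "0 \<le> t" "t \<le> T" and n: "\<not> (cat L f g \<longlongrightarrow> cat L f g t) (at t within {0..})" by (auto simp: continuous_within)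
      consider "t < L" | "t = L" | "t > L" by linarith
      then show "t \<in> ?F \<union> {L} \<union> (\<lambda>s. s + L) ` ?G"
      proof cases
        case 1
        then have "t \<in> ?F" using t n left[OF 1] by (simp add: continuous_within cat_def)
        then show ?thesis by blast
      next
        case 3
        \<comment> \<open>Beyond L all points are interior, so the closed half-line may be replaced
          by open half-lines that the shift by L maps into each other.\<close>
        have "at t within {0..} = at t" "at (t - L) within {0..} = at (t - L)"
          by (rule at_within_interior, use 3 L in simp)+
        moreover have "at t within {L<..} = at t" "at (t - L) within {0<..} = at (t - L)"
          by (rule at_within_open, use 3 in simp, simp)+
        ultimately have 0: "at t within {0..} = at t within {L<..}" "at (t - L) within {0..} = at (t - L) within {0<..}"
          by (simp_all only:)
        have "\<not> ((\<lambda>s. g (s - L)) \<longlongrightarrow> g (t - L)) (at t within {L<..})"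
          using n 3 unfolding 0(1) right[OF 3] by (simp add: cat_def)
        then have "\<not> (g \<longlongrightarrow> g (t - L)) (at (t - L) within {0<..})"
          using sh[of "g (t - L)" t "{0<..}" "{L<..}"] by (meson diff_gt_0_iff_gt greaterThan_iff)
        then have "\<not> (g \<longlongrightarrow> g (t - L)) (at (t - L) within {0..})" unfolding 0(2) .
        then have "t - L \<in> ?G" using t 3 L by (simp add: continuous_within)
        then show ?thesis by (intro UnI2 image_eqI[of _ _ "t - L"]) auto
      qed simp
    qed
  qed
  moreover have "\<exists>l. (cat L f g \<longlongrightarrow> l) (at_right t)" if t: "t \<ge> 0" for t
  proof (cases "t < L")
    case True
    then show ?thesis using f t left[OF True] by (simp add: pw_continuous_def)
  next
    case False
    then have "\<exists>l. (g \<longlongrightarrow> l) (at_right (t - L))" using g by (simp add: pw_continuous_def)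
    then obtain l where "(g \<longlongrightarrow> l) (at_right (t - L))" ..
    then have "((\<lambda>s. g (s - L)) \<longlongrightarrow> l) (at_right t)" by (rule sh) auto
    then show ?thesis using right'[of t] False by auto
  qed
  moreover have "\<exists>l. (cat L f g \<longlongrightarrow> l) (at_left t)" if t: "t > 0" for t
  proof (cases "t \<le> L")
    case True
    then show ?thesis using f t left'[OF True] by (simp add: pw_continuous_def)
  next
    case False
    then have "\<exists>l. (g \<longlongrightarrow> l) (at_left (t - L))" using g by (simp add: pw_continuous_def)
    then obtain l where "(g \<longlongrightarrow> l) (at_left (t - L))" ..
    then have "((\<lambda>s. g (s - L)) \<longlongrightarrow> l) (at_left t)" by (rule sh) auto
    then show ?thesis using right[of t] False by auto
  qed
  ultimately show ?thesis unfolding pw_continuous_def by simp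
qed

section \<open>Continuous-time state trajectories as solutions of an integral equation\<close>

lemma add_mult_mat_vec_index:
  fixes A B :: "real mat"
  assumes "A \<in> carrier_mat m n" "B \<in> carrier_mat m k" "v \<in> carrier_vec n" "w \<in> carrier_vec k" "i < m"
  shows "(A *\<^sub>v v + B *\<^sub>v w) $ i = (\<Sum>j<n. A $$ (i, j) * v $ j) + (\<Sum>j<k. B $$ (i, j) * w $ j)"
  using assms by (simp add: scalar_prod_def atLeast0LessThan)

lemma state_rhs_index:
  assumes "is_lpv_ssa S" "v \<in> carrier_vec (xdim S)" "w \<in> carrier_vec (udim S)" "i < xdim S"
  shows "state_rhs S q v w $ i = (\<Sum>j<xdim S. affine_mat (Am S) q $$ (i, j) * v $ j) +
    (\<Sum>j<udim S. affine_mat (Bm S) q $$ (i, j) * w $ j)"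
  unfolding state_rhs_def by (rule add_mult_mat_vec_index[OF lpv_carriers(1,2)[OF assms(1)] assms(2-4)])

lemma pw_continuous_affine_mat:
  fixes p :: "real \<Rightarrow> real ^ 'p::finite"
  assumes M: "\<And>i. M i \<in> carrier_mat m n" and p: "pw_continuous p" and rc: "r < m" "c < n"
  shows "pw_continuous (\<lambda>t. affine_mat M (p t) $$ (r, c))"
proof -
  have "pw_continuous (\<lambda>t. vec_nth (p t) i)" for i
    by (rule pw_continuous_map[OF p]) (intro continuous_intros)
  then show ?thesis unfolding affine_mat_index[OF M rc]
    by (intro pw_continuous_add pw_continuous_sum pw_continuous_mult pw_continuous_const)
qed

text \<open>The integral equation replaces the almost everywhere derivative because it is stable
  under linear combination, concatenation and time reversal; pieces join at L without any condition
  on derivatives.\<close>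

definition ct_ssol :: "'p::finite lpv_ssa \<Rightarrow> ((real \<Rightarrow> real Matrix.vec) \<times> (real \<Rightarrow> real Matrix.vec) \<times> (real \<Rightarrow> real ^ 'p)) set" where
  "ct_ssol S = {(x, u, p). x \<in> {0..} \<rightarrow>\<^sub>E carrier_vec (xdim S) \<and> u \<in> ct_signals (udim S) \<and> p \<in> ct_scheds (sched S) \<and>
     (\<forall>i<xdim S. \<forall>t\<ge>0. ((\<lambda>s. state_rhs S (p s) (x s) (u s) $ i) has_integral (x t $ i - x 0 $ i)) {0..t})}"

lemma ct_signalsD:
  assumes "w \<in> ct_signals m"
  shows "w \<in> {0..} \<rightarrow>\<^sub>E carrier_vec m" "0 \<le> t \<Longrightarrow> w t \<in> carrier_vec m" "i < m \<Longrightarrow> pw_continuous (\<lambda>t. w t $ i)"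
  using assms by (auto simp: ct_signals_def)

lemma ct_schedsD:
  assumes "p \<in> ct_scheds P" shows "p \<in> {0..} \<rightarrow>\<^sub>E P" "0 \<le> t \<Longrightarrow> p t \<in> P" "pw_continuous p"
  using assms by (auto simp: ct_scheds_def)

lemma ct_ssolD:
  assumes "(x, u, p) \<in> ct_ssol S"
  shows "x \<in> {0..} \<rightarrow>\<^sub>E carrier_vec (xdim S)" "u \<in> ct_signals (udim S)" "p \<in> ct_scheds (sched S)"
    "0 \<le> t \<Longrightarrow> x t \<in> carrier_vec (xdim S)"
    "i < xdim S \<Longrightarrow> 0 \<le> t \<Longrightarrow> ((\<lambda>s. state_rhs S (p s) (x s) (u s) $ i) has_integral (x t $ i - x 0 $ i)) {0..t}"
  using assms by (auto simp: ct_ssol_def)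

lemma ct_ssolI:
  assumes "x \<in> {0..} \<rightarrow>\<^sub>E carrier_vec (xdim S)" "u \<in> ct_signals (udim S)" "p \<in> ct_scheds (sched S)"
    "\<And>i t. i < xdim S \<Longrightarrow> 0 \<le> t \<Longrightarrow> ((\<lambda>s. state_rhs S (p s) (x s) (u s) $ i) has_integral (x t $ i - x 0 $ i)) {0..t}"
  shows "(x, u, p) \<in> ct_ssol S"
  using assms by (simp add: ct_ssol_def)

lemma ct_ssol_continuous:
  assumes "(x, u, p) \<in> ct_ssol S" "i < xdim S" shows "continuous_on {0..} (\<lambda>t. x t $ i)"
  using ct_ssolD(5)[OF assms] by (rule integral_form_continuous_on)

lemma pw_continuous_affine_mult_vec:
  fixes p :: "real \<Rightarrow> real ^ 'p::finite"
  assumes M: "\<And>i. M i \<in> carrier_mat m n" "\<And>i. N i \<in> carrier_mat m k"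
    and x: "\<And>t. 0 \<le> t \<Longrightarrow> x t \<in> carrier_vec n" "\<And>j. j < n \<Longrightarrow> pw_continuous (\<lambda>t. x t $ j)"
    and u: "u \<in> ct_signals k" and p: "pw_continuous p" and i: "i < m"
  shows "pw_continuous (\<lambda>t. (affine_mat M (p t) *\<^sub>v x t + affine_mat N (p t) *\<^sub>v u t) $ i)"
proof -
  note ud = ct_signalsD[OF u]
  have "pw_continuous (\<lambda>t. (\<Sum>j<n. affine_mat M (p t) $$ (i, j) * x t $ j) + (\<Sum>j<k. affine_mat N (p t) $$ (i, j) * u t $ j))"
    using x(2) ud(3) i by (intro pw_continuous_add pw_continuous_sum pw_continuous_mult
      pw_continuous_affine_mat[OF M(1) p] pw_continuous_affine_mat[OF M(2) p]) auto
  then show ?thesis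
    using add_mult_mat_vec_index[OF affine_mat_carrier[of M, OF M(1)] affine_mat_carrier[of N, OF M(2)] x(1) ud(2) i]
    by (subst pw_continuous_cong) auto
qed

lemma pw_continuous_rhs:
  assumes S: "is_lpv_ssa S" and x: "\<And>t. 0 \<le> t \<Longrightarrow> x t \<in> carrier_vec (xdim S)"
    "\<And>i. i < xdim S \<Longrightarrow> pw_continuous (\<lambda>t. x t $ i)"
    and u: "u \<in> ct_signals (udim S)" and p: "p \<in> ct_scheds P"
  shows "i < xdim S \<Longrightarrow> pw_continuous (\<lambda>t. state_rhs S (p t) (x t) (u t) $ i)"
    "i < ydim S \<Longrightarrow> pw_continuous (\<lambda>t. output_rhs S (p t) (x t) (u t) $ i)"
  unfolding state_rhs_def output_rhs_def
  by (rule pw_continuous_affine_mult_vec[OF lpv_ssaD(1,2)[OF S] x u ct_schedsD(3)[OF p]]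
    pw_continuous_affine_mult_vec[OF lpv_ssaD(3,4)[OF S] x u ct_schedsD(3)[OF p]]; assumption)+

text \<open>From derivative to integral this is the fundamental theorem for absolutely continuous
  functions. Conversely x is continuous as a primitive, so the right-hand side is piecewise
  continuous; its primitive is locally Lipschitz and differentiable wherever the right-hand side is
  continuous, that is almost everywhere.\<close>

lemma ct_solutions_iff:
  assumes S: "is_lpv_ssa S"
  shows "(x, y, u, p) \<in> ct_solutions S \<longleftrightarrow> (x, u, p) \<in> ct_ssol S \<and> y \<in> ct_signals (ydim S) \<and>
    (AE t in lebesgue. 0 \<le> t \<longrightarrow> y t = output_rhs S (p t) (x t) (u t))"
proof -
  define D where "D t i \<longleftrightarrow> ((\<lambda>s. x s $ i) has_real_derivative state_rhs S (p t) (x t) (u t) $ i) (at t within {0..})" for t i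
  have "(AE t in lebesgue. 0 \<le> t \<longrightarrow> (\<forall>i<xdim S. D t i) \<and> y t = output_rhs S (p t) (x t) (u t)) \<longleftrightarrow>
    (AE t in lebesgue. (\<forall>i\<in>{..<xdim S}. 0 \<le> t \<longrightarrow> D t i) \<and> (0 \<le> t \<longrightarrow> y t = output_rhs S (p t) (x t) (u t)))"
    by (rule arg_cong2[where f = almost_everywhere], rule refl) (auto simp: fun_eq_iff)
  also have "\<dots> \<longleftrightarrow> (\<forall>i<xdim S. AE t in lebesgue. 0 \<le> t \<longrightarrow> D t i) \<and>
      (AE t in lebesgue. 0 \<le> t \<longrightarrow> y t = output_rhs S (p t) (x t) (u t))"
    by (subst AE_conj_iff, subst AE_finite_all) auto
  finally have ae: "(AE t in lebesgue. 0 \<le> t \<longrightarrow> (\<forall>i<xdim S. D t i) \<and> y t = output_rhs S (p t) (x t) (u t)) \<longleftrightarrow>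
    (\<forall>i<xdim S. AE t in lebesgue. 0 \<le> t \<longrightarrow> D t i) \<and> (AE t in lebesgue. 0 \<le> t \<longrightarrow> y t = output_rhs S (p t) (x t) (u t))" .
  have eq: "x \<in> ct_states (xdim S) \<and> (\<forall>i<xdim S. AE t in lebesgue. 0 \<le> t \<longrightarrow> D t i) \<longleftrightarrow>
    x \<in> {0..} \<rightarrow>\<^sub>E carrier_vec (xdim S) \<and>
     (\<forall>i<xdim S. \<forall>t\<ge>0. ((\<lambda>s. state_rhs S (p s) (x s) (u s) $ i) has_integral (x t $ i - x 0 $ i)) {0..t})"
    if u: "u \<in> ct_signals (udim S)" and p: "p \<in> ct_scheds (sched S)"
  proof (intro iffI conjI allI impI)
    assume "x \<in> ct_states (xdim S) \<and> (\<forall>i<xdim S. AE t in lebesgue. 0 \<le> t \<longrightarrow> D t i)"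
    then have x: "x \<in> {0..} \<rightarrow>\<^sub>E carrier_vec (xdim S)" "\<And>i. i < xdim S \<Longrightarrow> loc_abs_continuous (\<lambda>t. x t $ i)"
      "\<And>i. i < xdim S \<Longrightarrow> AE t in lebesgue. 0 \<le> t \<longrightarrow> D t i" by (auto simp: ct_states_def)
    show "x \<in> {0..} \<rightarrow>\<^sub>E carrier_vec (xdim S)" by (rule x(1))
    fix i and t :: real assume "i < xdim S" "0 \<le> t"
    then show "((\<lambda>s. state_rhs S (p s) (x s) (u s) $ i) has_integral (x t $ i - x 0 $ i)) {0..t}"
      using x(3) unfolding D_def by (intro has_integral_abs_continuous[OF x(2)]) auto
  next
    assume "x \<in> {0..} \<rightarrow>\<^sub>E carrier_vec (xdim S) \<and>
     (\<forall>i<xdim S. \<forall>t\<ge>0. ((\<lambda>s. state_rhs S (p s) (x s) (u s) $ i) has_integral (x t $ i - x 0 $ i)) {0..t})"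
    then have x: "x \<in> {0..} \<rightarrow>\<^sub>E carrier_vec (xdim S)"
      and int: "\<And>i t. i < xdim S \<Longrightarrow> 0 \<le> t \<Longrightarrow> ((\<lambda>s. state_rhs S (p s) (x s) (u s) $ i) has_integral (x t $ i - x 0 $ i)) {0..t}" by auto
    have pw: "pw_continuous (\<lambda>t. state_rhs S (p t) (x t) (u t) $ i)" if "i < xdim S" for i
      by (rule pw_continuous_rhs(1)[OF S _ _ u p that])
        (use x in \<open>auto intro!: pw_continuous_continuous_on integral_form_continuous_on int\<close>)
    show "x \<in> ct_states (xdim S)"
      unfolding ct_states_def using x integral_form_loc_abs_continuous[OF int pw] by blast
    fix i assume i: "i < xdim S"
    show "AE t in lebesgue. 0 \<le> t \<longrightarrow> D t i"
      using pw_continuous_AE_continuous[OF pw[OF i]]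
      by eventually_elim (auto simp: D_def intro!: integral_form_has_derivative int i)
  qed
  have "(x, y, u, p) \<in> ct_solutions S \<longleftrightarrow> y \<in> ct_signals (ydim S) \<and> u \<in> ct_signals (udim S) \<and> p \<in> ct_scheds (sched S) \<and>
    (x \<in> ct_states (xdim S) \<and> (\<forall>i<xdim S. AE t in lebesgue. 0 \<le> t \<longrightarrow> D t i)) \<and>
    (AE t in lebesgue. 0 \<le> t \<longrightarrow> y t = output_rhs S (p t) (x t) (u t))"
    unfolding ct_solutions_def using ae[unfolded D_def] unfolding D_def by auto
  also have "\<dots> \<longleftrightarrow> (x, u, p) \<in> ct_ssol S \<and> y \<in> ct_signals (ydim S) \<and>
    (AE t in lebesgue. 0 \<le> t \<longrightarrow> y t = output_rhs S (p t) (x t) (u t))"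
  proof -
    have c: "(x, u, p) \<in> ct_ssol S \<longleftrightarrow> u \<in> ct_signals (udim S) \<and> p \<in> ct_scheds (sched S) \<and>
      (x \<in> {0..} \<rightarrow>\<^sub>E carrier_vec (xdim S) \<and>
       (\<forall>i<xdim S. \<forall>t\<ge>0. ((\<lambda>s. state_rhs S (p s) (x s) (u s) $ i) has_integral (x t $ i - x 0 $ i)) {0..t}))"
      unfolding ct_ssol_def by blast
    show ?thesis
    \<comment> \<open>\<open>eq\<close> needs admissible signals; without them both sides
      fail.\<close>
    proof (cases "u \<in> ct_signals (udim S) \<and> p \<in> ct_scheds (sched S)")
      case True
      show ?thesis unfolding c eq[OF True[THEN conjunct1] True[THEN conjunct2]] using True by argo
    next
      case False
      then show ?thesis unfolding c by argo
    qed
  qed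
  finally show ?thesis .
qed

lemma ct_signals_const:
  assumes "v \<in> carrier_vec m" shows "const v \<in> ct_signals m"
proof -
  have "pw_continuous (\<lambda>t. const v t $ i)" for i
    by (subst pw_continuous_cong[of _ "\<lambda>_. v $ i"]) (auto simp: pw_continuous_const)
  then show ?thesis using assms by (simp add: ct_signals_def)
qed

lemma ct_scheds_const:
  assumes "q \<in> P" shows "const q \<in> ct_scheds P"
proof -
  have "pw_continuous (const q :: real \<Rightarrow> _)"
    by (subst pw_continuous_cong[of _ "\<lambda>_. q"]) (auto simp: pw_continuous_const)
  then show ?thesis using assms by (simp add: ct_scheds_def)
qed

lemma cat_PiE:
  fixes L :: real
  assumes "0 \<le> L" "f \<in> {0..} \<rightarrow>\<^sub>E A" "g \<in> {0..} \<rightarrow>\<^sub>E A" shows "cat L f g \<in> {0..} \<rightarrow>\<^sub>E A"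
  using assms by (auto simp: cat_def PiE_def Pi_def extensional_def)

lemma ct_signals_cat:
  assumes L: "0 \<le> L" and w: "w \<in> ct_signals m" "w' \<in> ct_signals m" shows "cat L w w' \<in> ct_signals m"
proof -
  have "(\<lambda>t. cat L w w' t $ i) = cat L (\<lambda>t. w t $ i) (\<lambda>t. w' t $ i)" for i by (auto simp: cat_def)
  then show ?thesis
    using cat_PiE[OF L ct_signalsD(1)[OF w(1)] ct_signalsD(1)[OF w(2)]] pw_continuous_cat[OF ct_signalsD(3)[OF w(1)] ct_signalsD(3)[OF w(2)] L]
    by (simp add: ct_signals_def)
qed

lemma ct_scheds_cat:
  assumes L: "0 \<le> L" and w: "w \<in> ct_scheds P" "w' \<in> ct_scheds P" shows "cat L w w' \<in> ct_scheds P"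
  using cat_PiE[OF L ct_schedsD(1)[OF w(1)] ct_schedsD(1)[OF w(2)]] pw_continuous_cat[OF ct_schedsD(3)[OF w(1)] ct_schedsD(3)[OF w(2)] L]
  by (simp add: ct_scheds_def)

lemma ct_output_signals:
  assumes S: "is_lpv_ssa S" and x: "(x, u, p) \<in> ct_ssol S"
  shows "(\<lambda>t\<in>{0..}. output_rhs S (p t) (x t) (u t)) \<in> ct_signals (ydim S)"
proof -
  note d = ct_ssolD[OF x]
  have "pw_continuous (\<lambda>t. output_rhs S (p t) (x t) (u t) $ i)" if "i < ydim S" for i
    by (rule pw_continuous_rhs(2)[OF S d(4) pw_continuous_continuous_on[OF ct_ssol_continuous[OF x]] d(2,3) that])
  moreover have "pw_continuous (\<lambda>t. (\<lambda>t\<in>{0..}. output_rhs S (p t) (x t) (u t)) t $ i) \<longleftrightarrow> pw_continuous (\<lambda>t. output_rhs S (p t) (x t) (u t) $ i)" for i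
    by (rule pw_continuous_cong) simp
  ultimately show ?thesis using output_rhs_carrier[OF S] by (simp add: ct_signals_def)
qed

lemma finite_family_bounded:
  fixes a :: "'i \<Rightarrow> real \<Rightarrow> real"
  assumes "finite I" "\<And>i. i \<in> I \<Longrightarrow> pw_continuous (a i)"
  shows "\<exists>K\<ge>0. \<forall>i\<in>I. \<forall>t\<in>{0..T}. \<bar>a i t\<bar> \<le> K"
  using assms
proof (induction I rule: finite_induct)
  case (insert i I)
  then obtain K where K: "K \<ge> 0" "\<forall>i\<in>I. \<forall>t\<in>{0..T}. \<bar>a i t\<bar> \<le> K" by auto
  obtain K' where "K' > 0" "\<forall>t\<in>{0..T}. \<bar>a i t\<bar> \<le> K'" using pw_continuous_bounded[of "a i" T] insert by auto
  then show ?case using K by (intro exI[of _ "max K K'"]) (auto simp: le_max_iff_disj)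
qed auto

lemma ct_coefficients_bounded:
  assumes S: "is_lpv_ssa S" and p: "p \<in> ct_scheds P"
  shows "\<exists>K\<ge>0. \<forall>i<xdim S. \<forall>j<xdim S. \<forall>t\<in>{0..T}. \<bar>affine_mat (Am S) (p t) $$ (i, j)\<bar> \<le> K"
proof -
  have "\<exists>K\<ge>0. \<forall>ij\<in>{..<xdim S} \<times> {..<xdim S}. \<forall>t\<in>{0..T}. \<bar>affine_mat (Am S) (p t) $$ ij\<bar> \<le> K"
    by (rule finite_family_bounded) (auto intro!: pw_continuous_affine_mat[OF lpv_ssaD(1)[OF S] ct_schedsD(3)[OF p]])
  then show ?thesis by fastforce
qed

lemma ct_ssol_exists:
  assumes S: "is_lpv_ssa S" and x0: "x0 \<in> carrier_vec (xdim S)" and u: "u \<in> ct_signals (udim S)" and p: "p \<in> ct_scheds (sched S)"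
  shows "\<exists>x. (x, u, p) \<in> ct_ssol S \<and> x 0 = x0"
proof -
  note c = lpv_ssaD[OF S] and ud = ct_signalsD[OF u] and pd = ct_schedsD[OF p]
  have a: "pw_continuous (\<lambda>t. affine_mat (Am S) (p t) $$ (i, j))" if "i < xdim S" "j < xdim S" for i j
    by (rule pw_continuous_affine_mat[OF c(1) pd(3) that])
  have b: "pw_continuous (\<lambda>t. \<Sum>j<udim S. affine_mat (Bm S) (p t) $$ (i, j) * u t $ j)" if "i < xdim S" for i
    using that by (intro pw_continuous_sum pw_continuous_mult pw_continuous_affine_mat[OF c(2) pd(3)] ud(3)) auto
  obtain X where "\<forall>i<xdim S. \<forall>t\<ge>0. ((\<lambda>s. (\<Sum>j<xdim S. affine_mat (Am S) (p s) $$ (i, j) * X j s) +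
      (\<Sum>j<udim S. affine_mat (Bm S) (p s) $$ (i, j) * u s $ j)) has_integral (X i t - x0 $ i)) {0..t}"
    using picard_existence[OF a b, where \<xi> = "\<lambda>i. x0 $ i"] ..
  then have X: "((\<lambda>s. (\<Sum>j<xdim S. affine_mat (Am S) (p s) $$ (i, j) * X j s) +
      (\<Sum>j<udim S. affine_mat (Bm S) (p s) $$ (i, j) * u s $ j)) has_integral (X i t - x0 $ i)) {0..t}"
    if "i < xdim S" "0 \<le> t" for i t using that by blast
  define x where "x = (\<lambda>t\<in>{0..}. Matrix.vec (xdim S) (\<lambda>i. X i t))"
  have xX: "x t $ i = X i t" if "0 \<le> t" "i < xdim S" for t i using that by (simp add: x_def)
  have xc: "x t \<in> carrier_vec (xdim S)" if "0 \<le> t" for t using that by (simp add: x_def)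
  \<comment> \<open>The integral over a single point vanishes, which fixes the initial value of the
    Picard limit.\<close>
  have X0: "X i 0 = x0 $ i" if "i < xdim S" for i
    using has_integral_unique[OF X[OF that order_refl, unfolded atLeastAtMost_singleton] has_integral_refl(2)] by simp
  have "x 0 = x0" using x0 xc[of 0] by (intro eq_vecI) (auto simp: xX X0)
  moreover have "(x, u, p) \<in> ct_ssol S"
  proof (rule ct_ssolI[OF _ u p])
    show "x \<in> {0..} \<rightarrow>\<^sub>E carrier_vec (xdim S)" by (auto simp: x_def)
    fix i and t :: real assume i: "i < xdim S" and t: "0 \<le> t"
    show "((\<lambda>s. state_rhs S (p s) (x s) (u s) $ i) has_integral (x t $ i - x 0 $ i)) {0..t}"
      using X[OF i t] unfolding xX[OF t i] xX[OF order_refl i] X0[OF i]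
      by (rule has_integral_eq[rotated]) (simp add: state_rhs_index[OF S xc ud(2) i] xX)
  qed
  ultimately show ?thesis by blast
qed

lemma ct_ssol_lincomb:
  assumes S: "is_lpv_ssa S" and x: "(x, u, p) \<in> ct_ssol S" and x': "(x', u', p) \<in> ct_ssol S"
  shows "(lincomb x a x', lincomb u a u', p) \<in> ct_ssol S"
proof (rule ct_ssolI)
  note d = ct_ssolD[OF x] and d' = ct_ssolD[OF x']
  note ud = ct_signalsD[OF d(2)] and ud' = ct_signalsD[OF d'(2)]
  show "lincomb x a x' \<in> {0..} \<rightarrow>\<^sub>E carrier_vec (xdim S)" using d(4) d'(4) by auto
  show "p \<in> ct_scheds (sched S)" by (rule d(3))
  have "pw_continuous (\<lambda>t. lincomb u a u' t $ i)" if i: "i < udim S" for i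
  proof -
    have "pw_continuous (\<lambda>t. u t $ i + a * u' t $ i)"
      by (intro pw_continuous_add pw_continuous_mult pw_continuous_const ud(3)[OF i] ud'(3)[OF i])
    moreover have "pw_continuous (\<lambda>t. lincomb u a u' t $ i) \<longleftrightarrow> pw_continuous (\<lambda>t. u t $ i + a * u' t $ i)"
      by (rule pw_continuous_cong) (simp add: i carrier_vecD[OF ud'(2)])
    ultimately show ?thesis by simp
  qed
  then show "lincomb u a u' \<in> ct_signals (udim S)" using ud(2) ud'(2) by (auto simp: ct_signals_def)
  fix i and t :: real assume i: "i < xdim S" and t: "0 \<le> t"
  have h1: "((\<lambda>s. state_rhs S (p s) (x s) (u s) $ i + a * state_rhs S (p s) (x' s) (u' s) $ i) has_integral
      ((x t $ i - x 0 $ i) + a * (x' t $ i - x' 0 $ i))) {0..t}"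
    by (intro has_integral_add has_integral_mult_right d(5) d'(5) i t)
  have h2: "lincomb x a x' t $ i - lincomb x a x' 0 $ i = (x t $ i - x 0 $ i) + a * (x' t $ i - x' 0 $ i)"
    using i t by (simp add: carrier_vecD[OF d'(4)] algebra_simps)
  have h3: "state_rhs S (p s) (lincomb x a x' s) (lincomb u a u' s) $ i =
      state_rhs S (p s) (x s) (u s) $ i + a * state_rhs S (p s) (x' s) (u' s) $ i" if s: "s \<in> {0..t}" for s
  proof -
    have s0: "0 \<le> s" using s by simp
    show ?thesis using s0 i carrier_vecD[OF state_rhs_carrier[OF S]]
      by (simp add: state_rhs_lincomb[OF S d(4)[OF s0] d'(4)[OF s0] ud(2)[OF s0] ud'(2)[OF s0]])
  qed
  show "((\<lambda>s. state_rhs S (p s) (lincomb x a x' s) (lincomb u a u' s) $ i) has_integral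
      (lincomb x a x' t $ i - lincomb x a x' 0 $ i)) {0..t}"
    unfolding h2 by (rule has_integral_eq[OF _ h1]) (rule h3[symmetric])
qed

text \<open>In the difference of two solutions the input terms cancel, which leaves a homogeneous
  integral equation with the coefficients A(p).\<close>

lemma ct_ssol_unique:
  assumes S: "is_lpv_ssa S" and x: "(x, u, p) \<in> ct_ssol S" and x': "(x', u, p) \<in> ct_ssol S" and 0: "x 0 = x' 0"
  shows "x = x'"
proof
  fix t
  note d = ct_ssolD[OF x] and d' = ct_ssolD[OF x']
  note ud = ct_signalsD[OF d(2)]
  show "x t = x' t"
  proof (cases "0 \<le> t")
    case True
    obtain K where K: "K \<ge> 0" "\<And>i j s. i < xdim S \<Longrightarrow> j < xdim S \<Longrightarrow> s \<in> {0..t} \<Longrightarrow> \<bar>affine_mat (Am S) (p s) $$ (i, j)\<bar> \<le> K"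
      using ct_coefficients_bounded[OF S d(3), of t] by blast
    have "x t $ i - x' t $ i = 0" if i: "i < xdim S" for i
    proof (rule linear_integral_equation_zero[where a = "\<lambda>i j s. affine_mat (Am S) (p s) $$ (i, j)" and d = "\<lambda>i s. x s $ i - x' s $ i" and T = t and K = K])
      fix i s assume i: "i < xdim S" and s: "s \<in> {0..t}"
      then have s0: "0 \<le> s" by simp
      have "((\<lambda>r. state_rhs S (p r) (x r) (u r) $ i - state_rhs S (p r) (x' r) (u r) $ i) has_integral
          ((x s $ i - x 0 $ i) - (x' s $ i - x' 0 $ i))) {0..s}"
        by (intro has_integral_diff d(5) d'(5) i s0)
      then show "((\<lambda>r. \<Sum>j<xdim S. affine_mat (Am S) (p r) $$ (i, j) * (x r $ j - x' r $ j)) has_integral (x s $ i - x' s $ i)) {0..s}"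
        unfolding 0 by (simp, elim has_integral_eq[rotated])
          (simp add: state_rhs_index[OF S d(4) ud(2) i] state_rhs_index[OF S d'(4) ud(2) i] right_diff_distrib sum_subtractf)
    qed (use K i True in auto)
    then show ?thesis using d(4)[OF True] d'(4)[OF True] by (intro eq_vecI) auto
  next
    case False
    then show ?thesis using d(1) d'(1) by (auto simp: PiE_def extensional_def)
  qed
qed

lemma ct_ssol_cat:
  assumes S: "is_lpv_ssa S" and x: "(x, u, p) \<in> ct_ssol S" and x': "(x', u', p') \<in> ct_ssol S" and L: "0 \<le> L" and eq: "x L = x' 0"
  shows "(cat L x x', cat L u u', cat L p p') \<in> ct_ssol S"
proof (rule ct_ssolI)
  note d = ct_ssolD[OF x] and d' = ct_ssolD[OF x']
  show "cat L x x' \<in> {0..} \<rightarrow>\<^sub>E carrier_vec (xdim S)" by (rule cat_PiE[OF L d(1) d'(1)])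
  show "cat L u u' \<in> ct_signals (udim S)" by (rule ct_signals_cat[OF L d(2) d'(2)])
  show "cat L p p' \<in> ct_scheds (sched S)" by (rule ct_scheds_cat[OF L d(3) d'(3)])
  fix i and t :: real assume i: "i < xdim S" and t: "0 \<le> t"
  let ?f = "\<lambda>s. state_rhs S (cat L p p' s) (cat L x x' s) (cat L u u' s) $ i"
  have c0: "cat L x x' 0 = x 0" using L eq by (cases "L = 0") (auto simp: cat_def)
  \<comment> \<open>At the single time L the concatenated signals already take their new values; one
    point does not affect the integral.\<close>
  have first: "(?f has_integral (x s $ i - x 0 $ i)) {0..s}" if s: "0 \<le> s" "s \<le> L" for s
    by (rule has_integral_spike_finite[OF _ _ d(5)[OF i s(1)], of "{L}"]) (use s in \<open>auto simp: cat_def\<close>)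
  show "(?f has_integral (cat L x x' t $ i - cat L x x' 0 $ i)) {0..t}"
  proof (cases "t < L")
    case True
    then show ?thesis using first[OF t] c0 by (simp add: cat_def)
  next
    case False
    have "((\<lambda>s. state_rhs S (p' (s - L)) (x' (s - L)) (u' (s - L)) $ i) has_integral (x' (t - L) $ i - x' 0 $ i)) {L..t}"
      using has_integral_shift_real_ivl[OF d'(5)[OF i, of "t - L"], of "- L"] False by simp
    then have "(?f has_integral (x' (t - L) $ i - x' 0 $ i)) {L..t}"
      by (rule has_integral_eq[rotated]) (simp add: cat_def)
    then have "(?f has_integral ((x L $ i - x 0 $ i) + (x' (t - L) $ i - x' 0 $ i))) {0..t}"
      using False by (intro has_integral_combine[OF L _ first[OF L order_refl]]) auto
    then show ?thesis using False c0 eq by (simp add: cat_def)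
  qed
qed

lemma ct_ssol_image:
  assumes si: "same_interface S S'" and Q: "Q \<in> carrier_mat (xdim S') (xdim S)"
    and st: "\<And>q v w. q \<in> sched S \<Longrightarrow> v \<in> carrier_vec (xdim S) \<Longrightarrow> w \<in> carrier_vec (udim S) \<Longrightarrow>
        state_rhs S' q (Q *\<^sub>v v) w = Q *\<^sub>v state_rhs S q v w"
    and x: "(x, u, p) \<in> ct_ssol S"
  shows "(\<lambda>t\<in>{0..}. Q *\<^sub>v x t, u, p) \<in> ct_ssol S'"
proof (rule ct_ssolI)
  note d = ct_ssolD[OF x]
  have S: "is_lpv_ssa S" and e: "sched S' = sched S" "udim S' = udim S" using si by (auto simp: same_interface_def)
  show "u \<in> ct_signals (udim S')" "p \<in> ct_scheds (sched S')" using d e by auto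
  show "(\<lambda>t\<in>{0..}. Q *\<^sub>v x t) \<in> {0..} \<rightarrow>\<^sub>E carrier_vec (xdim S')" using Q d(4) by auto
  fix i and t :: real assume i: "i < xdim S'" and t: "0 \<le> t"
  have idx: "(Q *\<^sub>v v) $ i = (\<Sum>j<xdim S. Q $$ (i, j) * v $ j)" if "v \<in> carrier_vec (xdim S)" for v
    using Q i that by (simp add: scalar_prod_def atLeast0LessThan)
  have h1: "((\<lambda>s. \<Sum>j<xdim S. Q $$ (i, j) * state_rhs S (p s) (x s) (u s) $ j) has_integral
      (\<Sum>j<xdim S. Q $$ (i, j) * (x t $ j - x 0 $ j))) {0..t}"
    by (intro has_integral_sum has_integral_mult_right d(5) t) auto
  have h2: "(\<lambda>t\<in>{0..}. Q *\<^sub>v x t) t $ i - (\<lambda>t\<in>{0..}. Q *\<^sub>v x t) 0 $ i = (\<Sum>j<xdim S. Q $$ (i, j) * (x t $ j - x 0 $ j))"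
    using t idx[OF d(4)[OF t]] idx[OF d(4)[of 0]] by (simp add: right_diff_distrib sum_subtractf)
  have h3: "state_rhs S' (p s) ((\<lambda>t\<in>{0..}. Q *\<^sub>v x t) s) (u s) $ i = (\<Sum>j<xdim S. Q $$ (i, j) * state_rhs S (p s) (x s) (u s) $ j)"
    if "s \<in> {0..t}" for s
    using that st[OF ct_schedsD(2)[OF d(3)] d(4) ct_signalsD(2)[OF d(2)], of s s s] idx[OF state_rhs_carrier[OF S]] by simp
  show "((\<lambda>s. state_rhs S' (p s) ((\<lambda>t\<in>{0..}. Q *\<^sub>v x t) s) (u s) $ i) has_integral
      ((\<lambda>t\<in>{0..}. Q *\<^sub>v x t) t $ i - (\<lambda>t\<in>{0..}. Q *\<^sub>v x t) 0 $ i)) {0..t}"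
    unfolding h2 by (rule has_integral_eq[OF _ h1]) (rule h3[symmetric])
qed

section \<open>The infinitesimal step and time reversal\<close>

lemma continuous_on_add_mult_mat_vec:
  fixes A B :: "real mat"
  assumes A: "A \<in> carrier_mat m n" "B \<in> carrier_mat m k"
    and x: "\<And>t. 0 \<le> t \<Longrightarrow> x t \<in> carrier_vec n" "\<And>j. j < n \<Longrightarrow> continuous_on {0..} (\<lambda>t. x t $ j)"
    and v: "v \<in> carrier_vec k" and i: "i < m"
  shows "continuous_on {0::real..} (\<lambda>t. (A *\<^sub>v x t + B *\<^sub>v v) $ i)"
proof -
  have "continuous_on {0..} (\<lambda>t. (\<Sum>j<n. A $$ (i, j) * x t $ j) + (\<Sum>j<k. B $$ (i, j) * v $ j))"
    by (intro continuous_intros x(2)) auto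
  then show ?thesis by (rule continuous_on_eq) (simp only: add_mult_mat_vec_index[OF A x(1) v i] atLeast_iff)
qed

lemma continuous_on_rhs_const:
  assumes S: "is_lpv_ssa S" and x: "(x, const v, const q) \<in> ct_ssol S"
  shows "i < xdim S \<Longrightarrow> continuous_on {0..} (\<lambda>t. state_rhs S q (x t) v $ i)"
    "i < ydim S \<Longrightarrow> continuous_on {0..} (\<lambda>t. output_rhs S q (x t) v $ i)"
proof -
  have v: "v \<in> carrier_vec (udim S)" using ct_signalsD(2)[OF ct_ssolD(2)[OF x], of 0] by simp
  note l = lpv_carriers[OF S] and xd = ct_ssolD(4)[OF x] ct_ssol_continuous[OF x]
  show "i < xdim S \<Longrightarrow> continuous_on {0..} (\<lambda>t. state_rhs S q (x t) v $ i)"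
    unfolding state_rhs_def by (rule continuous_on_add_mult_mat_vec[OF l(1,2) xd v])
  show "i < ydim S \<Longrightarrow> continuous_on {0..} (\<lambda>t. output_rhs S q (x t) v $ i)"
    unfolding output_rhs_def by (rule continuous_on_add_mult_mat_vec[OF l(3,4) xd v])
qed

text \<open>Under constant signals the functional of the right-hand sides is continuous in time, and
  its integrals over all [0,t] vanish, so it is zero at time 0.\<close>

lemma ct_generator:
  assumes si: "same_interface S S'" and x: "(x, const v, const q) \<in> ct_ssol S" and x': "(x', const v, const q) \<in> ct_ssol S'"
    and c: "c \<in> carrier_vec (xdim S)" "c' \<in> carrier_vec (xdim S')"
    and z: "\<And>t. 0 \<le> t \<Longrightarrow> c \<bullet> x t + c' \<bullet> x' t = 0"
  shows "c \<bullet> state_rhs S q (x 0) v + c' \<bullet> state_rhs S' q (x' 0) v = 0"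
proof -
  have S: "is_lpv_ssa S" and S': "is_lpv_ssa S'" using si by (auto simp: same_interface_def)
  note d = ct_ssolD[OF x] and d' = ct_ssolD[OF x']
  have sp: "c \<bullet> w = (\<Sum>j<xdim S. c $ j * w $ j)" if "w \<in> carrier_vec (xdim S)" for w
    using that by (simp add: scalar_prod_def atLeast0LessThan)
  have sp': "c' \<bullet> w = (\<Sum>j<xdim S'. c' $ j * w $ j)" if "w \<in> carrier_vec (xdim S')" for w
    using that by (simp add: scalar_prod_def atLeast0LessThan)
  define f where "f s = (\<Sum>j<xdim S. c $ j * state_rhs S q (x s) v $ j) + (\<Sum>j<xdim S'. c' $ j * state_rhs S' q (x' s) v $ j)" for s
  have "f 0 = 0"
  proof (rule integral_zero_imp_initial_zero)
    show "continuous_on {0..} f" unfolding f_def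
      by (intro continuous_intros continuous_on_rhs_const(1)[OF S x] continuous_on_rhs_const(1)[OF S' x']) auto
    fix t :: real assume t: "0 \<le> t"
    have "((\<lambda>s. (\<Sum>j<xdim S. c $ j * state_rhs S (const q s) (x s) (const v s) $ j) + (\<Sum>j<xdim S'. c' $ j * state_rhs S' (const q s) (x' s) (const v s) $ j))
      has_integral ((\<Sum>j<xdim S. c $ j * (x t $ j - x 0 $ j)) + (\<Sum>j<xdim S'. c' $ j * (x' t $ j - x' 0 $ j)))) {0..t}"
      by (intro has_integral_add has_integral_sum has_integral_mult_right d(5) d'(5) t) auto
    moreover have "(\<Sum>j<xdim S. c $ j * (x t $ j - x 0 $ j)) + (\<Sum>j<xdim S'. c' $ j * (x' t $ j - x' 0 $ j)) = 0"
      using z[OF t] z[of 0] sp[OF d(4)[OF t]] sp[OF d(4)[of 0]] sp'[OF d'(4)[OF t]] sp'[OF d'(4)[of 0]]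
      by (simp add: right_diff_distrib sum_subtractf)
    ultimately have "((\<lambda>s. (\<Sum>j<xdim S. c $ j * state_rhs S (const q s) (x s) (const v s) $ j) + (\<Sum>j<xdim S'. c' $ j * state_rhs S' (const q s) (x' s) (const v s) $ j))
      has_integral 0) {0..t}" by simp
    then show "(f has_integral 0) {0..t}" by (rule has_integral_eq[rotated]) (simp add: f_def)
  qed
  then show ?thesis unfolding f_def using sp[OF state_rhs_carrier[OF S]] sp'[OF state_rhs_carrier[OF S']] by simp
qed

text \<open>The point 0 is itself a null set; it is continuity of the outputs under constant signals
  that carries almost everywhere equality over to it.\<close>

lemma ct_initial_output:
  assumes si: "same_interface S S'" and x: "(x, const v, const q) \<in> ct_ssol S" and x': "(x', const v, const q) \<in> ct_ssol S'"
    and ae: "AE t in lebesgue. 0 \<le> t \<longrightarrow> output_rhs S q (x t) v = output_rhs S' q (x' t) v"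
  shows "output_rhs S q (x 0) v = output_rhs S' q (x' 0) v"
proof -
  have S: "is_lpv_ssa S" and S': "is_lpv_ssa S'" and e: "ydim S' = ydim S" using si by (auto simp: same_interface_def)
  have "output_rhs S q (x 0) v $ i - output_rhs S' q (x' 0) v $ i = 0" if i: "i < ydim S" for i
  proof (rule AE_zero_imp_initial_zero)
    show "AE t in lebesgue. 0 \<le> t \<longrightarrow> output_rhs S q (x t) v $ i - output_rhs S' q (x' t) v $ i = 0"
      using ae by eventually_elim simp
    show "continuous_on {0..} (\<lambda>t. output_rhs S q (x t) v $ i - output_rhs S' q (x' t) v $ i)"
      using i e by (intro continuous_intros continuous_on_rhs_const(2)[OF S x] continuous_on_rhs_const(2)[OF S' x']) auto
  qed
  then show ?thesis using output_rhs_carrier[OF S, of q "x 0" v] output_rhs_carrier[OF S', of q "x' 0" v] e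
    by (intro eq_vecI) auto
qed

text \<open>The reversed trajectory s \<mapsto> x (L - s) starts at zero and solves a homogeneous
  linear integral equation with coefficients -A, so it vanishes up to s = L.\<close>

lemma ct_backward_unique:
  assumes S: "is_lpv_ssa S" and x: "(x, zero_input S, p) \<in> ct_ssol S" and L: "0 \<le> L" and xL: "x L = 0\<^sub>v (xdim S)"
  shows "x 0 = 0\<^sub>v (xdim S)"
proof -
  note d = ct_ssolD[OF x]
  let ?f = "\<lambda>i s. state_rhs S (p s) (x s) (zero_input S s) $ i"
  obtain K where K: "K \<ge> 0" "\<And>i j s. i < xdim S \<Longrightarrow> j < xdim S \<Longrightarrow> s \<in> {0..L} \<Longrightarrow> \<bar>affine_mat (Am S) (p s) $$ (i, j)\<bar> \<le> K"
    using ct_coefficients_bounded[OF S d(3), of L] by blast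
  have "x (L - L) $ i = 0" if i: "i < xdim S" for i
  proof (rule linear_integral_equation_zero[where a = "\<lambda>i j s. - affine_mat (Am S) (p (L - s)) $$ (i, j)" and d = "\<lambda>i s. x (L - s) $ i" and T = L and K = K])
    fix i t assume i: "i < xdim S" and t: "t \<in> {0..L}"
    \<comment> \<open>Since x L = 0, the increment of x over the last t units of time is minus x (L
      - t). Reflection and a shift by L then bring the integral back to [0,t].\<close>
    have "(?f i has_integral ((x L $ i - x 0 $ i) - (x (L - t) $ i - x 0 $ i))) {L - t..L}"
      by (rule has_integral_Icc_diff[OF d(5) d(5)]) (use i t in auto)
    then have "(?f i has_integral (- x (L - t) $ i)) {L - t..L}" using xL i by simp
    then have "((\<lambda>s. ?f i (- s)) has_integral (- x (L - t) $ i)) {- L..- (L - t)}"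
      by (subst has_integral_reflect_real) simp_all
    from has_integral_shift_real_ivl[OF this, of "- L"]
    have "((\<lambda>s. ?f i (L - s)) has_integral (- x (L - t) $ i)) {0..t}" by simp
    from has_integral_neg[OF this]
    have "((\<lambda>s. - ?f i (L - s)) has_integral x (L - t) $ i) {0..t}" by simp
    then show "((\<lambda>s. \<Sum>j<xdim S. - affine_mat (Am S) (p (L - s)) $$ (i, j) * x (L - s) $ j) has_integral x (L - t) $ i) {0..t}"
    proof (rule has_integral_eq[rotated])
      fix s assume "s \<in> {0..t}"
      then have s: "0 \<le> L - s" using t by simp
      show "- ?f i (L - s) = (\<Sum>j<xdim S. - affine_mat (Am S) (p (L - s)) $$ (i, j) * x (L - s) $ j)"
        using s state_rhs_index[OF S d(4)[OF s] zero_carrier_vec i, of "p (L - s)"] by (simp add: sum_negf)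
    qed
  qed (use K i L in auto)
  then show ?thesis using d(4)[of 0] by (intro eq_vecI) auto
qed

text \<open>The regularity predicate is \<open>True\<close>, since backward uniqueness holds for the
  integral equation itself.\<close>

interpretation ct: lpv_time lebesgue ct_ssol ct_signals ct_scheds ct_solutions "\<lambda>_. True"
proof (unfold_locales, goal_cases)
  case (1 S x y u p)
  then show ?case by (rule ct_solutions_iff)
next
  case (2 S x u p)
  then show ?case using ct_ssolD(1-3)[OF 2(2)] by blast
next
  case (3 m)
  show ?case using ct_signalsD(1) by blast
next
  case (4 P)
  show ?case using ct_schedsD(1) by blast
next
  case (5 v m)
  then show ?case by (rule ct_signals_const)
next
  case (6 q P)
  then show ?case by (rule ct_scheds_const)
next
  case (7 L m w w')
  then show ?case by (rule ct_signals_cat)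
next
  case (8 L P p p')
  then show ?case by (rule ct_scheds_cat)
next
  case (9 S x u p)
  then show ?case by (rule ct_output_signals)
next
  case (10 S x0 u p)
  then show ?case by (rule ct_ssol_exists)
next
  case (11 S x x' u p)
  then show ?case by (rule ct_ssol_unique)
next
  case (12 S x x' u u' p a)
  then show ?case by (intro ct_ssol_lincomb)
next
  case (13 S x x' u u' p p' L)
  then show ?case by (rule ct_ssol_cat)
next
  case (14 S S' Q x u p)
  then show ?case by (intro ct_ssol_image)
next
  case (15 S S' x x' v q c c')
  then show ?case by (rule ct_generator)
next
  case (16 S S' x x' v q)
  then show ?case by (rule ct_initial_output)
next
  case (17 S x p L)
  then show ?case by (intro ct_backward_unique)
next
  case (18 L R)
  show ?case by (rule AE_lebesgue_shift)
next
  case (19 R)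
  then show ?case by (rule AE_lebesgue_bounded)
qed

theorem theorem2:
  shows "(\<forall>S :: 'p::finite lpv_ssa. is_lpv_ssa S \<longrightarrow>
            (ct_regular S \<longrightarrow> (minimal ct_solutions S \<longleftrightarrow> observable ct_solutions S)) \<and>
            (dt_regular S \<longrightarrow> (minimal dt_solutions S \<longleftrightarrow> observable dt_solutions S))) \<and>
         (\<forall>S S' :: 'p lpv_ssa. is_lpv_ssa S \<longrightarrow> is_lpv_ssa S' \<longrightarrow>
            (ct_regular S \<and> ct_regular S' \<and> minimal ct_solutions S \<and> minimal ct_solutions S' \<and>
               (\<exists>B. realization ct_solutions S B \<and> realization ct_solutions S' B) \<longrightarrow>
               (\<exists>T. lpv_isomorphism T S S')) \<and>
            (dt_regular S \<and> dt_regular S' \<and> minimal dt_solutions S \<and> minimal dt_solutions S' \<and>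
               (\<exists>B. realization dt_solutions S B \<and> realization dt_solutions S' B) \<longrightarrow>
               (\<exists>T. lpv_isomorphism T S S')))"
proof (intro conjI allI impI)
  fix S :: "'p lpv_ssa"
  assume S: "is_lpv_ssa S"
  have ne: "interior P \<noteq> {} \<Longrightarrow> P \<noteq> {}" for P :: "(real ^ 'p) set" by auto
  show "minimal ct_solutions S \<longleftrightarrow> observable ct_solutions S" if "ct_regular S"
    using ct.minimal_imp_observable[OF S] ct.observable_imp_minimal[OF S TrueI] ne that
    by (auto simp: ct_regular_def)
  show "minimal dt_solutions S \<longleftrightarrow> observable dt_solutions S" if "dt_regular S"
    using dt.minimal_imp_observable[OF S] dt.observable_imp_minimal[OF S that] ne that
    by (auto simp: dt_regular_def)
next
  fix S S' :: "'p lpv_ssa"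
  assume S: "is_lpv_ssa S" and S': "is_lpv_ssa S'"
  show "\<exists>T. lpv_isomorphism T S S'"
    if "ct_regular S \<and> ct_regular S' \<and> minimal ct_solutions S \<and> minimal ct_solutions S' \<and>
      (\<exists>B. realization ct_solutions S B \<and> realization ct_solutions S' B)"
    using that by (intro ct.minimal_realizations_isomorphic[OF S S' TrueI]) (auto simp: ct_regular_def realization_def)
  show "\<exists>T. lpv_isomorphism T S S'"
    if "dt_regular S \<and> dt_regular S' \<and> minimal dt_solutions S \<and> minimal dt_solutions S' \<and>
      (\<exists>B. realization dt_solutions S B \<and> realization dt_solutions S' B)"
    using that by (intro dt.minimal_realizations_isomorphic[OF S S']) (auto simp: dt_regular_def realization_def)
qed

end
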